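(* Let $L$ be a finite-dimensional solvable Lie algebra over a field $F$. If $L$ is minimal non-$\mathcal{N}$, every maximal subalgebra of $L$ has a nilregular core, and $A/B$ is a complemented chief factor of $L$, then $L/B$ is minimal non-$\mathcal{N}$.
   Context: All Lie algebras are finite-dimensional and solvable over a field $F$. $N(L)$ is the nilradical of $L$; the upper nilpotent series is $N_0(L)=0$, $N_i(L)/N_{i-1}(L)=N(L/N_{i-1}(L))$, and the nilpotent length of $L$ is the smallest integer $m$ with $N_m(L)=L$. $\mathcal{N}(\leq k)$ is the class of Lie algebras of nilpotent length $\leq k$. $L$ is minimal non-$\mathcal{N}(\leq k)$ if every proper subalgebra of $L$, but not $L$ itself, lies in $\mathcal{N}(\leq k)$; $L$ is minimal non-$\mathcal{N}$ if it is minimal non-$\mathcal{N}(\leq k)$ for some $k$, i.e. its nilpotent length is greater than that of each of its proper subalgebras. The core $M_L$ of a subalgebra $M$ is the largest ideal of $L$ contained in $M$. If $F$ has characteristic $p>0$, a subalgebra $U$ of $L$ is nilregular if its nilradical $N(U)$ has nilpotency class less than $p-1$ (a nilpotent algebra $K$ has class $r$ if $K^{r+1}=0$ but $K^r\ne 0$, where $K^1=K$, $K^{i+1}=[K^i,K]$); if $F$ has characteristic zero every subalgebra is regarded as nilregular. For ideals $B\subset A$ of $L$, $A/B$ is a chief factor of $L$ if it is a minimal ideal of $L/B$; it is complemented if there is a maximal subalgebra $M$ of $L$ such that $L=A+M$ and $A\cap M=B$. *)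

theory Defs
  imports "HOL-Algebra.Module" "HOL-Algebra.AbelCoset" "HOL-Algebra.Multiplicative_Group"
begin

section \<open>Lie algebras over a field\<close>

text \<open>
  The fields \<open>mult\<close> and \<open>one\<close> that the record inherits from \<open>module\<close> (and thus from \<open>ring\<close>)
  play no role, as is already the case for modules.
\<close>

record ('a, 'b) lie = "('a, 'b) module" +
  lie_bracket :: "['b, 'b] \<Rightarrow> 'b"  (\<open>\<langle>_,/ _\<rangle>\<index>\<close>)

locale lie_algebra = field F + module F L
    for F :: "('f, 'm) ring_scheme" (structure) and L :: "('f, 'a, 'n) lie_scheme" (structure) +
  assumes bracket_closed:
      "\<lbrakk>x \<in> carrier L; y \<in> carrier L\<rbrakk> \<Longrightarrow> \<langle>x, y\<rangle>\<^bsub>L\<^esub> \<in> carrier L"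
    and bracket_add_left:
      "\<lbrakk>x \<in> carrier L; y \<in> carrier L; z \<in> carrier L\<rbrakk>
        \<Longrightarrow> \<langle>x \<oplus>\<^bsub>L\<^esub> y, z\<rangle>\<^bsub>L\<^esub> = \<langle>x, z\<rangle>\<^bsub>L\<^esub> \<oplus>\<^bsub>L\<^esub> \<langle>y, z\<rangle>\<^bsub>L\<^esub>"
    and bracket_add_right:
      "\<lbrakk>x \<in> carrier L; y \<in> carrier L; z \<in> carrier L\<rbrakk>
        \<Longrightarrow> \<langle>x, y \<oplus>\<^bsub>L\<^esub> z\<rangle>\<^bsub>L\<^esub> = \<langle>x, y\<rangle>\<^bsub>L\<^esub> \<oplus>\<^bsub>L\<^esub> \<langle>x, z\<rangle>\<^bsub>L\<^esub>"
    and bracket_smult_left: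
      "\<lbrakk>a \<in> carrier F; x \<in> carrier L; y \<in> carrier L\<rbrakk>
        \<Longrightarrow> \<langle>a \<odot>\<^bsub>L\<^esub> x, y\<rangle>\<^bsub>L\<^esub> = a \<odot>\<^bsub>L\<^esub> \<langle>x, y\<rangle>\<^bsub>L\<^esub>"
    and bracket_smult_right:
      "\<lbrakk>a \<in> carrier F; x \<in> carrier L; y \<in> carrier L\<rbrakk>
        \<Longrightarrow> \<langle>x, a \<odot>\<^bsub>L\<^esub> y\<rangle>\<^bsub>L\<^esub> = a \<odot>\<^bsub>L\<^esub> \<langle>x, y\<rangle>\<^bsub>L\<^esub>"
    and bracket_self: "x \<in> carrier L \<Longrightarrow> \<langle>x, x\<rangle>\<^bsub>L\<^esub> = \<zero>\<^bsub>L\<^esub>"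
    and jacobi:
      "\<lbrakk>x \<in> carrier L; y \<in> carrier L; z \<in> carrier L\<rbrakk>
        \<Longrightarrow> \<langle>x, \<langle>y, z\<rangle>\<^bsub>L\<^esub>\<rangle>\<^bsub>L\<^esub> \<oplus>\<^bsub>L\<^esub> \<langle>y, \<langle>z, x\<rangle>\<^bsub>L\<^esub>\<rangle>\<^bsub>L\<^esub> \<oplus>\<^bsub>L\<^esub> \<langle>z, \<langle>x, y\<rangle>\<^bsub>L\<^esub>\<rangle>\<^bsub>L\<^esub> = \<zero>\<^bsub>L\<^esub>"

definition lin_span :: "('f, 'm) ring_scheme \<Rightarrow> ('f, 'a, 'n) module_scheme \<Rightarrow> 'a set \<Rightarrow> 'a set"
  where "lin_span F L S = \<Inter>{H. submodule H F L \<and> S \<subseteq> H}"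

definition finite_dimensional :: "('f, 'm) ring_scheme \<Rightarrow> ('f, 'a, 'n) module_scheme \<Rightarrow> bool"
  where "finite_dimensional F L \<longleftrightarrow>
    (\<exists>S. finite S \<and> S \<subseteq> carrier L \<and> lin_span F L S = carrier L)"

text \<open>
  Subalgebras and ideals are subsets of the carrier; a subalgebra \<open>U\<close> is regarded as a Lie algebra
  in its own right through the structure \<open>L\<lparr>carrier := U\<rparr>\<close>.
\<close>

definition lie_subalgebra :: "('f, 'm) ring_scheme \<Rightarrow> ('f, 'a, 'n) lie_scheme \<Rightarrow> 'a set \<Rightarrow> bool"
  where "lie_subalgebra F L U \<longleftrightarrow>
    submodule U F L \<and> (\<forall>x\<in>U. \<forall>y\<in>U. \<langle>x, y\<rangle>\<^bsub>L\<^esub> \<in> U)"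

definition lie_ideal :: "('f, 'm) ring_scheme \<Rightarrow> ('f, 'a, 'n) lie_scheme \<Rightarrow> 'a set \<Rightarrow> bool"
  where "lie_ideal F L I \<longleftrightarrow>
    submodule I F L \<and> (\<forall>x\<in>carrier L. \<forall>y\<in>I. \<langle>x, y\<rangle>\<^bsub>L\<^esub> \<in> I)"

definition lie_quotient :: "('f, 'a, 'n) lie_scheme \<Rightarrow> 'a set \<Rightarrow> ('f, 'a set) lie"
  where "lie_quotient L I =
    \<lparr>carrier = a_rcosets\<^bsub>L\<^esub> I, mult = undefined, one = undefined,
     zero = I, add = set_add L,
     smult = (\<lambda>a X. \<Union>x\<in>X. I +>\<^bsub>L\<^esub> (a \<odot>\<^bsub>L\<^esub> x)),
     lie_bracket = (\<lambda>X Y. \<Union>x\<in>X. \<Union>y\<in>Y. I +>\<^bsub>L\<^esub> \<langle>x, y\<rangle>\<^bsub>L\<^esub>)\<rparr>"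


section \<open>Solvability, nilpotency, nilpotent length\<close>

definition bracket_space ::
    "('f, 'm) ring_scheme \<Rightarrow> ('f, 'a, 'n) lie_scheme \<Rightarrow> 'a set \<Rightarrow> 'a set \<Rightarrow> 'a set"
  where "bracket_space F L A B = lin_span F L {\<langle>x, y\<rangle>\<^bsub>L\<^esub> | x y. x \<in> A \<and> y \<in> B}"

primrec derived_series :: "('f, 'm) ring_scheme \<Rightarrow> ('f, 'a, 'n) lie_scheme \<Rightarrow> nat \<Rightarrow> 'a set"
  where
    "derived_series F L 0 = carrier L"
  | "derived_series F L (Suc i) = bracket_space F L (derived_series F L i) (derived_series F L i)"

definition lie_solvable :: "('f, 'm) ring_scheme \<Rightarrow> ('f, 'a, 'n) lie_scheme \<Rightarrow> bool"
  where "lie_solvable F L \<longleftrightarrow> (\<exists>i. derived_series F L i = {\<zero>\<^bsub>L\<^esub>})"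

text \<open>The index is shifted: \<open>lower_central F L i\<close> is \<open>L\<^sup>i\<^sup>+\<^sup>1\<close> in the convention \<open>L\<^sup>1 = L\<close>.\<close>

primrec lower_central :: "('f, 'm) ring_scheme \<Rightarrow> ('f, 'a, 'n) lie_scheme \<Rightarrow> nat \<Rightarrow> 'a set"
  where
    "lower_central F L 0 = carrier L"
  | "lower_central F L (Suc i) = bracket_space F L (lower_central F L i) (carrier L)"

definition lie_nilpotent :: "('f, 'm) ring_scheme \<Rightarrow> ('f, 'a, 'n) lie_scheme \<Rightarrow> bool"
  where "lie_nilpotent F L \<longleftrightarrow> (\<exists>r. lower_central F L r = {\<zero>\<^bsub>L\<^esub>})"

text \<open>
  The least \<open>r\<close> with \<open>L\<^sup>r\<^sup>+\<^sup>1 = 0\<close>; in particular the zero algebra has class 0.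
  Only meaningful for nilpotent algebras.
\<close>

definition nilpotency_class :: "('f, 'm) ring_scheme \<Rightarrow> ('f, 'a, 'n) lie_scheme \<Rightarrow> nat"
  where "nilpotency_class F L = (LEAST r. lower_central F L r = {\<zero>\<^bsub>L\<^esub>})"

text \<open>Largest with respect to inclusion; it exists when \<open>L\<close> is finite-dimensional.\<close>

definition nilradical :: "('f, 'm) ring_scheme \<Rightarrow> ('f, 'a, 'n) lie_scheme \<Rightarrow> 'a set"
  where "nilradical F L =
    (GREATEST I. lie_ideal F L I \<and> lie_nilpotent F (L\<lparr>carrier := I\<rparr>))"

text \<open>Each term is the preimage in \<open>L\<close> of the nilradical of the quotient by the previous term.\<close>

primrec upper_nilpotent :: "('f, 'm) ring_scheme \<Rightarrow> ('f, 'a, 'n) lie_scheme \<Rightarrow> nat \<Rightarrow> 'a set"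
  where
    "upper_nilpotent F L 0 = {\<zero>\<^bsub>L\<^esub>}"
  | "upper_nilpotent F L (Suc i) =
      {x \<in> carrier L. upper_nilpotent F L i +>\<^bsub>L\<^esub> x
                        \<in> nilradical F (lie_quotient L (upper_nilpotent F L i))}"

text \<open>Only meaningful if the series reaches \<open>L\<close>, as it does for finite-dimensional solvable \<open>L\<close>.\<close>

definition nilpotent_length :: "('f, 'm) ring_scheme \<Rightarrow> ('f, 'a, 'n) lie_scheme \<Rightarrow> nat"
  where "nilpotent_length F L = (LEAST m. upper_nilpotent F L m = carrier L)"

definition nilpotent_length_le ::
    "('f, 'm) ring_scheme \<Rightarrow> nat \<Rightarrow> ('f, 'a, 'n) lie_scheme \<Rightarrow> bool"
  where "nilpotent_length_le F k L \<longleftrightarrow>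
    lie_algebra F L \<and> finite_dimensional F L \<and> lie_solvable F L \<and> nilpotent_length F L \<le> k"

text \<open>The ambient class is that of finite-dimensional solvable Lie algebras.\<close>

definition minimal_non_N_le ::
    "('f, 'm) ring_scheme \<Rightarrow> nat \<Rightarrow> ('f, 'a, 'n) lie_scheme \<Rightarrow> bool"
  where "minimal_non_N_le F k L \<longleftrightarrow>
    lie_algebra F L \<and> finite_dimensional F L \<and> lie_solvable F L \<and>
    (\<forall>U. lie_subalgebra F L U \<and> U \<noteq> carrier L \<longrightarrow> nilpotent_length_le F k (L\<lparr>carrier := U\<rparr>)) \<and>
    \<not> nilpotent_length_le F k L"

definition minimal_non_N :: "('f, 'm) ring_scheme \<Rightarrow> ('f, 'a, 'n) lie_scheme \<Rightarrow> bool"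
  where "minimal_non_N F L \<longleftrightarrow> (\<exists>k. minimal_non_N_le F k L)"


section \<open>Cores, nilregular subalgebras, chief factors\<close>

definition maximal_lie_subalgebra ::
    "('f, 'm) ring_scheme \<Rightarrow> ('f, 'a, 'n) lie_scheme \<Rightarrow> 'a set \<Rightarrow> bool"
  where "maximal_lie_subalgebra F L M \<longleftrightarrow>
    lie_subalgebra F L M \<and> M \<noteq> carrier L \<and>
    (\<forall>U. lie_subalgebra F L U \<and> M \<subseteq> U \<longrightarrow> U = M \<or> U = carrier L)"

definition lie_core :: "('f, 'm) ring_scheme \<Rightarrow> ('f, 'a, 'n) lie_scheme \<Rightarrow> 'a set \<Rightarrow> 'a set"
  where "lie_core F L M = (GREATEST I. lie_ideal F L I \<and> I \<subseteq> M)"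

text \<open>
  The order of \<open>\<one>\<close> in the additive group; \<open>group.ord\<close> is 0 for elements of infinite order, so
  this is 0 exactly in characteristic zero.
\<close>

definition field_char :: "('f, 'm) ring_scheme \<Rightarrow> nat"
  where "field_char F = group.ord (add_monoid F) \<one>\<^bsub>F\<^esub>"

definition nilregular :: "('f, 'm) ring_scheme \<Rightarrow> ('f, 'a, 'n) lie_scheme \<Rightarrow> 'a set \<Rightarrow> bool"
  where "nilregular F L U \<longleftrightarrow>
    (field_char F > 0 \<longrightarrow>
      nilpotency_class F (L\<lparr>carrier := nilradical F (L\<lparr>carrier := U\<rparr>)\<rparr>) < field_char F - 1)"

definition minimal_lie_ideal ::
    "('f, 'm) ring_scheme \<Rightarrow> ('f, 'a, 'n) lie_scheme \<Rightarrow> 'a set \<Rightarrow> bool"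
  where "minimal_lie_ideal F L I \<longleftrightarrow>
    lie_ideal F L I \<and> I \<noteq> {\<zero>\<^bsub>L\<^esub>} \<and>
    (\<forall>J. lie_ideal F L J \<and> J \<subseteq> I \<longrightarrow> J = {\<zero>\<^bsub>L\<^esub>} \<or> J = I)"

definition chief_factor ::
    "('f, 'm) ring_scheme \<Rightarrow> ('f, 'a, 'n) lie_scheme \<Rightarrow> 'a set \<Rightarrow> 'a set \<Rightarrow> bool"
  where "chief_factor F L A B \<longleftrightarrow>
    lie_ideal F L A \<and> lie_ideal F L B \<and> B \<subset> A \<and>
    minimal_lie_ideal F (lie_quotient L B) (carrier (lie_quotient (L\<lparr>carrier := A\<rparr>) B))"

definition complemented_factor ::
    "('f, 'm) ring_scheme \<Rightarrow> ('f, 'a, 'n) lie_scheme \<Rightarrow> 'a set \<Rightarrow> 'a set \<Rightarrow> bool"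
  where "complemented_factor F L A B \<longleftrightarrow>
    (\<exists>M. maximal_lie_subalgebra F L M \<and> carrier L = A <+>\<^bsub>L\<^esub> M \<and> A \<inter> M = B)"

end

theory Submission
  imports Defs "HOL-Computational_Algebra.Primes"
begin

text \<open>
  Write \<open>R j S\<close> for the \<open>j\<close>-th term of the lower nilpotent series of \<open>S\<close>: \<open>R 0 S = S\<close>, and
  \<open>R (j + 1) S\<close> is the intersection of the lower central series of \<open>R j S\<close>. A finite-dimensional
  solvable \<open>S\<close> has nilpotent length at most \<open>k\<close> iff \<open>R k S = 0\<close>. So \<open>R k L\<close> is nonzero while
  \<open>R k S = 0\<close> for all proper subalgebras \<open>S\<close>, and what is needed is an \<open>l\<close> such that \<open>R l L\<close> is not
  contained in \<open>B\<close> while \<open>R l S\<close> is, for all proper \<open>S\<close> above \<open>B\<close>. If \<open>R k L\<close> is not contained in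
  \<open>B\<close>, take \<open>l = k\<close>. Otherwise let \<open>M\<close> be the maximal subalgebra that complements \<open>A / B\<close>.

  In characteristic 2 nilregularity means that the core of \<open>M\<close> has nilradical 0. Then the core is 0,
  hence \<open>B = 0\<close>, contradicting \<open>R k L \<noteq> 0\<close>.

  In other characteristics take the \<open>l\<close> for which \<open>R l L\<close> is not contained in \<open>M\<close> but \<open>R (l + 1) L\<close>
  is. The key is that \<open>R l M\<close> then lies in an ideal \<open>J\<close> of \<open>L\<close> with \<open>R (k - l) J = 0\<close>. By an
  Engel-type argument some \<open>s\<close> in \<open>R (l - 1) M\<close> acts invertibly on the irreducible \<open>M\<close>-module
  \<open>R l L / (R l L \<inter> M)\<close>, and its Fitting one-component \<open>U\<close> complements \<open>M\<close> modulo \<open>J\<close>. The maps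
  \<open>1 + ad u + (ad u)^2 / 2\<close> for \<open>u\<close> in \<open>U\<close> are automorphisms modulo \<open>J\<close> and carry \<open>M\<close> to other
  proper subalgebras, so the images \<open>s u\<close> of \<open>s\<close> all act nilpotently on \<open>J\<close> modulo
  \<open>W = (D \<inter> J) + [J, J]\<close>, where \<open>D\<close> is the largest ideal of \<open>R l L \<inter> M\<close> with \<open>R (k - l) D = 0\<close>.
  Comparing high powers of \<open>ad (s u)\<close> for varying \<open>u\<close> yields that \<open>[U, J]\<close> lies in \<open>W\<close>: over an
  infinite field they are polynomials in the scalar multiples of \<open>u\<close>, and in characteristic \<open>p\<close> the
  \<open>p^e\<close>-th powers are derivations. Since \<open>J\<close> is solvable this forces \<open>J\<close> into \<open>D\<close>.

  Consequently an ideal \<open>I\<close> with \<open>R e I = 0\<close> that is not contained in a maximal subalgebra determines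
  a term of the lower nilpotent series of \<open>L\<close> that is not contained in it either, and comparing the
  levels of \<open>M\<close> and of the other maximal subalgebras above \<open>B\<close> shows that \<open>l\<close> works.
\<close>

section \<open>Subspaces, subalgebras and ideals\<close>

context lie_algebra
begin

abbreviation vadd :: "'a \<Rightarrow> 'a \<Rightarrow> 'a" (infixl \<open>\<^bold>+\<close> 65) where "x \<^bold>+ y \<equiv> x \<oplus>\<^bsub>L\<^esub> y"
abbreviation vneg :: "'a \<Rightarrow> 'a" (\<open>\<^bold>- _\<close> [81] 80) where "\<^bold>- x \<equiv> \<ominus>\<^bsub>L\<^esub> x"
abbreviation vzero :: "'a" (\<open>\<^bold>0\<close>) where "\<^bold>0 \<equiv> \<zero>\<^bsub>L\<^esub>"
abbreviation vsmult :: "'f \<Rightarrow> 'a \<Rightarrow> 'a" (infixr \<open>\<^bold>*\<close> 70) where "a \<^bold>* x \<equiv> a \<odot>\<^bsub>L\<^esub> x"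
abbreviation br :: "'a \<Rightarrow> 'a \<Rightarrow> 'a" (\<open>\<lbrace>_, _\<rbrace>\<close>) where "\<lbrace>x, y\<rbrace> \<equiv> \<langle>x, y\<rangle>\<^bsub>L\<^esub>"
abbreviation ssum :: "'a set \<Rightarrow> 'a set \<Rightarrow> 'a set" (infixl \<open>[+]\<close> 65) where "A [+] B \<equiv> A <+>\<^bsub>L\<^esub> B"
abbreviation brs :: "'a set \<Rightarrow> 'a set \<Rightarrow> 'a set" where "brs A B \<equiv> bracket_space F L A B"
abbreviation sub :: "'a set \<Rightarrow> bool" where "sub H \<equiv> submodule H F L"
abbreviation alg :: "'a set \<Rightarrow> bool" where "alg H \<equiv> lie_subalgebra F L H"
abbreviation ide :: "'a set \<Rightarrow> bool" where "ide H \<equiv> lie_ideal F L H"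

lemma ssum_iff: "x \<in> A [+] B \<longleftrightarrow> (\<exists>a\<in>A. \<exists>b\<in>B. x = a \<^bold>+ b)"
  by (auto simp: set_add_def')

lemma ssumI: "a \<in> A \<Longrightarrow> b \<in> B \<Longrightarrow> a \<^bold>+ b \<in> A [+] B"
  by (auto simp: set_add_def')

lemma ssumE:
  assumes "x \<in> A [+] B" obtains a b where "a \<in> A" "b \<in> B" "x = a \<^bold>+ b"
  using assms by (auto simp: ssum_iff)

lemmas vs_simps = M.a_ac M.minus_add M.minus_minus M.r_neg M.l_neg M.r_neg1 M.r_neg2
  smult_r_distr smult_l_distr smult_r_minus smult_l_minus

lemma sub_carrier: "sub H \<Longrightarrow> H \<subseteq> carrier L"
  and sub_zero: "sub H \<Longrightarrow> \<^bold>0 \<in> H"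
  and sub_add: "sub H \<Longrightarrow> x \<in> H \<Longrightarrow> y \<in> H \<Longrightarrow> x \<^bold>+ y \<in> H"
  and sub_neg: "sub H \<Longrightarrow> x \<in> H \<Longrightarrow> \<^bold>- x \<in> H"
  and sub_smult: "sub H \<Longrightarrow> a \<in> carrier F \<Longrightarrow> x \<in> H \<Longrightarrow> a \<^bold>* x \<in> H"
  using submoduleE[of H] subgroup.one_closed[of H "add_monoid L"] submodule.axioms(1)[of H F L]
  by auto

lemma sub_mem: "sub H \<Longrightarrow> x \<in> H \<Longrightarrow> x \<in> carrier L"
  using sub_carrier by blast

lemma sub_add_cancel:
  assumes "sub H" "x \<in> carrier L" "y \<in> H" "x \<^bold>+ y \<in> H"
  shows "x \<in> H"
proof -
  have "(x \<^bold>+ y) \<^bold>+ \<^bold>- y = x"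
    using assms sub_mem[OF assms(1)] by (simp add: vs_simps)
  moreover have "(x \<^bold>+ y) \<^bold>+ \<^bold>- y \<in> H"
    using sub_add[OF assms(1,4) sub_neg[OF assms(1,3)]] .
  ultimately show ?thesis by (simp only:)
qed

lemma add_eq_zeroD:
  assumes "x \<in> carrier L" "y \<in> carrier L" "x \<^bold>+ y = \<^bold>0"
  shows "x = \<^bold>- y"
  using M.minus_equality[OF assms(3) assms(2,1)] assms by simp

lemma add_neg_eq_zeroD:
  assumes "x \<in> carrier L" "y \<in> carrier L" "x \<^bold>+ \<^bold>- y = \<^bold>0"
  shows "x = y"
  using add_eq_zeroD[of x "\<^bold>- y"] assms by simp

lemma bracket_zero_left [simp]: "x \<in> carrier L \<Longrightarrow> \<lbrace>\<^bold>0, x\<rbrace> = \<^bold>0"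
  using bracket_smult_left[of "\<zero>\<^bsub>F\<^esub>" "\<^bold>0" x] bracket_closed by simp

lemma bracket_zero_right [simp]: "x \<in> carrier L \<Longrightarrow> \<lbrace>x, \<^bold>0\<rbrace> = \<^bold>0"
  using bracket_smult_right[of "\<zero>\<^bsub>F\<^esub>" x "\<^bold>0"] bracket_closed by simp

lemma bracket_anti:
  assumes "x \<in> carrier L" "y \<in> carrier L"
  shows "\<lbrace>x, y\<rbrace> = \<^bold>- \<lbrace>y, x\<rbrace>"
proof -
  have "\<lbrace>x \<^bold>+ y, x \<^bold>+ y\<rbrace> = \<^bold>0"
    using assms bracket_self by simp
  moreover have "\<lbrace>x \<^bold>+ y, x \<^bold>+ y\<rbrace> = \<lbrace>x, y\<rbrace> \<^bold>+ \<lbrace>y, x\<rbrace>"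
    using assms
    by (subst bracket_add_left) (simp_all add: bracket_add_right bracket_self bracket_closed)
  ultimately show ?thesis
    using assms bracket_closed by (intro add_eq_zeroD) simp_all
qed

lemma bracket_neg_right:
  assumes "x \<in> carrier L" "y \<in> carrier L" shows "\<lbrace>x, \<^bold>- y\<rbrace> = \<^bold>- \<lbrace>x, y\<rbrace>"
proof (rule add_eq_zeroD)
  show "\<lbrace>x, \<^bold>- y\<rbrace> \<^bold>+ \<lbrace>x, y\<rbrace> = \<^bold>0"
    using bracket_add_right[of x "\<^bold>- y" y] assms by (simp add: M.l_neg)
qed (use assms bracket_closed in auto)

lemma bracket_neg_left:
  assumes "x \<in> carrier L" "y \<in> carrier L" shows "\<lbrace>\<^bold>- x, y\<rbrace> = \<^bold>- \<lbrace>x, y\<rbrace>"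
proof (rule add_eq_zeroD)
  show "\<lbrace>\<^bold>- x, y\<rbrace> \<^bold>+ \<lbrace>x, y\<rbrace> = \<^bold>0"
    using bracket_add_left[of "\<^bold>- x" x y] assms by (simp add: M.l_neg)
qed (use assms bracket_closed in auto)

lemmas br_simps = bracket_add_left bracket_add_right bracket_neg_left bracket_neg_right
  bracket_smult_left bracket_smult_right bracket_closed

lemma minus_vzero: "\<^bold>- \<^bold>0 = \<^bold>0"
  using M.r_neg[of "\<^bold>0"] by simp

text \<open>With these rules the method \<open>algebra\<close> normalizes by linearity and
  bilinearity. Antisymmetry and the Jacobi identity are not among them and are applied by
  hand.\<close>

lemmas vs_algebra [algebra lie "zero L" "add L" "a_inv L" "a_minus L" "smult L" "lie_bracket L"] =
  M.a_closed M.zero_closed M.a_inv_closed M.minus_closed smult_closed bracket_closed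
  M.a_assoc M.l_zero M.l_neg M.a_comm M.minus_eq M.r_zero M.r_neg M.r_neg2 M.r_neg1
  M.minus_add M.minus_minus M.a_lcomm minus_vzero smult_r_distr smult_l_distr smult_r_minus
  smult_l_minus smult_r_null smult_l_null bracket_zero_left bracket_zero_right
  bracket_add_left bracket_add_right bracket_neg_left bracket_neg_right
  bracket_smult_left bracket_smult_right

lemma jacobi_right:
  assumes "x \<in> carrier L" "y \<in> carrier L" "z \<in> carrier L"
  shows "\<lbrace>x, \<lbrace>y, z\<rbrace>\<rbrace> = \<lbrace>\<lbrace>x, y\<rbrace>, z\<rbrace> \<^bold>+ \<lbrace>y, \<lbrace>x, z\<rbrace>\<rbrace>"
proof -
  have 1: "\<lbrace>y, \<lbrace>z, x\<rbrace>\<rbrace> = \<^bold>- \<lbrace>y, \<lbrace>x, z\<rbrace>\<rbrace>"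
    using assms bracket_anti[of z x] by (simp add: br_simps)
  have 2: "\<lbrace>z, \<lbrace>x, y\<rbrace>\<rbrace> = \<^bold>- \<lbrace>\<lbrace>x, y\<rbrace>, z\<rbrace>"
    using assms bracket_anti[of z "\<lbrace>x, y\<rbrace>"] by (simp add: br_simps)
  have "\<lbrace>x, \<lbrace>y, z\<rbrace>\<rbrace> \<^bold>+ \<^bold>- (\<lbrace>\<lbrace>x, y\<rbrace>, z\<rbrace> \<^bold>+ \<lbrace>y, \<lbrace>x, z\<rbrace>\<rbrace>) = \<^bold>0"
    using jacobi[OF assms] assms unfolding 1 2 by algebra
  moreover have "\<lbrace>x, \<lbrace>y, z\<rbrace>\<rbrace> \<in> carrier L" "\<lbrace>\<lbrace>x, y\<rbrace>, z\<rbrace> \<^bold>+ \<lbrace>y, \<lbrace>x, z\<rbrace>\<rbrace> \<in> carrier L"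
    using assms bracket_closed by simp_all
  ultimately show ?thesis by (rule add_neg_eq_zeroD[rotated 2])
qed

lemma jacobi_left:
  assumes "x \<in> carrier L" "y \<in> carrier L" "z \<in> carrier L"
  shows "\<lbrace>\<lbrace>x, y\<rbrace>, z\<rbrace> = \<lbrace>x, \<lbrace>y, z\<rbrace>\<rbrace> \<^bold>+ \<^bold>- \<lbrace>y, \<lbrace>x, z\<rbrace>\<rbrace>"
  unfolding jacobi_right[OF assms] using assms by algebra

lemma sub_Int: "sub H \<Longrightarrow> sub K \<Longrightarrow> sub (H \<inter> K)"
  by (rule submoduleI) (auto intro: sub_zero sub_add sub_neg sub_smult dest: sub_mem)

lemma sub_Inter:
  assumes "S \<noteq> {}" "\<And>H. H \<in> S \<Longrightarrow> sub H" shows "sub (\<Inter>S)"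
  using assms sub_carrier
  by (intro submoduleI) (blast, simp_all add: sub_zero sub_add sub_neg sub_smult)

lemma sub_trivial: "sub {\<^bold>0}"
  by (rule submoduleI) auto

lemma sub_ssum:
  assumes "sub H" "sub K"
  shows "sub (H [+] K)"
proof (rule submoduleI)
  note c = sub_mem[OF assms(1)] sub_mem[OF assms(2)]
  show "H [+] K \<subseteq> carrier L" using c by (auto simp: ssum_iff)
  show "\<^bold>0 \<in> H [+] K" using ssumI[OF sub_zero[OF assms(1)] sub_zero[OF assms(2)]] by simp
  fix x assume "x \<in> H [+] K"
  then obtain h k where x: "h \<in> H" "k \<in> K" "x = h \<^bold>+ k" by (auto simp: ssum_iff)
  have "\<^bold>- x = \<^bold>- h \<^bold>+ \<^bold>- k" using x c by (simp add: vs_simps)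
  then show "\<^bold>- x \<in> H [+] K" using x assms ssumI sub_neg by simp
  { fix y assume "y \<in> H [+] K"
    then obtain h' k' where y: "h' \<in> H" "k' \<in> K" "y = h' \<^bold>+ k'" by (auto simp: ssum_iff)
    have "x \<^bold>+ y = (h \<^bold>+ h') \<^bold>+ (k \<^bold>+ k')" using x y c by (simp add: vs_simps)
    then show "x \<^bold>+ y \<in> H [+] K" using x y assms ssumI sub_add by simp }
  fix a assume "a \<in> carrier F"
  then show "a \<^bold>* x \<in> H [+] K" using x c assms ssumI sub_smult by (simp add: vs_simps)
qed

lemma ssum_upper1: "sub H \<Longrightarrow> sub K \<Longrightarrow> H \<subseteq> H [+] K"
  using ssumI[of _ H "\<^bold>0" K] sub_zero[of K] sub_mem[of H] by fastforce

lemma ssum_upper2: "sub H \<Longrightarrow> sub K \<Longrightarrow> K \<subseteq> H [+] K"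
  using ssumI[of "\<^bold>0" H _ K] sub_zero[of H] sub_mem[of K] by fastforce

lemma ssum_least: "sub W \<Longrightarrow> H \<subseteq> W \<Longrightarrow> K \<subseteq> W \<Longrightarrow> H [+] K \<subseteq> W"
  using sub_add[of W] by (auto simp: ssum_iff subset_iff)

lemma ssum_mono: "H \<subseteq> H' \<Longrightarrow> K \<subseteq> K' \<Longrightarrow> H [+] K \<subseteq> H' [+] K'"
  by (force simp: ssum_iff)

lemma sub_preimage:
  assumes "sub W" "sub V" "\<And>x. x \<in> V \<Longrightarrow> f x \<in> carrier L"
    and "\<And>x y. x \<in> V \<Longrightarrow> y \<in> V \<Longrightarrow> f (x \<^bold>+ y) = f x \<^bold>+ f y"
    and "\<And>a x. a \<in> carrier F \<Longrightarrow> x \<in> V \<Longrightarrow> f (a \<^bold>* x) = a \<^bold>* f x"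
  shows "sub {x \<in> V. f x \<in> W}"
proof (rule submoduleI)
  have V: "\<And>x. x \<in> V \<Longrightarrow> x \<in> carrier L" using assms sub_mem by blast
  have z: "f \<^bold>0 = \<^bold>0"
    using assms(5)[of "\<zero>\<^bsub>F\<^esub>" "\<^bold>0"] assms(3)[of "\<^bold>0"] sub_zero[OF assms(2)] by simp
  then show "\<^bold>0 \<in> {x \<in> V. f x \<in> W}" using assms sub_zero by simp
  fix x assume x: "x \<in> {x \<in> V. f x \<in> W}"
  have "f (\<^bold>- x) = \<^bold>- f x"
    using assms(5)[of "\<ominus>\<^bsub>F\<^esub> \<one>\<^bsub>F\<^esub>" x] x V assms(3) by (simp add: smult_l_minus)
  then show "\<^bold>- x \<in> {x \<in> V. f x \<in> W}" using x assms sub_neg by auto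
qed (use assms sub_mem sub_add sub_smult in auto)

lemma sub_image:
  assumes "sub V" "\<And>x. x \<in> V \<Longrightarrow> f x \<in> carrier L"
    and "\<And>x y. x \<in> V \<Longrightarrow> y \<in> V \<Longrightarrow> f (x \<^bold>+ y) = f x \<^bold>+ f y"
    and "\<And>a x. a \<in> carrier F \<Longrightarrow> x \<in> V \<Longrightarrow> f (a \<^bold>* x) = a \<^bold>* f x"
  shows "sub (f ` V)"
proof (rule submoduleI)
  have V: "\<And>x. x \<in> V \<Longrightarrow> x \<in> carrier L" using assms sub_mem by blast
  have "f \<^bold>0 = \<^bold>0"
    using assms(4)[of "\<zero>\<^bsub>F\<^esub>" "\<^bold>0"] assms(2)[of "\<^bold>0"] sub_zero[OF assms(1)] by simp
  then show "\<^bold>0 \<in> f ` V" using sub_zero[OF assms(1)] by (metis imageI)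
  show "f ` V \<subseteq> carrier L" using assms by auto
  fix x assume "x \<in> f ` V"
  then obtain v where v: "v \<in> V" "x = f v" by auto
  have "f (\<^bold>- v) = \<^bold>- f v"
    using assms(4)[of "\<ominus>\<^bsub>F\<^esub> \<one>\<^bsub>F\<^esub>" v] v V assms(2) by (simp add: smult_l_minus)
  then show "\<^bold>- x \<in> f ` V" using v sub_neg[OF assms(1), of v] by (intro image_eqI[of _ _ "\<^bold>- v"]) auto
  { fix y assume "y \<in> f ` V"
    then obtain w where "w \<in> V" "y = f w" by auto
    then show "x \<^bold>+ y \<in> f ` V"
      using v assms(3)[of v w] sub_add[OF assms(1), of v w] by (intro image_eqI[of _ _ "v \<^bold>+ w"]) auto }
  fix a assume "a \<in> carrier F"
  then show "a \<^bold>* x \<in> f ` V" using v assms(4)[of a v] sub_smult[OF assms(1), of a v]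
    by (intro image_eqI[of _ _ "a \<^bold>* v"]) auto
qed

section \<open>Linear spans and bracket spaces\<close>

lemma lin_span_least: "sub W \<Longrightarrow> S \<subseteq> W \<Longrightarrow> lin_span F L S \<subseteq> W"
  unfolding lin_span_def by blast

lemma lin_span_upper: "S \<subseteq> lin_span F L S"
  unfolding lin_span_def by blast

lemma sub_lin_span: "S \<subseteq> carrier L \<Longrightarrow> sub (lin_span F L S)"
  unfolding lin_span_def using carrier_is_submodule by (intro sub_Inter) auto

lemma brs_least: "sub W \<Longrightarrow> (\<And>x y. x \<in> A \<Longrightarrow> y \<in> B \<Longrightarrow> \<lbrace>x, y\<rbrace> \<in> W) \<Longrightarrow> brs A B \<subseteq> W"
  unfolding bracket_space_def by (rule lin_span_least) auto

lemma brsI: "x \<in> A \<Longrightarrow> y \<in> B \<Longrightarrow> \<lbrace>x, y\<rbrace> \<in> brs A B"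
  unfolding bracket_space_def by (rule subsetD[OF lin_span_upper]) auto

lemma sub_brs: "A \<subseteq> carrier L \<Longrightarrow> B \<subseteq> carrier L \<Longrightarrow> sub (brs A B)"
  unfolding bracket_space_def by (rule sub_lin_span) (auto intro: bracket_closed)

lemma sub_brs': "sub A \<Longrightarrow> sub B \<Longrightarrow> sub (brs A B)"
  using sub_brs sub_carrier by simp

lemma brs_mono: "A \<subseteq> A' \<Longrightarrow> B \<subseteq> B' \<Longrightarrow> A' \<subseteq> carrier L \<Longrightarrow> B' \<subseteq> carrier L \<Longrightarrow> brs A B \<subseteq> brs A' B'"
  by (rule brs_least[OF sub_brs]) (auto intro: brsI)

lemma br_swap: "sub W \<Longrightarrow> x \<in> carrier L \<Longrightarrow> y \<in> carrier L \<Longrightarrow> \<lbrace>x, y\<rbrace> \<in> W \<Longrightarrow> \<lbrace>y, x\<rbrace> \<in> W"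
  using bracket_anti[of y x] sub_neg by auto

lemma sub_br_right: "sub W \<Longrightarrow> x \<in> carrier L \<Longrightarrow> sub {y \<in> carrier L. \<lbrace>x, y\<rbrace> \<in> W}"
  by (rule sub_preimage[OF _ carrier_is_submodule]) (auto simp: br_simps)

text \<open>The Jacobi identity makes \<open>ad x\<close> a derivation, so it maps a generator
  [a, b] to [[x, a], b] + [a, [x, b]].\<close>

lemma brs_norm:
  assumes "A \<subseteq> carrier L" "B \<subseteq> carrier L" "x \<in> carrier L"
    and "\<And>a. a \<in> A \<Longrightarrow> \<lbrace>x, a\<rbrace> \<in> A" "\<And>b. b \<in> B \<Longrightarrow> \<lbrace>x, b\<rbrace> \<in> B"
    and "z \<in> brs A B"
  shows "\<lbrace>x, z\<rbrace> \<in> brs A B"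
proof -
  have s: "sub (brs A B)" by (rule sub_brs[OF assms(1,2)])
  have "brs A B \<subseteq> {y \<in> carrier L. \<lbrace>x, y\<rbrace> \<in> brs A B}"
  proof (rule brs_least[OF sub_br_right[OF s assms(3)]])
    fix a b assume ab: "a \<in> A" "b \<in> B"
    then have c: "a \<in> carrier L" "b \<in> carrier L" using assms by auto
    have "\<lbrace>x, \<lbrace>a, b\<rbrace>\<rbrace> = \<lbrace>\<lbrace>x, a\<rbrace>, b\<rbrace> \<^bold>+ \<lbrace>a, \<lbrace>x, b\<rbrace>\<rbrace>"
      using jacobi_right assms(3) c by blast
    then show "\<lbrace>a, b\<rbrace> \<in> {y \<in> carrier L. \<lbrace>x, y\<rbrace> \<in> brs A B}"
      using ab c assms(4,5) brsI sub_add[OF s] bracket_closed by simp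
  qed
  then show ?thesis using assms(6) by blast
qed

section \<open>Subalgebras and ideals\<close>

lemma ideI: "sub I \<Longrightarrow> (\<And>x y. x \<in> carrier L \<Longrightarrow> y \<in> I \<Longrightarrow> \<lbrace>x, y\<rbrace> \<in> I) \<Longrightarrow> ide I"
  by (simp add: lie_ideal_def)
lemma ide_sub: "ide I \<Longrightarrow> sub I" by (simp add: lie_ideal_def)
lemma ide_br: "ide I \<Longrightarrow> x \<in> carrier L \<Longrightarrow> y \<in> I \<Longrightarrow> \<lbrace>x, y\<rbrace> \<in> I" by (simp add: lie_ideal_def)
lemma ide_br': "ide I \<Longrightarrow> x \<in> I \<Longrightarrow> y \<in> carrier L \<Longrightarrow> \<lbrace>x, y\<rbrace> \<in> I"
  using br_swap[of I y x] ide_sub ide_br sub_mem by blast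
lemma algI: "sub I \<Longrightarrow> (\<And>x y. x \<in> I \<Longrightarrow> y \<in> I \<Longrightarrow> \<lbrace>x, y\<rbrace> \<in> I) \<Longrightarrow> alg I"
  by (simp add: lie_subalgebra_def)
lemma alg_sub: "alg I \<Longrightarrow> sub I" by (simp add: lie_subalgebra_def)
lemma alg_br: "alg I \<Longrightarrow> x \<in> I \<Longrightarrow> y \<in> I \<Longrightarrow> \<lbrace>x, y\<rbrace> \<in> I" by (simp add: lie_subalgebra_def)
lemma ide_alg: "ide I \<Longrightarrow> alg I"
  using sub_mem by (auto simp: lie_ideal_def lie_subalgebra_def)
lemma alg_carrier: "alg (carrier L)"
  using carrier_is_submodule bracket_closed by (auto simp: lie_subalgebra_def)
lemma ide_carrier: "ide (carrier L)"
  using carrier_is_submodule bracket_closed by (auto simp: lie_ideal_def)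
lemma ide_zero: "ide {\<^bold>0}"
  using sub_trivial by (auto intro: ideI)
lemma alg_ssum:
  assumes "alg S" "sub I" "\<And>x y. x \<in> S \<Longrightarrow> y \<in> I \<Longrightarrow> \<lbrace>x, y\<rbrace> \<in> I"
    and "\<And>x y. x \<in> I \<Longrightarrow> y \<in> I \<Longrightarrow> \<lbrace>x, y\<rbrace> \<in> S [+] I"
  shows "alg (S [+] I)"
proof (rule algI)
  note sS = alg_sub[OF assms(1)]
  show s: "sub (S [+] I)" using sS assms(2) by (rule sub_ssum)
  have up: "S \<subseteq> S [+] I" "I \<subseteq> S [+] I"
    using ssum_upper1 ssum_upper2 sS assms(2) by auto
  fix x y assume "x \<in> S [+] I" "y \<in> S [+] I"
  then obtain a i b j where 1: "a \<in> S" "i \<in> I" "x = a \<^bold>+ i" "b \<in> S" "j \<in> I" "y = b \<^bold>+ j"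
    by (auto simp: ssum_iff)
  then have c: "a \<in> carrier L" "i \<in> carrier L" "b \<in> carrier L" "j \<in> carrier L"
    using sub_mem sS assms(2) by auto
  have "\<lbrace>i, b\<rbrace> \<in> I" using br_swap[OF assms(2), of b i] assms(3) 1 c by simp
  moreover have "\<lbrace>x, y\<rbrace> = (\<lbrace>a, b\<rbrace> \<^bold>+ \<lbrace>i, b\<rbrace>) \<^bold>+ (\<lbrace>a, j\<rbrace> \<^bold>+ \<lbrace>i, j\<rbrace>)"
    using 1 c by (simp add: br_simps)
  ultimately show "\<lbrace>x, y\<rbrace> \<in> S [+] I"
    using sub_add[OF s] up alg_br[OF assms(1)] assms(3,4) 1 by (simp add: subset_iff)
qed

lemma alg_ssum_ide: "alg S \<Longrightarrow> ide I \<Longrightarrow> alg (S [+] I)"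
  using ide_sub[of I] sub_mem[OF alg_sub, of S] alg_br[OF ide_alg, of I]
    ssum_upper2[OF alg_sub ide_sub, of S I] ide_br[of I]
  by (intro alg_ssum) blast+

lemma ide_ssum:
  assumes "ide I" "ide J" shows "ide (I [+] J)"
proof (rule ideI)
  show s: "sub (I [+] J)" using assms ide_sub sub_ssum by blast
  fix x y assume "x \<in> carrier L" "y \<in> I [+] J"
  then obtain i j where "i \<in> I" "j \<in> J" "y = i \<^bold>+ j" by (auto simp: ssum_iff)
  moreover have "\<lbrace>x, i\<rbrace> \<in> I" "\<lbrace>x, j\<rbrace> \<in> J"
    using calculation \<open>x \<in> carrier L\<close> assms ide_br by auto
  ultimately show "\<lbrace>x, y\<rbrace> \<in> I [+] J"
    using \<open>x \<in> carrier L\<close> assms sub_mem[OF ide_sub]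
    by (simp add: br_simps ssumI)
qed

lemma ide_brs:
  assumes "ide I" "ide J" shows "ide (brs I J)"
proof (rule ideI)
  show "sub (brs I J)" using assms ide_sub sub_brs' by simp
  fix x y assume "x \<in> carrier L" "y \<in> brs I J"
  then show "\<lbrace>x, y\<rbrace> \<in> brs I J"
    using assms by (intro brs_norm[of I J]) (simp_all add: ide_br sub_carrier[OF ide_sub])
qed

lemma ide_Inter: "S \<noteq> {} \<Longrightarrow> (\<And>H. H \<in> S \<Longrightarrow> ide H) \<Longrightarrow> ide (\<Inter>S)"
  by (intro ideI sub_Inter) (auto intro: ide_sub ide_br)

text \<open>Normalization is linear in the normalizing element, so two summands suffice. Later
  \<open>P\<close> is a maximal subalgebra, and \<open>Q\<close> is an ideal outside it or the
  subspace \<open>U\<close>.\<close>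

lemma ide_of_ssum:
  assumes "sub X" "sub P" "sub Q" "P [+] Q = carrier L"
    and "\<And>p x. p \<in> P \<Longrightarrow> x \<in> X \<Longrightarrow> \<lbrace>p, x\<rbrace> \<in> X" "\<And>p x. p \<in> Q \<Longrightarrow> x \<in> X \<Longrightarrow> \<lbrace>p, x\<rbrace> \<in> X"
  shows "ide X"
proof (rule ideI[OF assms(1)])
  fix x y assume "x \<in> carrier L" "y \<in> X"
  then obtain p q where "p \<in> P" "q \<in> Q" "x = p \<^bold>+ q" using assms(4) ssum_iff by blast
  moreover have "\<lbrace>x, y\<rbrace> = \<lbrace>p, y\<rbrace> \<^bold>+ \<lbrace>q, y\<rbrace>"
    using calculation \<open>y \<in> X\<close> assms(1-3) sub_mem by (auto intro!: bracket_add_left)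
  ultimately show "\<lbrace>x, y\<rbrace> \<in> X"
    using assms(5,6) \<open>y \<in> X\<close> sub_add[OF assms(1)] by simp
qed

lemma modular:
  assumes "sub X" "sub Y" "sub Z" "X \<subseteq> Z" "Z \<subseteq> X [+] Y"
  shows "Z = X [+] (Y \<inter> Z)"
proof
  show "X [+] (Y \<inter> Z) \<subseteq> Z" using assms by (intro ssum_least) auto
  show "Z \<subseteq> X [+] (Y \<inter> Z)"
  proof
    fix z assume z: "z \<in> Z"
    then obtain x y where xy: "x \<in> X" "y \<in> Y" "z = x \<^bold>+ y" using assms(5) ssum_iff by blast
    then have "y \<in> Z"
      using sub_add_cancel[OF assms(3), of y x] assms(4) z M.a_comm[of x y]
        sub_mem[OF assms(1), of x] sub_mem[OF assms(2), of y] by auto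
    then show "z \<in> X [+] (Y \<inter> Z)" using xy ssumI by blast
  qed
qed

end

section \<open>Dimension counting by pivots\<close>

context lie_algebra
begin

lemma lin_span_insert:
  assumes "v \<in> carrier L" "S \<subseteq> carrier L" "h \<in> lin_span F L (insert v S)"
  obtains x a where "x \<in> lin_span F L S" "a \<in> carrier F" "h = x \<^bold>+ a \<^bold>* v"
proof -
  let ?T = "(\<lambda>a. a \<^bold>* v) ` carrier F"
  have T: "sub ?T"
  proof (rule submoduleI)
    show "\<^bold>0 \<in> ?T" using assms(1) by (intro image_eqI[of _ _ "\<zero>\<^bsub>F\<^esub>"]) auto
    show "?T \<subseteq> carrier L" using assms(1) by auto
    fix x assume "x \<in> ?T"
    then obtain a where a: "a \<in> carrier F" "x = a \<^bold>* v" by auto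
    show "\<^bold>- x \<in> ?T"
      using a assms(1) by (intro image_eqI[of _ _ "\<ominus>\<^bsub>F\<^esub> a"]) (auto simp: smult_l_minus)
    { fix y assume "y \<in> ?T"
      then obtain b where b: "b \<in> carrier F" "y = b \<^bold>* v" by auto
      show "x \<^bold>+ y \<in> ?T"
        using a b assms(1) by (intro image_eqI[of _ _ "a \<oplus>\<^bsub>F\<^esub> b"]) (auto simp: smult_l_distr) }
    fix c assume "c \<in> carrier F"
    then show "c \<^bold>* x \<in> ?T"
      using a assms(1) by (intro image_eqI[of _ _ "c \<otimes>\<^bsub>F\<^esub> a"]) (auto simp: smult_assoc1)
  qed
  have "v \<in> ?T" using assms(1) by (intro image_eqI[of _ _ "\<one>\<^bsub>F\<^esub>"]) auto
  then have "lin_span F L (insert v S) \<subseteq> lin_span F L S [+] ?T"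
    using ssum_upper1[OF sub_lin_span[OF assms(2)] T] ssum_upper2[OF sub_lin_span[OF assms(2)] T]
      lin_span_upper[of S]
    by (intro lin_span_least sub_ssum sub_lin_span assms T) auto
  then show ?thesis using assms(3) that by (auto simp: ssum_iff subset_iff)
qed

text \<open>The function \<open>d\<close> counts the pivots of a subspace with respect to a fixed flag.\<close>

lemma dim_exists:
  assumes "finite_dimensional F L"
  obtains d :: "'a set \<Rightarrow> nat" and N where "\<And>H. d H \<le> N"
    and "\<And>H K. sub H \<Longrightarrow> sub K \<Longrightarrow> H \<subset> K \<Longrightarrow> d H < d K"
proof -
  obtain S where S: "finite S" "S \<subseteq> carrier L" "lin_span F L S = carrier L"
    using assms unfolding finite_dimensional_def by blast
  obtain vs where vs: "set vs = S" using finite_list[OF S(1)] by blast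
  define V where "V i = lin_span F L (set (take i vs))" for i
  define piv where "piv H = {i. i < length vs \<and> (\<exists>h\<in>H. h \<in> V (Suc i) \<and> h \<notin> V i)}" for H
  have Vs: "sub (V i)" for i
    unfolding V_def using set_take_subset[of i vs] S vs by (intro sub_lin_span) auto
  have piv: "K \<subseteq> H" if "sub H" "sub K" "H \<subseteq> K" and piv_le: "piv K \<subseteq> piv H" for H K
  proof -
    have "i \<le> length vs \<Longrightarrow> K \<inter> V i \<subseteq> H" for i
    proof (induction i)
      case 0
      have "V 0 \<subseteq> {\<^bold>0}" unfolding V_def by (intro lin_span_least sub_trivial) auto
      then show ?case using sub_zero[OF that(1)] by auto
    next
      case (Suc i)
      show ?case
      proof
        fix h assume h: "h \<in> K \<inter> V (Suc i)"
        show "h \<in> H"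
        proof (cases "h \<in> V i")
          case True then show ?thesis using h Suc by auto
        next
          case False
          then have "i \<in> piv K" using h Suc unfolding piv_def by auto
          then have "i \<in> piv H" using piv_le by blast
          then obtain g where g: "g \<in> H" "g \<in> V (Suc i)" "g \<notin> V i" unfolding piv_def by auto
          let ?v = "vs ! i"
          have v: "?v \<in> carrier L" using Suc vs S by (auto dest: nth_mem)
          have st: "set (take (Suc i) vs) = insert ?v (set (take i vs))"
            using Suc by (simp add: take_Suc_conv_app_nth)
          have ti: "set (take i vs) \<subseteq> carrier L" using set_take_subset[of i vs] S vs by auto
          obtain x a where x: "x \<in> V i" "a \<in> carrier F" "h = x \<^bold>+ a \<^bold>* ?v"
            using lin_span_insert[OF v ti] h unfolding V_def st by blast
          obtain y b where y: "y \<in> V i" "b \<in> carrier F" "g = y \<^bold>+ b \<^bold>* ?v"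
            using lin_span_insert[OF v ti] g unfolding V_def st by blast
          have xy: "x \<in> carrier L" "y \<in> carrier L" using x y sub_mem[OF Vs] by auto
          have "b \<noteq> \<zero>\<^bsub>F\<^esub>" using y g v xy by auto
          then obtain c where c: "c \<in> carrier F" "c \<otimes>\<^bsub>F\<^esub> b = \<one>\<^bsub>F\<^esub>"
            using y field_Units Units_l_inv_ex[of b] Units_closed by blast
          \<comment> \<open>Gaussian elimination: \<open>c\<close> is the inverse of
            \<open>b\<close>, so adding \<open>?m\<close> times \<open>g\<close> to \<open>h\<close>
            cancels the multiple of \<open>?v\<close> and leaves an element of \<open>V i\<close>,
            where the induction hypothesis applies.\<close>
          let ?m = "\<ominus>\<^bsub>F\<^esub> (a \<otimes>\<^bsub>F\<^esub> c)"
          have m: "?m \<in> carrier F" using x c by simp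
          have "(a \<otimes>\<^bsub>F\<^esub> c) \<otimes>\<^bsub>F\<^esub> b = a" using x y c by (simp add: m_assoc)
          then have "?m \<^bold>* (b \<^bold>* ?v) = \<^bold>- (a \<^bold>* ?v)"
            using x y c v by (simp add: smult_assoc1[symmetric] l_minus smult_l_minus)
          then have "h \<^bold>+ ?m \<^bold>* g = x \<^bold>+ ?m \<^bold>* y"
            using x y xy v m by (simp add: smult_r_distr vs_simps)
          then have "h \<^bold>+ ?m \<^bold>* g \<in> V i"
            using x y m sub_add[OF Vs] sub_smult[OF Vs] by simp
          moreover have "h \<^bold>+ ?m \<^bold>* g \<in> K"
            using h g that m sub_add[OF that(2)] sub_smult[OF that(2)] by auto
          ultimately have "h \<^bold>+ ?m \<^bold>* g \<in> H" using Suc by auto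
          then show ?thesis
            using sub_add_cancel[OF that(1), of h "?m \<^bold>* g"] sub_smult[OF that(1) m g(1)] h sub_mem[OF that(2)]
            by auto
        qed
      qed
    qed
    from this[of "length vs"] have "K \<inter> carrier L \<subseteq> H" using S vs unfolding V_def by simp
    then show ?thesis using sub_mem[OF that(2)] by auto
  qed
  have fin: "finite (piv H)" for H unfolding piv_def by simp
  show ?thesis
  proof (rule that[of "\<lambda>H. card (piv H)" "length vs"])
    show "card (piv H) \<le> length vs" for H
      using card_mono[of "{..<length vs}" "piv H"] unfolding piv_def by auto
    fix H K assume HK: "sub H" "sub K" "H \<subset> K"
    then have "piv H \<subseteq> piv K" unfolding piv_def by auto
    moreover have "\<not> piv K \<subseteq> piv H" using piv[of H K] HK by auto
    ultimately show "card (piv H) < card (piv K)" using fin by (intro psubset_card_mono) auto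
  qed
qed

end

section \<open>The lower nilpotent series\<close>

text \<open>The series of a subalgebra \<open>S\<close> are formed inside \<open>L\<close>, without changing the carrier.\<close>

primrec lie_lc :: "('f, 'm) ring_scheme \<Rightarrow> ('f, 'a, 'n) lie_scheme \<Rightarrow> 'a set \<Rightarrow> nat \<Rightarrow> 'a set" where
  "lie_lc F L S 0 = S"
| "lie_lc F L S (Suc i) = bracket_space F L (lie_lc F L S i) S"

definition lie_resid :: "('f, 'm) ring_scheme \<Rightarrow> ('f, 'a, 'n) lie_scheme \<Rightarrow> 'a set \<Rightarrow> 'a set" where
  "lie_resid F L S = (\<Inter>i. lie_lc F L S i)"

primrec lie_nres :: "('f, 'm) ring_scheme \<Rightarrow> ('f, 'a, 'n) lie_scheme \<Rightarrow> nat \<Rightarrow> 'a set \<Rightarrow> 'a set" where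
  "lie_nres F L 0 S = S"
| "lie_nres F L (Suc k) S = lie_resid F L (lie_nres F L k S)"

context lie_algebra
begin

abbreviation lc :: "'a set \<Rightarrow> nat \<Rightarrow> 'a set" where "lc S \<equiv> lie_lc F L S"
abbreviation resid :: "'a set \<Rightarrow> 'a set" where "resid S \<equiv> lie_resid F L S"
abbreviation nres :: "nat \<Rightarrow> 'a set \<Rightarrow> 'a set" where "nres k S \<equiv> lie_nres F L k S"

lemma lc_Suc_subset: "alg S \<Longrightarrow> sub (lc S i) \<and> lc S (Suc i) \<subseteq> lc S i"
proof (induction i)
  case 0
  then show ?case using alg_sub alg_br brs_least[of S S S] by simp
next
  case (Suc i)
  then have c: "lc S i \<subseteq> carrier L" "S \<subseteq> carrier L" using sub_carrier alg_sub by auto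
  then have "sub (lc S (Suc i))" using sub_brs by simp
  moreover have "lc S (Suc (Suc i)) \<subseteq> lc S (Suc i)"
    using brs_mono[of "lc S (Suc i)" "lc S i" S S] Suc c by simp
  ultimately show ?case by simp
qed

lemma sub_lc: "alg S \<Longrightarrow> sub (lc S i)" using lc_Suc_subset by blast

lemma lc_antimono: "alg S \<Longrightarrow> i \<le> j \<Longrightarrow> lc S j \<subseteq> lc S i"
  using lift_Suc_antimono_le[of "lc S"] lc_Suc_subset by blast

lemma lc_subset: "alg S \<Longrightarrow> lc S i \<subseteq> S"
  using lc_antimono[of S 0 i] by simp

lemma lc_norm:
  assumes "alg S" "x \<in> carrier L" "\<And>a. a \<in> S \<Longrightarrow> \<lbrace>x, a\<rbrace> \<in> S"
  shows "z \<in> lc S i \<Longrightarrow> \<lbrace>x, z\<rbrace> \<in> lc S i"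
proof (induction i arbitrary: z)
  case (Suc i)
  then show ?case
    using brs_norm[of "lc S i" S x z] sub_carrier[OF sub_lc[OF assms(1)]]
      sub_carrier[OF alg_sub[OF assms(1)]] assms by simp
qed (use assms in simp)

lemma lc_mono: "alg S' \<Longrightarrow> S \<subseteq> S' \<Longrightarrow> lc S i \<subseteq> lc S' i"
proof (induction i)
  case (Suc i)
  then show ?case
    using brs_mono[of "lc S i" "lc S' i" S S'] sub_carrier sub_lc alg_sub by simp
qed simp

lemma sub_resid: "alg S \<Longrightarrow> sub (resid S)"
  unfolding lie_resid_def by (intro sub_Inter) (auto intro: sub_lc)

lemma resid_subset: "alg S \<Longrightarrow> resid S \<subseteq> S"
  unfolding lie_resid_def using lc_subset by blast

lemma resid_norm:
  assumes "alg S" "x \<in> carrier L" "\<And>a. a \<in> S \<Longrightarrow> \<lbrace>x, a\<rbrace> \<in> S" "z \<in> resid S"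
  shows "\<lbrace>x, z\<rbrace> \<in> resid S"
  using assms(4) lc_norm[OF assms(1-3)] unfolding lie_resid_def by auto

lemma resid_mono: "alg S' \<Longrightarrow> S \<subseteq> S' \<Longrightarrow> resid S \<subseteq> resid S'"
  using lc_mono[of S' S] by (auto simp: lie_resid_def)

lemma alg_resid: "alg S \<Longrightarrow> alg (resid S)"
proof (rule algI[OF sub_resid])
  fix x y assume "alg S" "x \<in> resid S" "y \<in> resid S"
  moreover from this have "x \<in> S" using resid_subset by auto
  ultimately show "\<lbrace>x, y\<rbrace> \<in> resid S"
    using resid_norm[of S x y] alg_br[of S x] sub_mem[OF alg_sub] by simp
qed

lemma alg_nres: "alg S \<Longrightarrow> alg (nres k S)"
  by (induction k) (auto intro: alg_resid)

lemma sub_nres: "alg S \<Longrightarrow> sub (nres k S)"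
  by (intro alg_sub alg_nres)

lemma nres_Suc_subset: "alg S \<Longrightarrow> nres (Suc k) S \<subseteq> nres k S"
  using alg_nres resid_subset by simp

lemma nres_antimono: "alg S \<Longrightarrow> i \<le> j \<Longrightarrow> nres j S \<subseteq> nres i S"
  using lift_Suc_antimono_le[of "\<lambda>k. nres k S"] nres_Suc_subset by blast

lemma nres_subset: "alg S \<Longrightarrow> nres k S \<subseteq> S"
  using nres_antimono[of S 0 k] by simp

lemma nres_mono: "alg S \<Longrightarrow> alg S' \<Longrightarrow> S \<subseteq> S' \<Longrightarrow> nres k S \<subseteq> nres k S'"
  by (induction k) (auto intro: resid_mono[THEN subsetD] alg_nres)

lemma nres_norm:
  assumes "alg S" "x \<in> carrier L" "\<And>a. a \<in> S \<Longrightarrow> \<lbrace>x, a\<rbrace> \<in> S"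
  shows "z \<in> nres k S \<Longrightarrow> \<lbrace>x, z\<rbrace> \<in> nres k S"
  using assms by (induction k arbitrary: z) (auto intro: resid_norm alg_nres)

lemma nres_add: "nres (i + j) S = nres i (nres j S)"
  by (induction i) auto

lemma ide_nres: "ide S \<Longrightarrow> ide (nres k S)"
  using nres_norm[of S] by (intro ideI sub_nres) (auto intro: ide_alg ide_br)

lemma nres_zero: "alg S \<Longrightarrow> nres i S = {\<^bold>0} \<Longrightarrow> i \<le> j \<Longrightarrow> nres j S = {\<^bold>0}"
  using nres_antimono[of S i j] sub_zero[OF sub_nres[of S j]] by auto

end

section \<open>Chain conditions in finite dimension\<close>

locale fd_lie = lie_algebra +
  assumes fd: "finite_dimensional F L"
begin

lemma ex_maximal_sub:
  assumes "P H" "\<And>H. P H \<Longrightarrow> sub H"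
  obtains M where "P M" "\<And>K. P K \<Longrightarrow> M \<subseteq> K \<Longrightarrow> K = M"
proof -
  obtain d N where d: "\<And>H. d H \<le> (N::nat)" "\<And>H K. sub H \<Longrightarrow> sub K \<Longrightarrow> H \<subset> K \<Longrightarrow> d H < d K"
    using dim_exists[OF fd] by blast
  obtain M where "P M" "\<And>y. P y \<Longrightarrow> d y \<le> d M"
    using ex_has_greatest_nat[of P H d "Suc N"] assms(1) d(1) by (metis le_imp_less_Suc less_Suc_eq_le)
  then show ?thesis using that[of M] d(2) assms(2) by (metis leD psubsetI)
qed

lemma ex_minimal_sub:
  assumes "P H" "\<And>H. P H \<Longrightarrow> sub H"
  obtains M where "P M" "\<And>K. P K \<Longrightarrow> K \<subseteq> M \<Longrightarrow> K = M"
proof -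
  obtain d N where d: "\<And>H. d H \<le> (N::nat)" "\<And>H K. sub H \<Longrightarrow> sub K \<Longrightarrow> H \<subset> K \<Longrightarrow> d H < d K"
    using dim_exists[OF fd] by blast
  obtain M where "P M" "\<And>y. P y \<Longrightarrow> d M \<le> d y"
    using ex_has_least_nat[of P H d] assms(1) by blast
  then show ?thesis using that[of M] d(2) assms(2) by (metis leD psubsetI)
qed

text \<open>A chain of this kind is strict until it becomes constant, and the length of strict
  chains is bounded by the range of the dimension function. The bound depends on \<open>L\<close>
  alone, so one number serves all chains.\<close>

lemma ex_stab:
  "\<exists>N. \<forall>X. (\<forall>i. sub (X i)) \<and> ((\<forall>i. X (Suc i) \<subseteq> X i) \<or> (\<forall>i. X i \<subseteq> X (Suc i))) \<and>
    (\<forall>i. X (Suc i) = X i \<longrightarrow> X (Suc (Suc i)) = X (Suc i)) \<longrightarrow> (\<forall>n\<ge>N. X n = X N)"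
proof -
  obtain d N where d: "\<And>H. d H \<le> (N::nat)" "\<And>H K. sub H \<Longrightarrow> sub K \<Longrightarrow> H \<subset> K \<Longrightarrow> d H < d K"
    using dim_exists[OF fd] by blast
  have "X n = X (Suc N)" if X: "\<And>i. sub (X i)" "(\<forall>i. X (Suc i) \<subseteq> X i) \<or> (\<forall>i. X i \<subseteq> X (Suc i))"
      and st: "\<And>i. X (Suc i) = X i \<Longrightarrow> X (Suc (Suc i)) = X (Suc i)" and n: "n \<ge> Suc N" for X n
  proof -
    have "\<exists>i\<le>N. X (Suc i) = X i"
    proof (rule ccontr)
      assume "\<not> ?thesis"
      then have ne: "\<And>i. i \<le> N \<Longrightarrow> X (Suc i) \<noteq> X i" by auto
      from X(2) show False
      proof
        assume "\<forall>i. X (Suc i) \<subseteq> X i"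
        then have *: "\<And>i. i \<le> N \<Longrightarrow> d (X (Suc i)) < d (X i)" using d(2)[OF X(1) X(1)] ne by (simp add: psubset_eq eq_commute)
        have "i \<le> Suc N \<Longrightarrow> d (X i) + i \<le> N" for i
        proof (induction i)
          case (Suc i) then show ?case using *[of i] by simp
        qed (use d(1) in simp)
        from this[of "Suc N"] show False by simp
      next
        assume "\<forall>i. X i \<subseteq> X (Suc i)"
        then have *: "\<And>i. i \<le> N \<Longrightarrow> d (X i) < d (X (Suc i))" using d(2)[OF X(1) X(1)] ne by (simp add: psubset_eq eq_commute)
        have "i \<le> Suc N \<Longrightarrow> i \<le> d (X i)" for i
        proof (induction i)
          case (Suc i) then show ?case using *[of i] by simp
        qed simp
        from this[of "Suc N"] show False using d(1)[of "X (Suc N)"] by simp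
      qed
    qed
    then obtain i where i: "i \<le> N" "X (Suc i) = X i" by blast
    have c: "X (Suc (i + j)) = X (i + j)" for j by (induction j) (use i st in auto)
    have "X (i + j) = X i" for j by (induction j) (use c in auto)
    from this[of "n - i"] this[of "Suc N - i"] show ?thesis using n i by simp
  qed
  then show ?thesis by blast
qed

text \<open>A common index from which on all lower central series, and all images and kernels of
  powers of \<open>ad s\<close> modulo invariant subspaces, are stationary.\<close>

definition stab :: nat where
  "stab = (SOME N. \<forall>X. (\<forall>i. sub (X i)) \<and> ((\<forall>i. X (Suc i) \<subseteq> X i) \<or> (\<forall>i. X i \<subseteq> X (Suc i))) \<and>
    (\<forall>i. X (Suc i) = X i \<longrightarrow> X (Suc (Suc i)) = X (Suc i)) \<longrightarrow> (\<forall>n\<ge>N. X n = X N))"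

lemma stab_dec:
  assumes "\<And>i. sub (X i)" "\<And>i. X (Suc i) \<subseteq> X i"
    and "\<And>i. X (Suc i) = X i \<Longrightarrow> X (Suc (Suc i)) = X (Suc i)" "n \<ge> stab"
  shows "X n = X stab"
  using someI_ex[OF ex_stab, folded stab_def] assms by blast

lemma stab_inc:
  assumes "\<And>i. sub (X i)" "\<And>i. X i \<subseteq> X (Suc i)"
    and "\<And>i. X (Suc i) = X i \<Longrightarrow> X (Suc (Suc i)) = X (Suc i)" "n \<ge> stab"
  shows "X n = X stab"
  using someI_ex[OF ex_stab, folded stab_def] assms by blast

lemma resid_eq_lc:
  assumes "alg S" "n \<ge> stab" shows "resid S = lc S n"
proof -
  have eq: "lc S m = lc S stab" if "m \<ge> stab" for m
    using assms(1) lc_Suc_subset that by (intro stab_dec) auto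
  have "lc S n \<subseteq> lc S i" for i
    using eq[of "max n i"] eq[of n] lc_antimono[of S i "max n i"] assms by auto
  then show ?thesis unfolding lie_resid_def by blast
qed

lemma brs_resid: "alg S \<Longrightarrow> brs (resid S) S = resid S"
  using resid_eq_lc[of S stab] resid_eq_lc[of S "Suc stab"] by simp

text \<open>By induction \<open>f\<close> maps each \<open>lc S i\<close> into
  \<open>lc S' i\<close> plus \<open>J\<close>; working at the index \<open>stab\<close> avoids
  interchanging the intersection with the sum. The maps of interest are the identity and the
  truncated exponentials.\<close>

lemma resid_hom_mod:
  assumes S: "alg S" and S': "alg S'" and J: "ide J"
    and lin: "\<And>x. x \<in> S \<Longrightarrow> f x \<in> S' [+] J"
      "\<And>x y. x \<in> S \<Longrightarrow> y \<in> S \<Longrightarrow> f (x \<^bold>+ y) = f x \<^bold>+ f y"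
      "\<And>a x. a \<in> carrier F \<Longrightarrow> x \<in> S \<Longrightarrow> f (a \<^bold>* x) = a \<^bold>* f x"
    and hom: "\<And>x y. x \<in> S \<Longrightarrow> y \<in> S \<Longrightarrow> f \<lbrace>x, y\<rbrace> \<^bold>+ \<^bold>- \<lbrace>f x, f y\<rbrace> \<in> J"
    and z: "z \<in> resid S"
  shows "f z \<in> resid S' [+] J"
proof -
  note sS = alg_sub[OF S] and sS' = alg_sub[OF S'] and sJ = ide_sub[OF J]
  have fc: "f x \<in> carrier L" if "x \<in> S" for x
    using lin(1)[OF that] sub_mem[OF sub_ssum[OF sS' sJ]] by blast
  have "z \<in> lc S i \<Longrightarrow> f z \<in> lc S' i [+] J" for i z
  proof (induction i arbitrary: z)
    case (Suc i)
    let ?W = "lc S' (Suc i) [+] J"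
    have W: "sub ?W" using sub_lc[OF S'] sJ sub_ssum by blast
    have up: "lc S' (Suc i) \<subseteq> ?W" "J \<subseteq> ?W"
      using sub_lc[OF S', of "Suc i"] sJ ssum_upper1 ssum_upper2 by auto
    have "lc S (Suc i) \<subseteq> {z \<in> S. f z \<in> ?W}"
      unfolding lie_lc.simps(2)[of F L S i]
    proof (rule brs_least)
      show "sub {z \<in> S. f z \<in> ?W}" by (rule sub_preimage[OF W sS fc lin(2,3)])
      fix x y assume xy: "x \<in> lc S i" "y \<in> S"
      then have x: "x \<in> S" using lc_subset[OF S] by blast
      obtain a j where a: "a \<in> lc S' i" "j \<in> J" "f x = a \<^bold>+ j"
        using Suc.IH[OF xy(1)] by (auto simp: ssum_iff)
      obtain b k where b: "b \<in> S'" "k \<in> J" "f y = b \<^bold>+ k"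
        using lin(1)[OF xy(2)] by (auto simp: ssum_iff)
      have c: "a \<in> carrier L" "b \<in> carrier L" "j \<in> carrier L" "k \<in> carrier L"
        "f \<lbrace>x, y\<rbrace> \<in> carrier L" "\<lbrace>f x, f y\<rbrace> \<in> carrier L"
        using a b sub_mem[OF sub_lc[OF S']] sub_mem[OF sJ] sub_mem[OF sS'] fc alg_br[OF S x xy(2)]
          bracket_closed x xy fc by auto
      have "\<lbrace>a, b\<rbrace> \<in> ?W" using up a b brsI by auto
      moreover have "\<lbrace>a, k\<rbrace> \<in> ?W" "\<lbrace>j, b\<rbrace> \<in> ?W" "\<lbrace>j, k\<rbrace> \<in> ?W"
        using ide_br[OF J] ide_br'[OF J] a b c up by auto
      moreover have "\<lbrace>f x, f y\<rbrace> = \<lbrace>a, b\<rbrace> \<^bold>+ (\<lbrace>a, k\<rbrace> \<^bold>+ (\<lbrace>j, b\<rbrace> \<^bold>+ \<lbrace>j, k\<rbrace>))"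
        unfolding a(3) b(3) using c(1-4) by algebra
      ultimately have "\<lbrace>f x, f y\<rbrace> \<in> ?W" using sub_add[OF W] by simp
      moreover have "f \<lbrace>x, y\<rbrace> \<^bold>+ \<^bold>- \<lbrace>f x, f y\<rbrace> \<in> ?W" using hom[OF x xy(2)] up by auto
      moreover have "f \<lbrace>x, y\<rbrace> = (f \<lbrace>x, y\<rbrace> \<^bold>+ \<^bold>- \<lbrace>f x, f y\<rbrace>) \<^bold>+ \<lbrace>f x, f y\<rbrace>"
        using c(5,6) by (simp add: M.a_assoc M.l_neg)
      ultimately have "f \<lbrace>x, y\<rbrace> \<in> ?W" using sub_add[OF W] by metis
      then show "\<lbrace>x, y\<rbrace> \<in> {z \<in> S. f z \<in> ?W}" using alg_br[OF S x xy(2)] by simp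
    qed
    then show ?case using Suc.prems by blast
  qed (use lin in simp)
  then show ?thesis using z resid_eq_lc[OF S order_refl] resid_eq_lc[OF S' order_refl] by auto
qed

lemma nres_hom_mod:
  assumes S: "alg S" and S': "alg S'" and J: "ide J"
    and lin: "\<And>x. x \<in> S \<Longrightarrow> f x \<in> S' [+] J"
      "\<And>x y. x \<in> S \<Longrightarrow> y \<in> S \<Longrightarrow> f (x \<^bold>+ y) = f x \<^bold>+ f y"
      "\<And>a x. a \<in> carrier F \<Longrightarrow> x \<in> S \<Longrightarrow> f (a \<^bold>* x) = a \<^bold>* f x"
    and hom: "\<And>x y. x \<in> S \<Longrightarrow> y \<in> S \<Longrightarrow> f \<lbrace>x, y\<rbrace> \<^bold>+ \<^bold>- \<lbrace>f x, f y\<rbrace> \<in> J"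
  shows "z \<in> nres k S \<Longrightarrow> f z \<in> nres k S' [+] J"
proof (induction k arbitrary: z)
  case (Suc k)
  have n: "\<And>x. x \<in> nres k S \<Longrightarrow> x \<in> S" using nres_subset[OF S] by blast
  show ?case unfolding lie_nres.simps(2)
    by (rule resid_hom_mod[OF alg_nres[OF S] alg_nres[OF S'] J Suc.IH])
      (use lin hom n Suc.prems in auto)
qed (use lin in simp)

text \<open>The identity on \<open>S [+] I\<close> is a homomorphism into \<open>S\<close> modulo
  \<open>I\<close>, so \<open>nres_hom_mod\<close> applies to it.\<close>

lemma nres_ssum_ide:
  assumes "alg S" "ide I"
  shows "nres k (S [+] I) \<subseteq> nres k S [+] I"
proof
  note a = alg_ssum_ide[OF assms]
  fix z assume "z \<in> nres k (S [+] I)"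
  then show "z \<in> nres k S [+] I"
    using nres_hom_mod[OF a assms(1,2), of "\<lambda>x. x" z k] sub_mem[OF alg_sub[OF a]]
      sub_zero[OF ide_sub[OF assms(2)]] by (simp add: M.r_neg bracket_closed)
qed

text \<open>An iterated bracket of elements of two ideals lies in the \<open>a\<close>-th term of the one lower
  central series and the \<open>b\<close>-th term of the other, \<open>a\<close> and \<open>b\<close> being the numbers of factors.\<close>

lemma lc_ssum:
  assumes X: "alg X" and I: "alg I" "I \<subseteq> X" "\<And>x y. x \<in> X \<Longrightarrow> y \<in> I \<Longrightarrow> \<lbrace>x, y\<rbrace> \<in> I"
    and J: "alg J" "J \<subseteq> X" "\<And>x y. x \<in> X \<Longrightarrow> y \<in> J \<Longrightarrow> \<lbrace>x, y\<rbrace> \<in> J"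
    and P: "P 0 = X" "\<And>a. P (Suc a) = lc I a" and Q: "Q 0 = X" "\<And>a. Q (Suc a) = lc J a"
  shows "sub W \<Longrightarrow> (\<And>a b. a + b = Suc n \<Longrightarrow> P a \<inter> Q b \<subseteq> W) \<Longrightarrow> lc (I [+] J) n \<subseteq> W"
proof (induction n arbitrary: W)
  case 0
  have "I \<subseteq> W" "J \<subseteq> W" using 0(2)[of 1 0] 0(2)[of 0 1] P(1) P(2)[of 0] Q(1) Q(2)[of 0] I(2) J(2) by auto
  then show ?case using ssum_least[OF 0(1)] by simp
next
  case (Suc n)
  note sX = alg_sub[OF X] and s = alg_sub[OF I(1)] alg_sub[OF J(1)]
  have c: "\<And>x. x \<in> X \<Longrightarrow> x \<in> carrier L" using sub_mem[OF sX] .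
  have lcI: "\<lbrace>z, x\<rbrace> \<in> lc I a" if "z \<in> lc I a" "x \<in> X" for z x a
    using lc_norm[OF I(1) c[OF that(2)] I(3)[OF that(2)] that(1)] that
      br_swap[OF sub_lc[OF I(1)] c, of x z] sub_mem[OF sub_lc[OF I(1)]] by blast
  have lcJ: "\<lbrace>z, x\<rbrace> \<in> lc J a" if "z \<in> lc J a" "x \<in> X" for z x a
    using lc_norm[OF J(1) c[OF that(2)] J(3)[OF that(2)] that(1)] that
      br_swap[OF sub_lc[OF J(1)] c, of x z] sub_mem[OF sub_lc[OF J(1)]] by blast
  have PX: "P a \<subseteq> X" "Q a \<subseteq> X" for a
    using P Q lc_subset[OF I(1)] lc_subset[OF J(1)] I(2) J(2) by (cases a; force)+
  have P1: "\<lbrace>z, x\<rbrace> \<in> P a" if "z \<in> P a" "x \<in> X" for z x a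
    using that P lcI alg_br[OF X] by (cases a) auto
  have Q1: "\<lbrace>z, x\<rbrace> \<in> Q a" if "z \<in> Q a" "x \<in> X" for z x a
    using that Q lcJ alg_br[OF X] by (cases a) auto
  have P2: "\<lbrace>z, x\<rbrace> \<in> P (Suc a)" if "z \<in> P a" "x \<in> I" for z x a
    using that P lcI[of _ 0] br_swap[OF s(1) c, of z x] I(3) brsI[of z "lc I (a - 1)" x I] sub_mem[OF s(1)]
    by (cases a) auto
  have Q2: "\<lbrace>z, x\<rbrace> \<in> Q (Suc a)" if "z \<in> Q a" "x \<in> J" for z x a
    using that Q br_swap[OF s(2) c, of z x] J(3) brsI[of z "lc J (a - 1)" x J] sub_mem[OF s(2)]
    by (cases a) auto
  \<comment> \<open>The elements of \<open>X\<close> whose brackets with all of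
    \<open>I [+] J\<close> lie in \<open>W\<close>. One more bracket raises one of the two counts,
    so \<open>?W\<close> meets the induction hypothesis with one factor less.\<close>
  let ?W = "\<Inter>y\<in>I [+] J. {z \<in> X. \<lbrace>z, y\<rbrace> \<in> W}"
  have sIJ: "sub (I [+] J)" using s sub_ssum by blast
  have "sub {z \<in> X. \<lbrace>z, y\<rbrace> \<in> W}" if "y \<in> I [+] J" for y
    using that sub_mem[OF sIJ] c by (intro sub_preimage[OF Suc.prems(1) sX]) (auto simp: br_simps)
  then have W: "sub ?W" using sub_zero[OF sIJ] by (intro sub_Inter) auto
  have "lc (I [+] J) n \<subseteq> ?W"
  proof (rule Suc.IH[OF W])
    fix a b assume ab: "a + b = Suc n"
    show "P a \<inter> Q b \<subseteq> ?W"
    proof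
      fix z assume z: "z \<in> P a \<inter> Q b"
      have "\<lbrace>z, y\<rbrace> \<in> W" if "y \<in> I [+] J" for y
      proof -
        obtain i j where ij: "i \<in> I" "j \<in> J" "y = i \<^bold>+ j" using \<open>y \<in> I [+] J\<close> by (auto simp: ssum_iff)
        have "\<lbrace>z, i\<rbrace> \<in> P (Suc a) \<inter> Q b" using z ij P2 Q1 I(2) by auto
        then have 1: "\<lbrace>z, i\<rbrace> \<in> W" using Suc.prems(2)[of "Suc a" b] ab by auto
        have "\<lbrace>z, j\<rbrace> \<in> P a \<inter> Q (Suc b)" using z ij P1 Q2 J(2) by auto
        then have 2: "\<lbrace>z, j\<rbrace> \<in> W" using Suc.prems(2)[of a "Suc b"] ab by auto
        have "\<lbrace>z, y\<rbrace> = \<lbrace>z, i\<rbrace> \<^bold>+ \<lbrace>z, j\<rbrace>"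
          using z ij PX c I(2) J(2) by (auto simp: subset_iff intro!: bracket_add_right)
        then show ?thesis using 1 2 sub_add[OF Suc.prems(1)] by simp
      qed
      then show "z \<in> ?W" using z PX by auto
    qed
  qed
  then show ?case
    unfolding lie_lc.simps by (intro brs_least Suc.prems(1)) auto
qed

text \<open>Among the \<open>2 * stab + 3\<close> factors of a bracket in the term with index
  \<open>2 * stab + 2\<close>, at least \<open>Suc stab\<close> come from the same ideal, so the
  bracket lies in the residual of that ideal.\<close>

lemma resid_ssum:
  assumes X: "alg X" and I: "alg I" "I \<subseteq> X" "\<And>x y. x \<in> X \<Longrightarrow> y \<in> I \<Longrightarrow> \<lbrace>x, y\<rbrace> \<in> I"
    and J: "alg J" "J \<subseteq> X" "\<And>x y. x \<in> X \<Longrightarrow> y \<in> J \<Longrightarrow> \<lbrace>x, y\<rbrace> \<in> J"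
  shows "alg (I [+] J)" and "resid (I [+] J) \<subseteq> resid I [+] resid J"
proof -
  have s: "sub (I [+] J)" by (rule sub_ssum[OF alg_sub[OF I(1)] alg_sub[OF J(1)]])
  show a: "alg (I [+] J)"
    using I J ssum_upper2[OF alg_sub alg_sub, OF I(1) J(1)] alg_br[OF J(1)]
    by (intro alg_ssum) (auto simp: alg_sub)
  let ?W = "resid I [+] resid J"
  have W: "sub ?W" by (rule sub_ssum[OF sub_resid[OF I(1)] sub_resid[OF J(1)]])
  have up: "resid I \<subseteq> ?W" "resid J \<subseteq> ?W"
    using ssum_upper1 ssum_upper2 sub_resid I J by auto
  let ?P = "\<lambda>a. case a of 0 \<Rightarrow> X | Suc b \<Rightarrow> lc I b" and ?Q = "\<lambda>a. case a of 0 \<Rightarrow> X | Suc b \<Rightarrow> lc J b"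
  have "lc (I [+] J) (2 * stab + 2) \<subseteq> ?W"
  proof (rule lc_ssum[OF X I J, of ?P ?Q])
    fix a b assume "a + b = Suc (2 * stab + 2)"
    then have "a \<ge> Suc stab \<or> b \<ge> Suc stab" by arith
    then show "?P a \<inter> ?Q b \<subseteq> ?W"
    proof
      assume "a \<ge> Suc stab"
      then show ?thesis using resid_eq_lc[OF I(1)] up by (cases a) auto
    next
      assume "b \<ge> Suc stab"
      then show ?thesis using resid_eq_lc[OF J(1)] up by (cases b) auto
    qed
  qed (use W in auto)
  then show "resid (I [+] J) \<subseteq> ?W" using resid_eq_lc[OF a, of "2 * stab + 2"] by simp
qed

lemma nres_ssum:
  assumes X: "alg X" and I: "alg I" "I \<subseteq> X" "\<And>x y. x \<in> X \<Longrightarrow> y \<in> I \<Longrightarrow> \<lbrace>x, y\<rbrace> \<in> I"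
    and J: "alg J" "J \<subseteq> X" "\<And>x y. x \<in> X \<Longrightarrow> y \<in> J \<Longrightarrow> \<lbrace>x, y\<rbrace> \<in> J"
  shows "nres k (I [+] J) \<subseteq> nres k I [+] nres k J"
proof (induction k)
  case (Suc k)
  note c = sub_mem[OF alg_sub[OF X]]
  have nI: "nres k I \<subseteq> X" "nres k J \<subseteq> X" using nres_subset I J by blast+
  have "\<lbrace>x, y\<rbrace> \<in> nres k I" if "x \<in> X" "y \<in> nres k I" for x y
    using nres_norm[OF I(1) c[OF that(1)] I(3)[OF that(1)] that(2)] .
  moreover have "\<lbrace>x, y\<rbrace> \<in> nres k J" if "x \<in> X" "y \<in> nres k J" for x y
    using nres_norm[OF J(1) c[OF that(1)] J(3)[OF that(1)] that(2)] .
  ultimately have "alg (nres k I [+] nres k J)"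
    "resid (nres k I [+] nres k J) \<subseteq> nres (Suc k) I [+] nres (Suc k) J"
    using resid_ssum[OF X alg_nres[OF I(1)] nI(1) _ alg_nres[OF J(1)] nI(2)] by simp_all
  then show ?case using resid_mono[OF _ Suc] by fastforce
qed simp

lemma nres_ssum_zero:
  assumes "alg X" "alg I" "I \<subseteq> X" "\<And>x y. x \<in> X \<Longrightarrow> y \<in> I \<Longrightarrow> \<lbrace>x, y\<rbrace> \<in> I"
    and "alg J" "J \<subseteq> X" "\<And>x y. x \<in> X \<Longrightarrow> y \<in> J \<Longrightarrow> \<lbrace>x, y\<rbrace> \<in> J"
    and "nres k I = {\<^bold>0}" "nres k J = {\<^bold>0}"
  shows "nres k (I [+] J) = {\<^bold>0}"
proof -
  have "nres k (I [+] J) \<subseteq> {\<^bold>0}"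
    using nres_ssum[of X I J k] assms by (auto simp: ssum_iff)
  then show ?thesis
    using sub_zero[OF sub_nres[OF resid_ssum(1)[OF assms(1-7)]], of k] by auto
qed

section \<open>Maximal subalgebras\<close>

lemma ex_maximal_alg:
  assumes "alg S" "S \<noteq> carrier L"
  obtains M where "maximal_lie_subalgebra F L M" "S \<subseteq> M"
proof -
  obtain M where "alg M \<and> M \<noteq> carrier L \<and> S \<subseteq> M"
      "\<And>K. alg K \<and> K \<noteq> carrier L \<and> S \<subseteq> K \<Longrightarrow> M \<subseteq> K \<Longrightarrow> K = M"
    by (rule ex_maximal_sub[of "\<lambda>M. alg M \<and> M \<noteq> carrier L \<and> S \<subseteq> M" S])
      (use assms alg_sub in auto)
  then show ?thesis using that[of M] unfolding maximal_lie_subalgebra_def by (metis subset_trans)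
qed

lemma maximal_ssum:
  assumes "maximal_lie_subalgebra F L M" "ide I" "\<not> I \<subseteq> M"
  shows "M [+] I = carrier L"
proof -
  have M: "alg M" "\<And>U. alg U \<Longrightarrow> M \<subseteq> U \<Longrightarrow> U = M \<or> U = carrier L"
    using assms(1) unfolding maximal_lie_subalgebra_def by auto
  have "M \<subseteq> M [+] I" "I \<subseteq> M [+] I"
    using ssum_upper1 ssum_upper2 alg_sub[OF M(1)] ide_sub[OF assms(2)] by auto
  then show ?thesis using M(2)[OF alg_ssum_ide[OF M(1) assms(2)]] assms(3) by auto
qed

end

section \<open>Solvable algebras\<close>

locale solv_lie = fd_lie +
  assumes solv: "lie_solvable F L"
begin

text \<open>Substituting \<open>eq\<close> into itself places \<open>S\<close> in \<open>I\<close>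
  plus every term of the derived series of \<open>L\<close>, and that series reaches 0. Most uses of
  solvability go through this lemma.\<close>

lemma solvable_sum:
  assumes S: "sub S" and I: "sub I" "I \<subseteq> S" "\<And>x y. x \<in> S \<Longrightarrow> y \<in> I \<Longrightarrow> \<lbrace>x, y\<rbrace> \<in> I"
    and eq: "S \<subseteq> I [+] brs S S"
  shows "S = I"
proof -
  have "sub (derived_series F L k) \<and> S \<subseteq> I [+] derived_series F L k" for k
  proof (induction k)
    case 0
    then show ?case using carrier_is_submodule S sub_carrier ssum_upper2[OF I(1) carrier_is_submodule] by auto
  next
    case (Suc k)
    let ?D = "derived_series F L k" and ?D' = "derived_series F L (Suc k)"
    have SD: "S \<subseteq> I [+] ?D" using Suc by simp
    have D: "sub ?D'" using Suc sub_brs' by simp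
    have W: "sub (I [+] ?D')" using D I(1) sub_ssum by blast
    have up: "I \<subseteq> I [+] ?D'" "?D' \<subseteq> I [+] ?D'" using D I(1) ssum_upper1 ssum_upper2 by auto
    have "brs S S \<subseteq> I [+] ?D'"
    proof (rule brs_least[OF W])
      fix x y assume xy: "x \<in> S" "y \<in> S"
      obtain i d where i: "i \<in> I" "d \<in> ?D" "x = i \<^bold>+ d"
        using xy SD by (blast elim: ssumE)
      obtain j e where j: "j \<in> I" "e \<in> ?D" "y = j \<^bold>+ e"
        using xy SD by (blast elim: ssumE)
      have c: "i \<in> carrier L" "d \<in> carrier L" "j \<in> carrier L" "e \<in> carrier L" "x \<in> carrier L" "y \<in> carrier L"
        using i j Suc sub_mem[OF I(1)] sub_mem[of ?D] sub_mem[OF S] xy by auto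
      have 1: "\<lbrace>i, y\<rbrace> \<in> I" using br_swap[OF I(1) c(6,1) I(3)] i xy by blast
      have "d \<in> S" using sub_add_cancel[OF S c(2), of i] i xy I(2) c M.a_comm[of i d] by auto
      then have 2: "\<lbrace>d, j\<rbrace> \<in> I" using I(3) j by blast
      have 3: "\<lbrace>d, e\<rbrace> \<in> ?D'" using i j brsI by simp
      have "\<lbrace>x, y\<rbrace> = \<lbrace>i, y\<rbrace> \<^bold>+ (\<lbrace>d, j\<rbrace> \<^bold>+ \<lbrace>d, e\<rbrace>)"
        unfolding i(3) j(3) using c(1-4) by algebra
      then show "\<lbrace>x, y\<rbrace> \<in> I [+] ?D'" using 1 2 3 up sub_add[OF W] by (simp add: subset_iff)
    qed
    then have "I [+] brs S S \<subseteq> I [+] ?D'" using ssum_least[OF W] up by blast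
    then show ?case using D eq by auto
  qed
  moreover obtain k where "derived_series F L k = {\<^bold>0}" using solv unfolding lie_solvable_def by blast
  ultimately have "S \<subseteq> I [+] {\<^bold>0}" by metis
  then have "S \<subseteq> I" using sub_mem[OF I(1)] by (auto simp: ssum_iff)
  then show ?thesis using I(2) by blast
qed

lemma resid_subset_brs: "resid S \<subseteq> brs S S"
  unfolding lie_resid_def using lie_lc.simps[of F L S] by (metis INF_lower UNIV_I)

lemma resid_proper:
  assumes "alg S" "resid S = S" shows "S = {\<^bold>0}"
proof (rule solvable_sum[OF alg_sub[OF assms(1)] sub_trivial])
  have b: "sub (brs S S)" using sub_brs' alg_sub[OF assms(1)] by blast
  show "S \<subseteq> {\<^bold>0} [+] brs S S" using resid_subset_brs[of S] assms ssum_upper2[OF sub_trivial b] by auto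
qed (use sub_zero[OF alg_sub[OF assms(1)]] sub_mem[OF alg_sub[OF assms(1)]] in auto)

lemma nres_terminates: "\<exists>k. nres k (carrier L) = {\<^bold>0}"
proof -
  have "sub (derived_series F L k) \<and> nres k (carrier L) \<subseteq> derived_series F L k" for k
  proof (induction k)
    case (Suc k)
    have "resid (nres k (carrier L)) \<subseteq> brs (nres k (carrier L)) (nres k (carrier L))"
      by (rule resid_subset_brs)
    also have "\<dots> \<subseteq> derived_series F L (Suc k)"
      using Suc sub_carrier[of "derived_series F L k"] by (simp add: brs_mono)
    finally show ?case using Suc sub_brs' by simp
  qed (simp add: carrier_is_submodule)
  moreover obtain k where "derived_series F L k = {\<^bold>0}" using solv unfolding lie_solvable_def by blast
  ultimately have "nres k (carrier L) \<subseteq> {\<^bold>0}" by metis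
  then show ?thesis using sub_zero[OF sub_nres[OF alg_carrier]] by blast
qed

end

section \<open>Fitting components\<close>

context lie_algebra
begin

abbreviation ad :: "'a \<Rightarrow> 'a \<Rightarrow> 'a" where "ad s \<equiv> \<lambda>x. \<lbrace>s, x\<rbrace>"

lemma adn_Suc: "(ad s ^^ Suc n) x = \<lbrace>s, (ad s ^^ n) x\<rbrace>"
  by simp

lemma adn_Suc': "(ad s ^^ Suc n) x = (ad s ^^ n) \<lbrace>s, x\<rbrace>"
  by (simp only: funpow_Suc_right o_def)

lemma adn_in: "(\<And>x. x \<in> V \<Longrightarrow> \<lbrace>s, x\<rbrace> \<in> V) \<Longrightarrow> x \<in> V \<Longrightarrow> (ad s ^^ n) x \<in> V"
  by (induction n) auto

lemma adn_closed: "s \<in> carrier L \<Longrightarrow> x \<in> carrier L \<Longrightarrow> (ad s ^^ n) x \<in> carrier L"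
  by (rule adn_in) (auto intro: bracket_closed)

lemma adn_add: "s \<in> carrier L \<Longrightarrow> x \<in> carrier L \<Longrightarrow> y \<in> carrier L \<Longrightarrow>
    (ad s ^^ n) (x \<^bold>+ y) = (ad s ^^ n) x \<^bold>+ (ad s ^^ n) y"
  by (induction n) (auto simp: adn_closed bracket_add_right)

lemma adn_smult: "s \<in> carrier L \<Longrightarrow> a \<in> carrier F \<Longrightarrow> x \<in> carrier L \<Longrightarrow>
    (ad s ^^ n) (a \<^bold>* x) = a \<^bold>* (ad s ^^ n) x"
  by (induction n) (auto simp: adn_closed bracket_smult_right)

lemma adn_neg: "s \<in> carrier L \<Longrightarrow> x \<in> carrier L \<Longrightarrow> (ad s ^^ n) (\<^bold>- x) = \<^bold>- (ad s ^^ n) x"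
  by (induction n) (auto simp: adn_closed bracket_neg_right)

lemma adn_image:
  assumes "s \<in> carrier L" "sub V" shows "sub ((ad s ^^ n) ` V)"
  using assms sub_mem[OF assms(2)]
  by (intro sub_image) (auto simp: adn_closed adn_add adn_smult)

lemma adn_preimage:
  assumes "s \<in> carrier L" "sub V" "sub W" shows "sub {v \<in> V. (ad s ^^ n) v \<in> W}"
  using assms sub_mem[OF assms(2)]
  by (intro sub_preimage) (auto simp: adn_closed adn_add adn_smult)

lemma adn_image_subset:
  assumes "\<And>x. x \<in> V \<Longrightarrow> \<lbrace>s, x\<rbrace> \<in> V"
  shows "(ad s ^^ Suc n) ` V \<subseteq> (ad s ^^ n) ` V"
  using assms by (auto simp only: adn_Suc' image_subset_iff intro!: imageI)

lemma adn_lc: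
  assumes "alg Y" "y \<in> Y" "z \<in> Y" shows "(ad y ^^ n) z \<in> lc Y n"
proof (induction n)
  case (Suc n)
  have "\<lbrace>(ad y ^^ n) z, y\<rbrace> \<in> lc Y (Suc n)" using Suc assms(2) brsI by simp
  then show ?case
    using br_swap[OF sub_lc[OF assms(1)], of "(ad y ^^ n) z" y "Suc n"] assms
      sub_mem[OF alg_sub[OF assms(1)]] adn_closed by simp
qed (use assms in simp)

text \<open>If \<open>ad s\<close> acts nilpotently on \<open>m\<close>, up to elements that annihilate \<open>V\<close> modulo \<open>J\<close>, then \<open>m\<close>
  respects the two Fitting components of \<open>V\<close> modulo \<open>J\<close> with respect to \<open>ad s\<close>.\<close>

lemma br_adn_image:
  assumes s: "s \<in> carrier L" and V: "sub V" and J: "sub J"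
    and sV: "\<And>x. x \<in> V \<Longrightarrow> \<lbrace>s, x\<rbrace> \<in> V" and sJ: "\<And>x. x \<in> J \<Longrightarrow> \<lbrace>s, x\<rbrace> \<in> J"
    and M: "M \<subseteq> carrier L" "\<And>m. m \<in> M \<Longrightarrow> \<lbrace>s, m\<rbrace> \<in> M"
    and MV: "\<And>m x. m \<in> M \<Longrightarrow> x \<in> V \<Longrightarrow> \<lbrace>m, x\<rbrace> \<in> V"
  shows "m \<in> M \<Longrightarrow> (\<And>x. x \<in> V \<Longrightarrow> \<lbrace>(ad s ^^ i) m, x\<rbrace> \<in> J) \<Longrightarrow> x \<in> V \<Longrightarrow>
    \<lbrace>m, (ad s ^^ (k + i)) x\<rbrace> \<in> (ad s ^^ k) ` V [+] J"
proof (induction i arbitrary: m k)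
  case 0
  have "\<lbrace>m, (ad s ^^ k) x\<rbrace> \<in> J" using 0(2)[of "(ad s ^^ k) x"] adn_in[of V s x k] sV 0(3) by simp
  then show ?case using ssum_upper2[OF adn_image[OF s V] J] by auto
next
  case (Suc i)
  note IH = Suc.IH and prems = Suc.prems
  show ?case
  proof (induction k)
    case 0
    have "\<lbrace>m, (ad s ^^ Suc i) x\<rbrace> \<in> V" using MV[OF prems(1)] adn_in[of V s x "Suc i"] sV prems(3) by blast
    then show ?case using ssum_upper1[OF V J] by (auto simp del: funpow.simps simp: image_ident)
  next
    case (Suc k)
    \<comment> \<open>Since [m, [s, y]] = [s, [m, y]] - [[s, m], y], the claim reduces to a smaller
      \<open>k\<close> and to [s, m], which needs one power of \<open>ad s\<close> less.\<close>
    let ?y = "(ad s ^^ (k + Suc i)) x" and ?W = "(ad s ^^ Suc k) ` V [+] J"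
    have W: "sub ?W" using adn_image[OF s V] J sub_ssum by blast
    have c: "m \<in> carrier L" "?y \<in> carrier L"
      using M(1) \<open>m \<in> M\<close> adn_closed[OF s] sub_mem[OF V \<open>x \<in> V\<close>] by (auto simp del: funpow.simps)
    have "\<lbrace>\<lbrace>s, m\<rbrace>, (ad s ^^ (Suc k + i)) x\<rbrace> \<in> ?W"
    proof (rule IH)
      show "\<lbrace>s, m\<rbrace> \<in> M" using M(2) \<open>m \<in> M\<close> .
      show "\<lbrace>(ad s ^^ i) \<lbrace>s, m\<rbrace>, x\<rbrace> \<in> J" if "x \<in> V" for x
        using prems(2)[OF that] by (simp only: adn_Suc')
    qed fact
    then have 1: "\<lbrace>\<lbrace>s, m\<rbrace>, ?y\<rbrace> \<in> ?W" by simp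
    obtain v j where vj: "v \<in> V" "j \<in> J" "\<lbrace>m, ?y\<rbrace> = (ad s ^^ k) v \<^bold>+ j"
      using Suc.IH by (auto elim!: ssumE)
    have vc: "(ad s ^^ k) v \<in> carrier L" "j \<in> carrier L"
      using vj sub_mem[OF V] sub_mem[OF J] adn_closed[OF s] by auto
    have "\<lbrace>s, \<lbrace>m, ?y\<rbrace>\<rbrace> = (ad s ^^ Suc k) v \<^bold>+ \<lbrace>s, j\<rbrace>"
      unfolding vj(3) using bracket_add_right[OF s vc] by simp
    then have 2: "\<lbrace>s, \<lbrace>m, ?y\<rbrace>\<rbrace> \<in> ?W" using vj(1,2) sJ by (auto intro!: ssumI simp del: funpow.simps)
    have "\<lbrace>m, \<lbrace>s, ?y\<rbrace>\<rbrace> = \<lbrace>s, \<lbrace>m, ?y\<rbrace>\<rbrace> \<^bold>+ \<^bold>- \<lbrace>\<lbrace>s, m\<rbrace>, ?y\<rbrace>"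
      unfolding jacobi_right[OF s c] using s c by algebra
    then show ?case using sub_add[OF W 2 sub_neg[OF W 1]] by simp
  qed
qed

lemma br_adn_kernel:
  assumes s: "s \<in> carrier L" and V: "sub V" and J: "sub J"
    and sV: "\<And>x. x \<in> V \<Longrightarrow> \<lbrace>s, x\<rbrace> \<in> V" and sJ: "\<And>x. x \<in> J \<Longrightarrow> \<lbrace>s, x\<rbrace> \<in> J"
    and M: "M \<subseteq> carrier L" "\<And>m. m \<in> M \<Longrightarrow> \<lbrace>s, m\<rbrace> \<in> M"
    and MJ: "\<And>m x. m \<in> M \<Longrightarrow> x \<in> J \<Longrightarrow> \<lbrace>m, x\<rbrace> \<in> J"
  shows "m \<in> M \<Longrightarrow> (\<And>x. x \<in> V \<Longrightarrow> \<lbrace>(ad s ^^ i) m, x\<rbrace> \<in> J) \<Longrightarrow> v \<in> V \<Longrightarrow> (ad s ^^ k) v \<in> J \<Longrightarrow>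
    (ad s ^^ (i + k)) \<lbrace>m, v\<rbrace> \<in> J"
proof (induction "i + k" arbitrary: i k m v)
  case 0
  then show ?case using MJ by simp
next
  case (Suc n)
  note c = s subsetD[OF M(1) Suc(3)] sub_mem[OF V Suc(5)]
  show ?case
  proof (cases "i = 0 \<or> k = 0")
    case True
    then have "\<lbrace>m, v\<rbrace> \<in> J" using Suc.prems MJ by auto
    then show ?thesis using adn_in[of J s] sJ by blast
  next
    case False
    \<comment> \<open>By the Leibniz rule one power of \<open>ad s\<close> falls on \<open>m\<close>
      or on \<open>v\<close>, and either way \<open>i + k\<close> decreases.\<close>
    then obtain i' k' where ik: "i = Suc i'" "k = Suc k'" by (metis not0_implies_Suc)
    have 1: "(ad s ^^ (i' + k)) \<lbrace>\<lbrace>s, m\<rbrace>, v\<rbrace> \<in> J"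
      using Suc.prems Suc.hyps(2) ik by (intro Suc.hyps) (auto simp: M simp del: funpow.simps simp: adn_Suc')
    have 2: "(ad s ^^ (i + k')) \<lbrace>m, \<lbrace>s, v\<rbrace>\<rbrace> \<in> J"
      using Suc.prems Suc.hyps(2) ik sV
      by (intro Suc.hyps) (auto simp del: funpow.simps simp: adn_Suc')
    have "(ad s ^^ (i + k)) \<lbrace>m, v\<rbrace> = (ad s ^^ (i' + k)) \<lbrace>s, \<lbrace>m, v\<rbrace>\<rbrace>"
      unfolding ik add_Suc by (rule adn_Suc')
    also have "\<dots> = (ad s ^^ (i' + k)) \<lbrace>\<lbrace>s, m\<rbrace>, v\<rbrace> \<^bold>+ (ad s ^^ (i' + k)) \<lbrace>m, \<lbrace>s, v\<rbrace>\<rbrace>"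
      using c by (simp add: jacobi_right[OF c] adn_add bracket_closed)
    finally show ?thesis using 1 2 ik sub_add[OF J] by simp
  qed
qed

end

section \<open>The Fitting decomposition modulo an invariant subspace\<close>

context fd_lie
begin

lemma adn_image_stab:
  assumes s: "s \<in> carrier L" and V: "sub V" "\<And>x. x \<in> V \<Longrightarrow> \<lbrace>s, x\<rbrace> \<in> V"
    and W: "sub W" "\<And>x. x \<in> W \<Longrightarrow> \<lbrace>s, x\<rbrace> \<in> W" and n: "n \<ge> stab"
  shows "(ad s ^^ n) ` V [+] W = (ad s ^^ stab) ` V [+] W"
proof (rule stab_dec[OF _ _ _ n])
  fix i
  show "sub ((ad s ^^ i) ` V [+] W)" using adn_image[OF s V(1)] W(1) sub_ssum by blast
  show "(ad s ^^ Suc i) ` V [+] W \<subseteq> (ad s ^^ i) ` V [+] W"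
    by (rule ssum_mono[OF adn_image_subset order_refl]) (rule V(2))
  assume eq: "(ad s ^^ Suc i) ` V [+] W = (ad s ^^ i) ` V [+] W"
  show "(ad s ^^ Suc (Suc i)) ` V [+] W = (ad s ^^ Suc i) ` V [+] W"
  proof
    show "(ad s ^^ Suc (Suc i)) ` V [+] W \<subseteq> (ad s ^^ Suc i) ` V [+] W"
      by (rule ssum_mono[OF adn_image_subset order_refl]) (rule V(2))
    have up: "(ad s ^^ i) ` V \<subseteq> (ad s ^^ i) ` V [+] W"
      using adn_image[OF s V(1)] W(1) ssum_upper1 by blast
    show "(ad s ^^ Suc i) ` V [+] W \<subseteq> (ad s ^^ Suc (Suc i)) ` V [+] W"
    proof
      fix x assume "x \<in> (ad s ^^ Suc i) ` V [+] W"
      then obtain v w where v: "v \<in> V" "w \<in> W" "x = (ad s ^^ Suc i) v \<^bold>+ w" by (auto elim!: ssumE)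
      then have "(ad s ^^ i) v \<in> (ad s ^^ Suc i) ` V [+] W" using up eq by auto
      then obtain v' w' where v': "v' \<in> V" "w' \<in> W" "(ad s ^^ i) v = (ad s ^^ Suc i) v' \<^bold>+ w'"
        by (auto elim!: ssumE)
      have c: "(ad s ^^ Suc i) v' \<in> carrier L" "w' \<in> carrier L" "w \<in> carrier L"
        "(ad s ^^ Suc (Suc i)) v' \<in> carrier L"
        using v v' adn_closed[OF s] sub_mem[OF V(1)] sub_mem[OF W(1)] by blast+
      have "(ad s ^^ Suc i) v = (ad s ^^ Suc (Suc i)) v' \<^bold>+ \<lbrace>s, w'\<rbrace>"
        using bracket_add_right[OF s c(1,2)] v'(3) by simp
      then have "x = (ad s ^^ Suc (Suc i)) v' \<^bold>+ (\<lbrace>s, w'\<rbrace> \<^bold>+ w)"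
        using v(3) c s bracket_closed by (simp only: M.a_assoc)
      then show "x \<in> (ad s ^^ Suc (Suc i)) ` V [+] W"
        using v'(1) sub_add[OF W(1) W(2)[OF v'(2)] v(2)] by (auto intro!: ssumI simp del: funpow.simps)
    qed
  qed
qed

text \<open>The preimages of \<open>W\<close> under the powers of \<open>ad s\<close> increase and
  are stationary from \<open>stab\<close> on, so an unknown exponent can be traded for a fixed
  one.\<close>

lemma adn_kernel_stab:
  assumes s: "s \<in> carrier L" and V: "sub V" "\<And>x. x \<in> V \<Longrightarrow> \<lbrace>s, x\<rbrace> \<in> V"
    and W: "sub W" "\<And>x. x \<in> W \<Longrightarrow> \<lbrace>s, x\<rbrace> \<in> W" and v: "v \<in> V" "(ad s ^^ n) v \<in> W" and m: "m \<ge> stab"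
  shows "(ad s ^^ m) v \<in> W"
proof -
  have inc: "{v \<in> V. (ad s ^^ i) v \<in> W} \<subseteq> {v \<in> V. (ad s ^^ Suc i) v \<in> W}" for i
    using W(2) by auto
  have st: "{v \<in> V. (ad s ^^ i) v \<in> W} = {v \<in> V. (ad s ^^ stab) v \<in> W}" if "i \<ge> stab" for i
  proof (rule stab_inc[where X = "\<lambda>i. {v \<in> V. (ad s ^^ i) v \<in> W}", OF _ inc _ that])
    fix i
    show "sub {v \<in> V. (ad s ^^ i) v \<in> W}" using adn_preimage[OF s V(1) W(1)] .
    assume eq: "{v \<in> V. (ad s ^^ Suc i) v \<in> W} = {v \<in> V. (ad s ^^ i) v \<in> W}"
    have "(ad s ^^ Suc i) v \<in> W" if "v \<in> V" "(ad s ^^ Suc (Suc i)) v \<in> W" for v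
    proof -
      have "\<lbrace>s, v\<rbrace> \<in> {v \<in> V. (ad s ^^ Suc i) v \<in> W}"
        using that V(2) by (simp only: adn_Suc' mem_Collect_eq)
      then have "(ad s ^^ i) \<lbrace>s, v\<rbrace> \<in> W" unfolding eq by simp
      then show ?thesis by (simp only: adn_Suc')
    qed
    then show "{v \<in> V. (ad s ^^ Suc (Suc i)) v \<in> W} = {v \<in> V. (ad s ^^ Suc i) v \<in> W}"
      using inc[of "Suc i"] by blast
  qed
  have "(ad s ^^ (max n stab)) v \<in> W"
  proof -
    have "(ad s ^^ (max n stab - n)) ((ad s ^^ n) v) \<in> W"
      by (rule adn_in[where V = W]) (use v W(2) in auto)
    also have "(ad s ^^ (max n stab - n)) ((ad s ^^ n) v) = (ad s ^^ (max n stab - n + n)) v"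
      by (simp only: funpow_add o_apply)
    finally show ?thesis by simp
  qed
  then show ?thesis using st[of "max n stab"] st[OF m] v(1) by auto
qed

text \<open>Modulo \<open>W\<close> the powers \<open>n\<close> and \<open>n + n\<close> of
  \<open>ad s\<close> have the same image. So (ad s)^n v agrees with (ad s)^(2n) u for some
  \<open>u\<close>, and v - (ad s)^n u is the component on which \<open>ad s\<close> is
  nilpotent.\<close>

lemma fitting:
  assumes s: "s \<in> carrier L" and V: "sub V" "\<And>x. x \<in> V \<Longrightarrow> \<lbrace>s, x\<rbrace> \<in> V"
    and W: "sub W" "W \<subseteq> V" "\<And>x. x \<in> W \<Longrightarrow> \<lbrace>s, x\<rbrace> \<in> W" and n: "n \<ge> stab" and v: "v \<in> V"
  obtains v0 v1 where "v0 \<in> V" "(ad s ^^ n) v0 \<in> W" "v1 \<in> V" "v = v0 \<^bold>+ (ad s ^^ n) v1"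
proof -
  note c = sub_mem[OF V(1)]
  have "(ad s ^^ n) v \<in> (ad s ^^ n) ` V [+] W"
    using v ssum_upper1[OF adn_image[OF s V(1)] W(1)] by auto
  also have "\<dots> = (ad s ^^ (n + n)) ` V [+] W"
    using adn_image_stab[OF s V W(1,3), of n] adn_image_stab[OF s V W(1,3), of "n + n"] n by simp
  finally obtain u w where u: "u \<in> V" "w \<in> W" "(ad s ^^ n) v = (ad s ^^ (n + n)) u \<^bold>+ w"
    by (auto elim!: ssumE)
  let ?z = "(ad s ^^ n) u"
  have z: "?z \<in> V" using adn_in[of V s] V(2) u(1) by blast
  have "(ad s ^^ n) (v \<^bold>+ \<^bold>- ?z) = (ad s ^^ n) v \<^bold>+ \<^bold>- (ad s ^^ n) ?z"
    using s v z c by (simp add: adn_add adn_neg)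
  also have "(ad s ^^ n) ?z = (ad s ^^ (n + n)) u" by (simp add: funpow_add)
  also have "(ad s ^^ n) v \<^bold>+ \<^bold>- \<dots> = w"
    unfolding u(3) using adn_closed[OF s c[OF u(1)], of "n + n"] sub_mem[OF W(1) u(2)] by algebra
  finally have "(ad s ^^ n) (v \<^bold>+ \<^bold>- ?z) \<in> W" using u(2) by simp
  moreover have "v \<^bold>+ \<^bold>- ?z \<in> V" using v z sub_add[OF V(1)] sub_neg[OF V(1)] by blast
  moreover have "v = (v \<^bold>+ \<^bold>- ?z) \<^bold>+ ?z" using c[OF v] c[OF z] by algebra
  ultimately show ?thesis using that u(1) by blast
qed

text \<open>A version of Engel's theorem for the nilpotent algebra of operators induced by \<open>Y\<close>.\<close>

lemma ex_nonnilpotent: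
  assumes M: "alg M" and Y: "alg Y" "Y \<subseteq> M" "\<And>m y. m \<in> M \<Longrightarrow> y \<in> Y \<Longrightarrow> \<lbrace>m, y\<rbrace> \<in> Y"
    and V1: "sub V1" "\<And>m v. m \<in> M \<Longrightarrow> v \<in> V1 \<Longrightarrow> \<lbrace>m, v\<rbrace> \<in> V1"
    and V2: "sub V2" "\<And>m v. m \<in> M \<Longrightarrow> v \<in> V2 \<Longrightarrow> \<lbrace>m, v\<rbrace> \<in> V2" "V1 \<subseteq> V2"
    and irr: "\<And>X. sub X \<Longrightarrow> V1 \<subseteq> X \<Longrightarrow> X \<subseteq> V2 \<Longrightarrow> (\<And>m v. m \<in> M \<Longrightarrow> v \<in> X \<Longrightarrow> \<lbrace>m, v\<rbrace> \<in> X) \<Longrightarrow> X = V1 \<or> X = V2"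
    and triv: "\<And>y v. y \<in> resid Y \<Longrightarrow> v \<in> V2 \<Longrightarrow> \<lbrace>y, v\<rbrace> \<in> V1"
    and nontriv: "\<exists>y\<in>Y. \<exists>v\<in>V2. \<lbrace>y, v\<rbrace> \<notin> V1"
  obtains s where "s \<in> Y" "\<And>v j. v \<in> V2 \<Longrightarrow> (ad s ^^ j) v \<in> V1 \<Longrightarrow> v \<in> V1"
proof -
  note Mc = sub_mem[OF alg_sub[OF M]] and Vc = sub_mem[OF V2(1)]
  \<comment> \<open>\<open>tr j\<close> says that \<open>lc Y j\<close> acts trivially on V2 / V1.
    For the \<open>i\<close> found below, \<open>lc Y i\<close> acts nontrivially but
    \<open>lc Y (Suc i)\<close> trivially, so the operators induced by \<open>lc Y i\<close>
    commute.\<close>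
  define tr where "tr j \<longleftrightarrow> (\<forall>y\<in>lc Y j. \<forall>v\<in>V2. \<lbrace>y, v\<rbrace> \<in> V1)" for j
  have "tr stab" unfolding tr_def using triv resid_eq_lc[OF Y(1) order_refl] by auto
  moreover have "\<not> tr 0" unfolding tr_def using nontriv by simp
  moreover have "\<not> tr n" if "\<And>i. tr (Suc i) \<Longrightarrow> tr i" "\<not> tr 0" for n
    using that by (induction n) auto
  ultimately obtain i where i: "\<not> tr i" "tr (Suc i)" by blast
  have lM: "y \<in> M" if "y \<in> lc Y j" for y j using that lc_subset[OF Y(1)] Y(2) by blast
  have "\<exists>y\<in>lc Y i. \<exists>v\<in>V2. \<forall>k. (ad y ^^ k) v \<notin> V1"
  proof (rule ccontr)
    assume no: "\<not> ?thesis"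
    have nil: "(ad y ^^ stab) v \<in> V1" if y: "y \<in> lc Y i" and v: "v \<in> V2" for y v
    proof -
      obtain k where k: "(ad y ^^ k) v \<in> V1" using no y v by blast
      show ?thesis
        by (rule adn_kernel_stab[OF Mc[OF lM[OF y]] V2(1) V2(2)[OF lM[OF y]] V1(1) V1(2)[OF lM[OF y]] v k order_refl])
    qed
    \<comment> \<open>A minimal invariant subspace \<open>W\<close> above \<open>V1\<close> is
      annihilated by the commuting operators: the image of \<open>W\<close> under \<open>y\<close>,
      together with \<open>V1\<close>, is again invariant, and it is not \<open>W\<close> because
      \<open>y\<close> acts nilpotently.\<close>
    let ?P = "\<lambda>W. sub W \<and> V1 \<subseteq> W \<and> W \<noteq> V1 \<and> W \<subseteq> V2 \<and> (\<forall>y\<in>lc Y i. \<forall>w\<in>W. \<lbrace>y, w\<rbrace> \<in> W)"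
    have "V1 \<noteq> V2" using nontriv V2(2) Y(2) by blast
    then have "?P V2" using V2 lM by auto
    then obtain W where W: "?P W" and min: "\<And>K. ?P K \<Longrightarrow> K \<subseteq> W \<Longrightarrow> K = W"
      by (rule ex_minimal_sub[of ?P]) auto
    have yW: "\<lbrace>y, w\<rbrace> \<in> V1" if y: "y \<in> lc Y i" and w: "w \<in> W" for y w
    proof -
      note yc = Mc[OF lM[OF y]]
      let ?K = "(ad y ^^ 1) ` W [+] V1"
      have sy: "sub ((ad y ^^ 1) ` W)" using adn_image[OF yc] W by blast
      have K: "sub ?K" "V1 \<subseteq> ?K" "(ad y ^^ 1) ` W \<subseteq> ?K"
        using sub_ssum[OF sy V1(1)] ssum_upper1[OF sy V1(1)] ssum_upper2[OF sy V1(1)] by auto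
      have KW: "?K \<subseteq> W" using W y by (intro ssum_least) auto
      have st: "\<lbrace>z, x\<rbrace> \<in> ?K" if z: "z \<in> lc Y i" and x: "x \<in> ?K" for z x
      proof -
        obtain w' v' where wv: "w' \<in> W" "v' \<in> V1" "x = \<lbrace>y, w'\<rbrace> \<^bold>+ v'" using x by (auto elim!: ssumE)
        note zc = Mc[OF lM[OF z]]
        have wc: "w' \<in> carrier L" "v' \<in> carrier L" using wv W Vc V2(3) by auto
        have "\<lbrace>z, y\<rbrace> \<in> lc Y (Suc i)" using z y lc_subset[OF Y(1), of i] brsI[of z "lc Y i" y Y] by auto
        then have 1: "\<lbrace>\<lbrace>z, y\<rbrace>, w'\<rbrace> \<in> ?K" using i(2) wv W K unfolding tr_def by blast
        have "\<lbrace>z, w'\<rbrace> \<in> W" using W z wv by blast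
        then have 2: "\<lbrace>y, \<lbrace>z, w'\<rbrace>\<rbrace> \<in> ?K" using K(3) by auto
        have 3: "\<lbrace>z, v'\<rbrace> \<in> ?K" using V1(2)[OF lM[OF z] wv(2)] K by blast
        have "\<lbrace>z, x\<rbrace> = (\<lbrace>\<lbrace>z, y\<rbrace>, w'\<rbrace> \<^bold>+ \<lbrace>y, \<lbrace>z, w'\<rbrace>\<rbrace>) \<^bold>+ \<lbrace>z, v'\<rbrace>"
          unfolding wv(3) jacobi_right[OF zc yc wc(1), symmetric]
          using zc yc wc by (intro bracket_add_right bracket_closed)
        then show ?thesis using sub_add[OF K(1) sub_add[OF K(1) 1 2] 3] by simp
      qed
      have "?K = V1"
      proof (rule ccontr)
        assume ne: "?K \<noteq> V1"
        have "?K \<subseteq> V2" using KW W by blast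
        then have "?P ?K" using K(1,2) ne st by (intro conjI ballI)
        then have eq: "?K = W" using min KW by blast
        have "W \<subseteq> (ad y ^^ n) ` W [+] V1" for n
        proof (induction n)
          case 0
          show ?case using W ssum_upper1[OF _ V1(1), of W] by simp
        next
          case (Suc n)
          let ?S = "(ad y ^^ Suc n) ` W [+] V1"
          have sn: "sub ((ad y ^^ Suc n) ` W)" using adn_image[OF yc] W by blast
          have S: "sub ?S" "V1 \<subseteq> ?S" "(ad y ^^ Suc n) ` W \<subseteq> ?S"
            using sub_ssum[OF sn V1(1)] ssum_upper1[OF sn V1(1)] ssum_upper2[OF sn V1(1)] by auto
          have "(ad y ^^ 1) ` W \<subseteq> ?S"
          proof
            fix x assume "x \<in> (ad y ^^ 1) ` W"
            then obtain u where u: "u \<in> W" "x = \<lbrace>y, u\<rbrace>" by auto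
            obtain a b where ab: "a \<in> W" "b \<in> V1" "u = (ad y ^^ n) a \<^bold>+ b"
              using u(1) Suc by (blast elim: ssumE)
            have "x = (ad y ^^ Suc n) a \<^bold>+ \<lbrace>y, b\<rbrace>"
              unfolding u(2) ab(3) adn_Suc
              using ab W Vc V2(3) yc by (intro bracket_add_right adn_closed) auto
            then show "x \<in> ?S" using ab V1(2)[OF lM[OF y] ab(2)] by (auto intro!: ssumI simp del: funpow.simps)
          qed
          then show ?case using ssum_least[OF S(1) _ S(2)] eq by blast
        qed
        then have "W \<subseteq> (ad y ^^ stab) ` W [+] V1" .
        also have "\<dots> \<subseteq> V1" using nil[OF y] W by (intro ssum_least[OF V1(1)]) auto
        finally show False using W by blast
      qed
      then show ?thesis using K(3) w by auto
    qed
    \<comment> \<open>The common kernel of \<open>lc Y i\<close> modulo \<open>V1\<close> is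
      invariant under \<open>M\<close> and contains \<open>W\<close>, so by irreducibility it is
      \<open>V2\<close>, against the choice of \<open>i\<close>.\<close>
    let ?X = "{v \<in> V2. \<forall>y\<in>lc Y i. \<lbrace>y, v\<rbrace> \<in> V1}"
    have Xeq: "?X = V2 \<inter> (\<Inter>y\<in>lc Y i. {v \<in> carrier L. \<lbrace>y, v\<rbrace> \<in> V1})" using Vc by auto
    have "lc Y i \<noteq> {}" using sub_zero[OF sub_lc[OF Y(1), of i]] by blast
    then have "sub ?X" unfolding Xeq
      using Mc lM
      by (intro sub_Int V2(1) sub_Inter) (auto intro!: sub_br_right[OF V1(1)])
    moreover have "V1 \<subseteq> ?X" using V2(3) V1(2) lM by auto
    moreover have "\<lbrace>m, v\<rbrace> \<in> ?X" if m: "m \<in> M" and v: "v \<in> ?X" for m v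
    proof -
      have "\<lbrace>y, \<lbrace>m, v\<rbrace>\<rbrace> \<in> V1" if y: "y \<in> lc Y i" for y
      proof -
        note c = Mc[OF lM[OF y]] Mc[OF m]
        have "\<lbrace>m, y\<rbrace> \<in> lc Y i" using lc_norm[OF Y(1) Mc[OF m] Y(3)[OF m] y] .
        then have "\<lbrace>y, m\<rbrace> \<in> lc Y i" using br_swap[OF sub_lc[OF Y(1)]] c by blast
        then have "\<lbrace>\<lbrace>y, m\<rbrace>, v\<rbrace> \<in> V1" "\<lbrace>m, \<lbrace>y, v\<rbrace>\<rbrace> \<in> V1" using v V1(2)[OF m] y by auto
        then show ?thesis using jacobi_right[OF c, of v] v Vc sub_add[OF V1(1)] by auto
      qed
      then show ?thesis using v V2(2)[OF m] by auto
    qed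
    ultimately have "?X = V1 \<or> ?X = V2" using irr[of ?X] by blast
    moreover have "W \<subseteq> ?X" using W yW by auto
    ultimately have "?X = V2" using W by auto
    then show False using i(1) unfolding tr_def by blast
  qed
  then obtain s v where s: "s \<in> lc Y i" and v: "v \<in> V2" "\<And>k. (ad s ^^ k) v \<notin> V1" by blast
  have sY: "s \<in> Y" and sM: "s \<in> M" using s lM lc_subset[OF Y(1)] by auto
  note sc = Mc[OF sM]
  \<comment> \<open>The Fitting null component of \<open>s\<close> on V2 / V1. It is invariant under
    \<open>M\<close>, because a high power of \<open>ad s\<close> takes \<open>M\<close> into
    \<open>resid Y\<close>, which acts trivially; as it is not \<open>V2\<close>, irreducibility
    leaves \<open>V1\<close>.\<close>
  let ?X = "{v \<in> V2. (ad s ^^ stab) v \<in> V1}"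
  have X: "sub ?X" using adn_preimage[OF sc V2(1) V1(1)] .
  have V1X: "V1 \<subseteq> ?X" using V2(3) adn_in[of V1 s] V1(2)[OF sM] by auto
  have st: "\<lbrace>m, x\<rbrace> \<in> ?X" if m: "m \<in> M" and x: "x \<in> ?X" for m x
  proof -
    have "\<lbrace>s, m\<rbrace> \<in> Y" using br_swap[OF alg_sub[OF Y(1)] Mc[OF m] sc Y(3)[OF m sY]] .
    then have "(ad s ^^ Suc stab) m \<in> lc Y stab" unfolding adn_Suc' using adn_lc[OF Y(1) sY] by blast
    then have "(ad s ^^ Suc stab) m \<in> resid Y" using resid_eq_lc[OF Y(1) order_refl] by simp
    then have k: "\<lbrace>(ad s ^^ Suc stab) m, x\<rbrace> \<in> V1" if "x \<in> V2" for x using triv that by blast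
    have h: "(ad s ^^ (Suc stab + stab)) \<lbrace>m, x\<rbrace> \<in> V1"
      by (rule br_adn_kernel[where M = M and V = V2, OF sc V2(1) V1(1)])
        (use x m k V2(2)[OF sM] V1(2) V1(2)[OF sM] sub_carrier[OF alg_sub[OF M]] alg_br[OF M sM] in \<open>auto simp del: funpow.simps\<close>)
    have mx: "\<lbrace>m, x\<rbrace> \<in> V2" using x V2(2)[OF m] by blast
    have "(ad s ^^ stab) \<lbrace>m, x\<rbrace> \<in> V1"
      by (rule adn_kernel_stab[OF sc V2(1) V2(2)[OF sM] V1(1) V1(2)[OF sM] mx h order_refl])
    then show ?thesis using mx by blast
  qed
  have "?X \<noteq> V2" using v by blast
  then have "?X = V1" using irr[OF X V1X _ st] by blast
  moreover have "(ad s ^^ stab) v \<in> V1" if "v \<in> V2" "(ad s ^^ j) v \<in> V1" for v j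
    using adn_kernel_stab[OF sc V2(1) V2(2)[OF sM] V1(1) V1(2)[OF sM] that order_refl] .
  ultimately show ?thesis using that[OF sY] by blast
qed

end

section \<open>Derivations and polynomials with vector coefficients\<close>

context field
begin

definition nscal :: "nat \<Rightarrow> 'a" where "nscal n = [n] \<cdot> \<one>"

lemma nscal_closed [simp]: "nscal n \<in> carrier R"
  unfolding nscal_def by simp

lemma nscal_0 [simp]: "nscal 0 = \<zero>"
  unfolding nscal_def by simp

lemma nscal_1 [simp]: "nscal (Suc 0) = \<one>"
  unfolding nscal_def by simp

lemma nscal_add: "nscal (m + n) = nscal m \<oplus> nscal n"
  unfolding nscal_def by (simp add: add.nat_pow_mult)

lemma nscal_mult: "nscal (m * n) = nscal m \<otimes> nscal n"
proof (induction m)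
  case (Suc m)
  have "nscal (Suc m) = \<one> \<oplus> nscal m"
    using nscal_add[of "Suc 0" m] by simp
  then show ?case using Suc by (simp add: nscal_add l_distr)
qed simp

lemma diff_nonzero: "a \<in> carrier R \<Longrightarrow> b \<in> carrier R \<Longrightarrow> a \<noteq> b \<Longrightarrow> a \<oplus> \<ominus> b \<noteq> \<zero>"
  using r_right_minus_eq[of a b] by (simp add: minus_eq)

end

context lie_algebra
begin

definition lie_deriv :: "('a \<Rightarrow> 'a) \<Rightarrow> bool" where
  "lie_deriv f \<longleftrightarrow> (\<forall>x\<in>carrier L. f x \<in> carrier L) \<and>
    (\<forall>x\<in>carrier L. \<forall>y\<in>carrier L. f (x \<^bold>+ y) = f x \<^bold>+ f y) \<and>
    (\<forall>a\<in>carrier F. \<forall>x\<in>carrier L. f (a \<^bold>* x) = a \<^bold>* f x) \<and>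
    (\<forall>x\<in>carrier L. \<forall>y\<in>carrier L. f \<lbrace>x, y\<rbrace> = \<lbrace>f x, y\<rbrace> \<^bold>+ \<lbrace>x, f y\<rbrace>)"

lemma lie_derivD:
  assumes "lie_deriv f" "x \<in> carrier L"
  shows "f x \<in> carrier L" and "y \<in> carrier L \<Longrightarrow> f (x \<^bold>+ y) = f x \<^bold>+ f y"
    and "a \<in> carrier F \<Longrightarrow> f (a \<^bold>* x) = a \<^bold>* f x"
    and "y \<in> carrier L \<Longrightarrow> f \<lbrace>x, y\<rbrace> = \<lbrace>f x, y\<rbrace> \<^bold>+ \<lbrace>x, f y\<rbrace>"
  using assms unfolding lie_deriv_def by auto

lemma lie_deriv_ad: "s \<in> carrier L \<Longrightarrow> lie_deriv (ad s)"
  unfolding lie_deriv_def by (auto simp: br_simps jacobi_right[symmetric])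

lemma derivn_closed: "lie_deriv f \<Longrightarrow> x \<in> carrier L \<Longrightarrow> (f ^^ n) x \<in> carrier L"
  by (induction n) (auto dest: lie_derivD)

lemma derivn_add: "lie_deriv f \<Longrightarrow> x \<in> carrier L \<Longrightarrow> y \<in> carrier L \<Longrightarrow>
    (f ^^ n) (x \<^bold>+ y) = (f ^^ n) x \<^bold>+ (f ^^ n) y"
  by (induction n) (auto simp: derivn_closed lie_derivD)

lemma derivn_smult: "lie_deriv f \<Longrightarrow> a \<in> carrier F \<Longrightarrow> x \<in> carrier L \<Longrightarrow>
    (f ^^ n) (a \<^bold>* x) = a \<^bold>* (f ^^ n) x"
  by (induction n) (auto simp: derivn_closed lie_derivD)

lemma pascal_finsum:
  assumes "\<And>i. a i \<in> carrier L"
  shows "(\<Oplus>\<^bsub>L\<^esub>i\<in>{..n}. nscal (n choose i) \<^bold>* a (Suc i)) \<^bold>+ (\<Oplus>\<^bsub>L\<^esub>i\<in>{..n}. nscal (n choose i) \<^bold>* a i) =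
    (\<Oplus>\<^bsub>L\<^esub>i\<in>{..Suc n}. nscal (Suc n choose i) \<^bold>* a i)" (is "?A \<^bold>+ ?B = ?C")
proof -
  let ?A' = "\<Oplus>\<^bsub>L\<^esub>i\<in>{..n}. nscal (n choose Suc i) \<^bold>* a (Suc i)"
  have c: "?A \<in> carrier L" "?A' \<in> carrier L" "a 0 \<in> carrier L"
    using assms by (auto intro!: M.finsum_closed)
  have "?B = (\<Oplus>\<^bsub>L\<^esub>i\<in>{..Suc n}. nscal (n choose i) \<^bold>* a i)"
    using assms by (subst M.finsum_Suc) (auto intro!: M.finsum_closed simp: binomial_eq_0)
  also have "\<dots> = ?A' \<^bold>+ a 0"
    using assms by (subst M.finsum_Suc2) auto
  finally have B: "?B = ?A' \<^bold>+ a 0" .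
  have "?C = (\<Oplus>\<^bsub>L\<^esub>i\<in>{..n}. nscal (Suc n choose Suc i) \<^bold>* a (Suc i)) \<^bold>+ a 0"
    using assms by (subst M.finsum_Suc2) auto
  also have "(\<Oplus>\<^bsub>L\<^esub>i\<in>{..n}. nscal (Suc n choose Suc i) \<^bold>* a (Suc i)) =
      (\<Oplus>\<^bsub>L\<^esub>i\<in>{..n}. nscal (n choose i) \<^bold>* a (Suc i) \<^bold>+ nscal (n choose Suc i) \<^bold>* a (Suc i))"
    using assms by (intro M.finsum_cong') (auto simp: nscal_add smult_l_distr)
  also have "\<dots> = ?A \<^bold>+ ?A'"
    using assms by (intro M.finsum_addf) auto
  finally show ?thesis unfolding B using c by (simp add: M.a_assoc)
qed

lemma leibniz:
  assumes f: "lie_deriv f" and x: "x \<in> carrier L" and y: "y \<in> carrier L"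
  shows "(f ^^ n) \<lbrace>x, y\<rbrace> = (\<Oplus>\<^bsub>L\<^esub>i\<in>{..n}. nscal (n choose i) \<^bold>* \<lbrace>(f ^^ i) x, (f ^^ (n - i)) y\<rbrace>)"
proof (induction n)
  case 0
  show ?case using x y bracket_closed by simp
next
  case (Suc n)
  let ?a = "\<lambda>i. \<lbrace>(f ^^ i) x, (f ^^ (Suc n - i)) y\<rbrace>"
  have c: "(f ^^ i) x \<in> carrier L" "(f ^^ i) y \<in> carrier L" for i
    using derivn_closed[OF f] x y by auto
  have fs: "f (\<Oplus>\<^bsub>L\<^esub>i\<in>A. g i) = (\<Oplus>\<^bsub>L\<^esub>i\<in>A. f (g i))"
    if "finite A" "\<And>i. i \<in> A \<Longrightarrow> g i \<in> carrier L" for g and A :: "nat set"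
    using that
  proof (induction A rule: finite_induct)
    case empty
    have "f \<^bold>0 = \<^bold>0" using lie_derivD(3)[OF f, of "\<^bold>0" "\<zero>\<^bsub>F\<^esub>"] lie_derivD(1)[OF f, of "\<^bold>0"] by simp
    then show ?case by simp
  next
    case (insert i A)
    then have g: "\<And>j. j \<in> insert i A \<Longrightarrow> f (g j) \<in> carrier L" using lie_derivD(1)[OF f] by blast
    have "f (\<Oplus>\<^bsub>L\<^esub>j\<in>insert i A. g j) = f (g i \<^bold>+ (\<Oplus>\<^bsub>L\<^esub>j\<in>A. g j))"
      using insert by (subst M.finsum_insert) auto
    also have "\<dots> = f (g i) \<^bold>+ (\<Oplus>\<^bsub>L\<^esub>j\<in>A. f (g j))"
      using insert lie_derivD(2)[OF f, of "g i"] by (auto intro!: M.finsum_closed)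
    also have "\<dots> = (\<Oplus>\<^bsub>L\<^esub>j\<in>insert i A. f (g j))"
      using insert g by (subst M.finsum_insert) auto
    finally show ?case .
  qed
  have "(f ^^ Suc n) \<lbrace>x, y\<rbrace> = f (\<Oplus>\<^bsub>L\<^esub>i\<in>{..n}. nscal (n choose i) \<^bold>* \<lbrace>(f ^^ i) x, (f ^^ (n - i)) y\<rbrace>)"
    using Suc by simp
  also have "\<dots> = (\<Oplus>\<^bsub>L\<^esub>i\<in>{..n}. f (nscal (n choose i) \<^bold>* \<lbrace>(f ^^ i) x, (f ^^ (n - i)) y\<rbrace>))"
    using c bracket_closed by (intro fs) auto
  also have "\<dots> = (\<Oplus>\<^bsub>L\<^esub>i\<in>{..n}. nscal (n choose i) \<^bold>* ?a (Suc i) \<^bold>+ nscal (n choose i) \<^bold>* ?a i)"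
  proof (intro M.finsum_cong' refl)
    fix i assume i: "i \<in> {..n}"
    have "f (nscal (n choose i) \<^bold>* \<lbrace>(f ^^ i) x, (f ^^ (n - i)) y\<rbrace>) =
        nscal (n choose i) \<^bold>* f \<lbrace>(f ^^ i) x, (f ^^ (n - i)) y\<rbrace>"
      using c bracket_closed by (intro lie_derivD(3)[OF f]) auto
    also have "f \<lbrace>(f ^^ i) x, (f ^^ (n - i)) y\<rbrace> =
        \<lbrace>(f ^^ Suc i) x, (f ^^ (n - i)) y\<rbrace> \<^bold>+ \<lbrace>(f ^^ i) x, (f ^^ Suc (n - i)) y\<rbrace>"
      using lie_derivD(4)[OF f c(1) c(2)] by simp
    also have "Suc (n - i) = Suc n - i" using i by (simp add: Suc_diff_le)
    finally show "f (nscal (n choose i) \<^bold>* \<lbrace>(f ^^ i) x, (f ^^ (n - i)) y\<rbrace>) =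
        nscal (n choose i) \<^bold>* ?a (Suc i) \<^bold>+ nscal (n choose i) \<^bold>* ?a i"
      using c bracket_closed by (simp add: smult_r_distr del: funpow.simps)
  qed (use c bracket_closed in \<open>auto simp del: funpow.simps\<close>)
  also have "\<dots> = (\<Oplus>\<^bsub>L\<^esub>i\<in>{..n}. nscal (n choose i) \<^bold>* ?a (Suc i)) \<^bold>+ (\<Oplus>\<^bsub>L\<^esub>i\<in>{..n}. nscal (n choose i) \<^bold>* ?a i)"
    using c bracket_closed by (intro M.finsum_addf) (auto simp del: funpow.simps)
  also have "\<dots> = (\<Oplus>\<^bsub>L\<^esub>i\<in>{..Suc n}. nscal (Suc n choose i) \<^bold>* ?a i)"
    using c bracket_closed by (intro pascal_finsum) (auto simp del: funpow.simps)
  finally show ?case .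
qed

text \<open>In the Leibniz formula for the \<open>p\<close>-th power all binomial coefficients but
  the first and the last are divisible by \<open>p\<close> and vanish in \<open>F\<close>.\<close>

lemma lie_deriv_prime:
  assumes f: "lie_deriv f" and p: "prime p" "nscal p = \<zero>\<^bsub>F\<^esub>"
  shows "lie_deriv (f ^^ p)"
proof -
  have "(f ^^ p) \<lbrace>x, y\<rbrace> = \<lbrace>(f ^^ p) x, y\<rbrace> \<^bold>+ \<lbrace>x, (f ^^ p) y\<rbrace>"
    if xy: "x \<in> carrier L" "y \<in> carrier L" for x y
  proof -
    have c: "(f ^^ i) x \<in> carrier L" "(f ^^ i) y \<in> carrier L" for i
      using derivn_closed[OF f] xy by auto
    let ?g = "\<lambda>i. nscal (p choose i) \<^bold>* \<lbrace>(f ^^ i) x, (f ^^ (p - i)) y\<rbrace>"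
    have g: "?g i \<in> carrier L" for i using c bracket_closed by auto
    have p0: "0 < p" "0 \<noteq> p" using p(1) prime_gt_0_nat by auto
    have "(f ^^ p) \<lbrace>x, y\<rbrace> = (\<Oplus>\<^bsub>L\<^esub>i\<in>{..p}. ?g i)" by (rule leibniz[OF f xy])
    also have "\<dots> = (\<Oplus>\<^bsub>L\<^esub>i\<in>{0, p}. ?g i)"
    proof (rule M.add.finprod_mono_neutral_cong_right)
      show "?g i = \<^bold>0" if "i \<in> {..p} - {0, p}" for i
      proof -
        from that have "p dvd (p choose i)" using p(1) by (intro dvd_choose_prime) auto
        then obtain m where "p choose i = p * m" by auto
        then have "nscal (p choose i) = \<zero>\<^bsub>F\<^esub>" using p(2) by (simp add: nscal_mult)
        then show "?g i = \<^bold>0" using c bracket_closed by simp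
      qed
    qed (use g in auto)
    also have "\<dots> = \<lbrace>x, (f ^^ p) y\<rbrace> \<^bold>+ \<lbrace>(f ^^ p) x, y\<rbrace>"
      using g c[of p] xy bracket_closed p0 by simp
    finally show ?thesis using c[of p] xy bracket_closed by (simp add: M.a_comm)
  qed
  then show ?thesis unfolding lie_deriv_def using f by (auto simp: derivn_closed derivn_add derivn_smult)
qed

lemma lie_deriv_prime_power:
  assumes "lie_deriv f" "prime p" "nscal p = \<zero>\<^bsub>F\<^esub>"
  shows "lie_deriv (f ^^ (p ^ e))"
proof (induction e)
  case (Suc e)
  have "(f ^^ (p ^ e)) ^^ p = f ^^ (p ^ Suc e)" by (simp add: funpow_mult mult.commute)
  then show ?case using lie_deriv_prime[OF Suc assms(2,3)] by simp
qed (use assms in simp)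

text \<open>Horner's scheme: the list holds the coefficients in \<open>L\<close> of a polynomial in
  the scalar \<open>a\<close>, constant term first.\<close>

primrec vpoly :: "'a list \<Rightarrow> 'f \<Rightarrow> 'a" where
  "vpoly [] a = \<^bold>0"
| "vpoly (c # cs) a = c \<^bold>+ a \<^bold>* vpoly cs a"

lemma vpoly_closed: "set cs \<subseteq> carrier L \<Longrightarrow> a \<in> carrier F \<Longrightarrow> vpoly cs a \<in> carrier L"
  by (induction cs) auto

text \<open>Synthetic division by X - a0, with quotient \<open>ds\<close>. The last conjunct runs
  Horner's recursion backwards: the coefficients of \<open>cs\<close> are recovered from those of
  \<open>ds\<close> and the value at \<open>a0\<close>.\<close>

lemma vpoly_div:
  assumes W: "sub W" and a0: "a0 \<in> carrier F"
  shows "set cs \<subseteq> carrier L \<Longrightarrow> \<exists>ds. set ds \<subseteq> carrier L \<and> length ds = length cs - 1 \<and>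
    (\<forall>a\<in>carrier F. vpoly cs a = vpoly cs a0 \<^bold>+ (a \<oplus>\<^bsub>F\<^esub> \<ominus>\<^bsub>F\<^esub> a0) \<^bold>* vpoly ds a) \<and>
    (set ds \<subseteq> W \<longrightarrow> vpoly cs a0 \<in> W \<longrightarrow> set cs \<subseteq> W)"
proof (induction cs)
  case Nil
  then show ?case using a0 by auto
next
  case (Cons c cs)
  show ?case
  proof (cases "cs = []")
    case True
    then show ?thesis using Cons.prems a0 by (intro exI[of _ "[]"]) auto
  next
    case False
    then obtain ds where ds: "set ds \<subseteq> carrier L" "length ds = length cs - 1"
      "\<And>a. a \<in> carrier F \<Longrightarrow> vpoly cs a = vpoly cs a0 \<^bold>+ (a \<oplus>\<^bsub>F\<^esub> \<ominus>\<^bsub>F\<^esub> a0) \<^bold>* vpoly ds a"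
      "set ds \<subseteq> W \<Longrightarrow> vpoly cs a0 \<in> W \<Longrightarrow> set cs \<subseteq> W" using Cons by auto
    let ?e = "vpoly cs a0"
    have e: "?e \<in> carrier L" "c \<in> carrier L" using vpoly_closed Cons.prems a0 by auto
    show ?thesis
    proof (intro exI[of _ "?e # ds"] conjI ballI impI)
      show "length (?e # ds) = length (c # cs) - 1" using ds(2) False by (cases cs) auto
      show "set (?e # ds) \<subseteq> carrier L" using ds e by auto
      fix a assume a: "a \<in> carrier F"
      let ?v = "vpoly ds a" and ?b = "a \<oplus>\<^bsub>F\<^esub> \<ominus>\<^bsub>F\<^esub> a0"
      have v: "?v \<in> carrier L" "?b \<in> carrier F" using vpoly_closed[OF ds(1)] a a0 by auto
      have "vpoly (c # cs) a = c \<^bold>+ (a \<^bold>* ?e \<^bold>+ a \<^bold>* (?b \<^bold>* ?v))"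
        using ds(3)[OF a] a e v by (simp add: smult_r_distr)
      also have "a \<^bold>* (?b \<^bold>* ?v) = ?b \<^bold>* (a \<^bold>* ?v)"
        using smult_assoc1[OF a v(2,1)] smult_assoc1[OF v(2) a v(1)] m_comm[OF a v(2)] by simp
      also have "a \<^bold>* ?e = a0 \<^bold>* ?e \<^bold>+ ?b \<^bold>* ?e"
      proof -
        have "a0 \<oplus>\<^bsub>F\<^esub> ?b = a" using a a0 by algebra
        then show ?thesis using smult_l_distr[OF a0 v(2) e(1)] by simp
      qed
      also have "c \<^bold>+ (a0 \<^bold>* ?e \<^bold>+ ?b \<^bold>* ?e \<^bold>+ ?b \<^bold>* (a \<^bold>* ?v)) = vpoly (c # cs) a0 \<^bold>+ ?b \<^bold>* vpoly (?e # ds) a"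
        using a a0 e v by (simp add: smult_r_distr M.a_assoc)
      finally show "vpoly (c # cs) a = vpoly (c # cs) a0 \<^bold>+ ?b \<^bold>* vpoly (?e # ds) a" .
    next
      assume 1: "set (?e # ds) \<subseteq> W" "vpoly (c # cs) a0 \<in> W"
      then have "c \<in> W"
        using sub_add_cancel[OF W e(2), of "a0 \<^bold>* ?e"] sub_smult[OF W a0, of ?e] by simp
      then show "set (c # cs) \<subseteq> W" using ds(4) 1 by auto
    qed
  qed
qed

text \<open>Division at a point \<open>a0\<close> outside \<open>E\<close> shortens the list. The
  values of the quotient are known to lie in \<open>W\<close> only where a - a0 is invertible, hence
  \<open>a0\<close> joins \<open>E\<close>; an infinite field always leaves a further point.\<close>

lemma vpoly_coeffs:
  assumes W: "sub W" and inf: "infinite (carrier F)"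
  shows "set cs \<subseteq> carrier L \<Longrightarrow> finite E \<Longrightarrow> (\<And>a. a \<in> carrier F \<Longrightarrow> a \<notin> E \<Longrightarrow> vpoly cs a \<in> W) \<Longrightarrow> set cs \<subseteq> W"
proof (induction "length cs" arbitrary: cs E)
  case (Suc n)
  obtain a0 where a0: "a0 \<in> carrier F" "a0 \<notin> E" using inf Suc.prems(2) by (meson finite_subset subsetI)
  obtain ds where ds: "set ds \<subseteq> carrier L" "length ds = length cs - 1"
      "\<And>a. a \<in> carrier F \<Longrightarrow> vpoly cs a = vpoly cs a0 \<^bold>+ (a \<oplus>\<^bsub>F\<^esub> \<ominus>\<^bsub>F\<^esub> a0) \<^bold>* vpoly ds a"
      "set ds \<subseteq> W \<Longrightarrow> vpoly cs a0 \<in> W \<Longrightarrow> set cs \<subseteq> W"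
    using vpoly_div[OF W a0(1) Suc.prems(1)] by blast
  have v0: "vpoly cs a0 \<in> W" using Suc.prems(3) a0 by blast
  have "vpoly ds a \<in> W" if a: "a \<in> carrier F" "a \<notin> insert a0 E" for a
  proof -
    let ?b = "a \<oplus>\<^bsub>F\<^esub> \<ominus>\<^bsub>F\<^esub> a0"
    have b: "?b \<in> carrier F" using a a0 by simp
    have v: "vpoly ds a \<in> carrier L" "?b \<^bold>* vpoly ds a \<in> carrier L" using vpoly_closed[OF ds(1)] a b by auto
    have "?b \<noteq> \<zero>\<^bsub>F\<^esub>" using diff_nonzero[of a a0] a a0 by auto
    then obtain c where c: "c \<in> carrier F" "c \<otimes>\<^bsub>F\<^esub> ?b = \<one>\<^bsub>F\<^esub>"
      using b field_Units Units_l_inv_ex[of ?b] Units_closed by blast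
    have "vpoly cs a0 \<^bold>+ ?b \<^bold>* vpoly ds a \<in> W" using Suc.prems(3)[of a] a ds(3)[of a] by simp
    then have "?b \<^bold>* vpoly ds a \<in> W"
      using sub_add_cancel[OF W v(2) v0] v0 v sub_mem[OF W] by (simp add: M.a_comm)
    then have "c \<^bold>* (?b \<^bold>* vpoly ds a) \<in> W" using sub_smult[OF W c(1)] by blast
    then show ?thesis using c b v by (simp add: smult_assoc1[symmetric])
  qed
  then have "set ds \<subseteq> W" using Suc.hyps Suc.prems(2) ds(1,2) by (intro Suc.hyps(1)[of ds "insert a0 E"]) auto
  then show ?case using ds(4) v0 by blast
qed simp

end

section \<open>Conjugation by truncated exponentials\<close>

text \<open>\<open>R\<close> is a term of the lower nilpotent series of \<open>L\<close> outside the maximal subalgebra \<open>M\<close>, \<open>J\<close> is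
  the ideal generated by a residual of \<open>M\<close>, \<open>U / J\<close> is the Fitting one-component of \<open>ad s\<close> on
  \<open>R / J\<close>, and \<open>h\<close> is 1/2. Then \<open>(ad u)^3\<close> maps \<open>L\<close> into \<open>J\<close> for \<open>u \<in> U\<close>, so the truncated
  exponential \<open>phi u\<close> defined below is an automorphism modulo \<open>J\<close>.\<close>

locale lie_split = solv_lie +
  fixes M B J U R s h
  assumes M: "alg M" and R: "ide R" and B: "ide B" and J: "ide J" and U: "sub U"
    and subs: "J \<subseteq> B" "J \<subseteq> U" "B = R \<inter> M" "U \<subseteq> R"
    and MU: "\<And>m u. m \<in> M \<Longrightarrow> u \<in> U \<Longrightarrow> \<lbrace>m, u\<rbrace> \<in> U"
    and sum: "M [+] U = carrier L" and RBU: "R = B [+] U"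
    and UB: "U \<inter> B \<subseteq> J" and RR: "\<And>x y. x \<in> R \<Longrightarrow> y \<in> R \<Longrightarrow> \<lbrace>x, y\<rbrace> \<in> B"
    and s: "s \<in> M" and surj: "\<And>u. u \<in> U \<Longrightarrow> \<exists>u'\<in>U. \<exists>j\<in>J. u = \<lbrace>s, u'\<rbrace> \<^bold>+ j"
    and nil: "\<And>m n. m \<in> M \<Longrightarrow> stab < n \<Longrightarrow> (ad s ^^ n) m \<in> J"
    and h: "h \<in> carrier F" "h \<oplus>\<^bsub>F\<^esub> h = \<one>\<^bsub>F\<^esub>"
begin

lemma Mc: "m \<in> M \<Longrightarrow> m \<in> carrier L" using sub_mem[OF alg_sub[OF M]] .
lemma Uc: "u \<in> U \<Longrightarrow> u \<in> carrier L" using sub_mem[OF U] .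
lemma Jc: "u \<in> J \<Longrightarrow> u \<in> carrier L" using sub_mem[OF ide_sub[OF J]] .
lemma Bc: "u \<in> B \<Longrightarrow> u \<in> carrier L" using sub_mem[OF ide_sub[OF B]] .
lemma Rc: "u \<in> R \<Longrightarrow> u \<in> carrier L" using sub_mem[OF ide_sub[OF R]] .
lemma sc: "s \<in> carrier L" using Mc s .
lemma hh: "x \<in> carrier L \<Longrightarrow> h \<^bold>* x \<^bold>+ h \<^bold>* x = x"
  using h smult_l_distr[of h h x] by simp

lemmas J_add = sub_add[OF ide_sub[OF J]] and J_neg = sub_neg[OF ide_sub[OF J]]
  and J_smult = sub_smult[OF ide_sub[OF J]] and J_br = ide_br[OF J] and J_br' = ide_br'[OF J]

lemma BM: "b \<in> B \<Longrightarrow> b \<in> M" and BR: "b \<in> B \<Longrightarrow> b \<in> R" using subs(3) by blast+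
lemma UR: "u \<in> U \<Longrightarrow> u \<in> R" using subs(4) by blast

lemma UB_br: "u \<in> U \<Longrightarrow> b \<in> B \<Longrightarrow> \<lbrace>u, b\<rbrace> \<in> J"
proof -
  assume ub: "u \<in> U" "b \<in> B"
  then have "\<lbrace>b, u\<rbrace> \<in> U" using MU[OF BM] by blast
  moreover have "\<lbrace>b, u\<rbrace> \<in> B" using ide_br'[OF B] ub Uc by blast
  ultimately have "\<lbrace>b, u\<rbrace> \<in> J" using UB by blast
  then show "\<lbrace>u, b\<rbrace> \<in> J" using br_swap[OF ide_sub[OF J]] Uc Bc ub by blast
qed

lemma UU_br: "u \<in> U \<Longrightarrow> v \<in> U \<Longrightarrow> \<lbrace>u, v\<rbrace> \<in> B"
  using RR UR by blast

lemma R_UU_br: "r \<in> R \<Longrightarrow> u \<in> U \<Longrightarrow> v \<in> U \<Longrightarrow> \<lbrace>r, \<lbrace>u, v\<rbrace>\<rbrace> \<in> J"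
proof -
  assume ruv: "r \<in> R" "u \<in> U" "v \<in> U"
  then obtain b w where bw: "b \<in> B" "w \<in> U" "r = b \<^bold>+ w" using RBU by (blast elim: ssumE)
  note c = Bc[OF bw(1)] Uc[OF bw(2)] Uc[OF ruv(2)] Uc[OF ruv(3)]
  have 1: "\<lbrace>b, u\<rbrace> \<in> J" "\<lbrace>b, v\<rbrace> \<in> J"
    using br_swap[OF ide_sub[OF J] c(3) c(1) UB_br[OF ruv(2) bw(1)]]
      br_swap[OF ide_sub[OF J] c(4) c(1) UB_br[OF ruv(3) bw(1)]] .
  have 2: "\<lbrace>b, \<lbrace>u, v\<rbrace>\<rbrace> \<in> J"
    unfolding jacobi_right[OF c(1,3,4)] by (rule J_add[OF J_br'[OF 1(1) c(4)] J_br[OF c(3) 1(2)]])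
  have 3: "\<lbrace>w, \<lbrace>u, v\<rbrace>\<rbrace> \<in> J" using UB_br bw UU_br ruv by blast
  have "\<lbrace>r, \<lbrace>u, v\<rbrace>\<rbrace> = \<lbrace>b, \<lbrace>u, v\<rbrace>\<rbrace> \<^bold>+ \<lbrace>w, \<lbrace>u, v\<rbrace>\<rbrace>"
    unfolding bw(3) using c by (intro bracket_add_left bracket_closed)
  then show "\<lbrace>r, \<lbrace>u, v\<rbrace>\<rbrace> \<in> J" using 2 3 J_add by simp
qed

lemma UM_br: "u \<in> U \<Longrightarrow> m \<in> M \<Longrightarrow> \<lbrace>u, m\<rbrace> \<in> U"
  using br_swap[OF U Mc Uc MU] .

lemma R_br: "r \<in> R \<Longrightarrow> x \<in> carrier L \<Longrightarrow> \<lbrace>r, x\<rbrace> \<in> R"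
  using ide_br'[OF R] .

text \<open>For \<open>r = u\<close> this says that (ad u)^3 maps \<open>L\<close> into
  \<open>J\<close>. The general \<open>r\<close> disposes of the higher-order brackets in
  \<open>phi_hom\<close>.\<close>

lemma R_D2:
  assumes "r \<in> R" "u \<in> U" "y \<in> carrier L" shows "\<lbrace>r, \<lbrace>u, \<lbrace>u, y\<rbrace>\<rbrace>\<rbrace> \<in> J"
proof -
  obtain m v where mv: "m \<in> M" "v \<in> U" "y = m \<^bold>+ v" using assms(3) sum by (metis ssumE)
  note c = Rc[OF assms(1)] Uc[OF assms(2)] Mc[OF mv(1)] Uc[OF mv(2)]
  have 1: "\<lbrace>r, \<lbrace>u, \<lbrace>u, m\<rbrace>\<rbrace>\<rbrace> \<in> J" using R_UU_br assms(1,2) UM_br mv by blast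
  have 2: "\<lbrace>r, \<lbrace>u, \<lbrace>u, v\<rbrace>\<rbrace>\<rbrace> \<in> J" using UB_br[OF assms(2)] UU_br assms mv c J_br by blast
  have "\<lbrace>r, \<lbrace>u, \<lbrace>u, y\<rbrace>\<rbrace>\<rbrace> = \<lbrace>r, \<lbrace>u, \<lbrace>u, m\<rbrace>\<rbrace>\<rbrace> \<^bold>+ \<lbrace>r, \<lbrace>u, \<lbrace>u, v\<rbrace>\<rbrace>\<rbrace>"
    unfolding mv(3) using c by algebra
  then show ?thesis using 1 2 J_add by simp
qed

definition phi :: "'c \<Rightarrow> 'c \<Rightarrow> 'c" where
  "phi u x = x \<^bold>+ \<lbrace>u, x\<rbrace> \<^bold>+ h \<^bold>* \<lbrace>u, \<lbrace>u, x\<rbrace>\<rbrace>"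

lemma phi_closed: "u \<in> carrier L \<Longrightarrow> x \<in> carrier L \<Longrightarrow> phi u x \<in> carrier L"
  unfolding phi_def using h bracket_closed by simp

lemma phi_add: "u \<in> carrier L \<Longrightarrow> x \<in> carrier L \<Longrightarrow> y \<in> carrier L \<Longrightarrow> phi u (x \<^bold>+ y) = phi u x \<^bold>+ phi u y"
  unfolding phi_def using h(1) by algebra

lemma phi_smult: "u \<in> carrier L \<Longrightarrow> a \<in> carrier F \<Longrightarrow> x \<in> carrier L \<Longrightarrow> phi u (a \<^bold>* x) = a \<^bold>* phi u x"
  unfolding phi_def using h(1) bracket_closed
  by (simp add: br_simps smult_r_distr smult_assoc1[symmetric] m_comm)

lemma phi_J: "u \<in> carrier L \<Longrightarrow> j \<in> J \<Longrightarrow> phi u j \<in> J"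
  unfolding phi_def using h(1) by (intro J_add J_smult J_br)

text \<open>Both sides agree up to order two in \<open>u\<close>, as 2h = 1 gives [x1, y1] the right
  coefficient. The rest, \<open>?E\<close>, consists of multiples of [x1, y2], [x2, y1] and
  [x2, y2], which lie in \<open>J\<close> by \<open>R_D2\<close>.\<close>

lemma phi_hom:
  assumes u: "u \<in> U" and x: "x \<in> carrier L" and y: "y \<in> carrier L"
  shows "phi u \<lbrace>x, y\<rbrace> \<^bold>+ \<^bold>- \<lbrace>phi u x, phi u y\<rbrace> \<in> J"
proof -
  define x1 y1 x2 y2 where d: "x1 = \<lbrace>u, x\<rbrace>" "y1 = \<lbrace>u, y\<rbrace>" "x2 = \<lbrace>u, x1\<rbrace>" "y2 = \<lbrace>u, y1\<rbrace>"
  note uc = Uc[OF u]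
  have c: "x1 \<in> carrier L" "y1 \<in> carrier L" "x2 \<in> carrier L" "y2 \<in> carrier L"
    unfolding d using x y uc by (intro bracket_closed; simp)+
  have R: "x1 \<in> R" "y1 \<in> R" "x2 \<in> R" "y2 \<in> R"
    unfolding d using x y uc R_br[OF UR[OF u]] bracket_closed by simp_all
  have 1: "\<lbrace>x1, y2\<rbrace> \<in> J" "\<lbrace>x2, y2\<rbrace> \<in> J" using R_D2[OF _ u y] R unfolding d by blast+
  have "\<lbrace>y1, x2\<rbrace> \<in> J" using R_D2[OF _ u x] R unfolding d by blast
  then have 2: "\<lbrace>x2, y1\<rbrace> \<in> J" using br_swap[OF ide_sub[OF J]] c by blast
  have D1: "\<lbrace>u, \<lbrace>x, y\<rbrace>\<rbrace> = \<lbrace>x1, y\<rbrace> \<^bold>+ \<lbrace>x, y1\<rbrace>" unfolding d by (rule jacobi_right[OF uc x y])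
  have "\<lbrace>u, \<lbrace>x1, y\<rbrace> \<^bold>+ \<lbrace>x, y1\<rbrace>\<rbrace> = \<lbrace>u, \<lbrace>x1, y\<rbrace>\<rbrace> \<^bold>+ \<lbrace>u, \<lbrace>x, y1\<rbrace>\<rbrace>"
    using uc x y c by (intro bracket_add_right bracket_closed)
  also have "\<dots> = (\<lbrace>x2, y\<rbrace> \<^bold>+ \<lbrace>x1, y1\<rbrace>) \<^bold>+ (\<lbrace>x1, y1\<rbrace> \<^bold>+ \<lbrace>x, y2\<rbrace>)"
    using jacobi_right[OF uc c(1) y] jacobi_right[OF uc x c(2)] unfolding d by simp
  finally have D2: "\<lbrace>u, \<lbrace>x1, y\<rbrace> \<^bold>+ \<lbrace>x, y1\<rbrace>\<rbrace> = (\<lbrace>x2, y\<rbrace> \<^bold>+ \<lbrace>x1, y1\<rbrace>) \<^bold>+ (\<lbrace>x1, y1\<rbrace> \<^bold>+ \<lbrace>x, y2\<rbrace>)" .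
  let ?E = "h \<^bold>* \<lbrace>x1, y2\<rbrace> \<^bold>+ (h \<^bold>* \<lbrace>x2, y1\<rbrace> \<^bold>+ h \<^bold>* (h \<^bold>* \<lbrace>x2, y2\<rbrace>))"
  have E: "?E \<in> J" using 1 2 h(1) by (intro J_add J_smult)
  have phi: "phi u x = x \<^bold>+ x1 \<^bold>+ h \<^bold>* x2" "phi u y = y \<^bold>+ y1 \<^bold>+ h \<^bold>* y2"
    unfolding phi_def d by simp_all
  have "\<lbrace>phi u x, phi u y\<rbrace> = \<lbrace>x, y\<rbrace> \<^bold>+ \<lbrace>x1, y\<rbrace> \<^bold>+ \<lbrace>x, y1\<rbrace> \<^bold>+ h \<^bold>* \<lbrace>x2, y\<rbrace> \<^bold>+ \<lbrace>x1, y1\<rbrace> \<^bold>+ h \<^bold>* \<lbrace>x, y2\<rbrace> \<^bold>+ ?E"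
    unfolding phi using x y c h(1) by (simp add: br_simps smult_r_distr M.a_ac)
  moreover have "phi u \<lbrace>x, y\<rbrace> = \<lbrace>x, y\<rbrace> \<^bold>+ \<lbrace>x1, y\<rbrace> \<^bold>+ \<lbrace>x, y1\<rbrace> \<^bold>+ h \<^bold>* \<lbrace>x2, y\<rbrace> \<^bold>+
      (h \<^bold>* \<lbrace>x1, y1\<rbrace> \<^bold>+ h \<^bold>* \<lbrace>x1, y1\<rbrace>) \<^bold>+ h \<^bold>* \<lbrace>x, y2\<rbrace>"
    unfolding phi_def D1 D2 using x y c h(1) by algebra
  ultimately have "\<lbrace>phi u x, phi u y\<rbrace> = phi u \<lbrace>x, y\<rbrace> \<^bold>+ ?E"
    using hh[OF bracket_closed[OF c(1,2)]] by simp
  moreover have "phi u \<lbrace>x, y\<rbrace> \<in> carrier L" using phi_closed uc x y bracket_closed by simp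
  ultimately have "phi u \<lbrace>x, y\<rbrace> \<^bold>+ \<^bold>- \<lbrace>phi u x, phi u y\<rbrace> = \<^bold>- ?E"
    using Jc[OF E] by (simp add: M.minus_add M.r_neg M.a_assoc[symmetric])
  then show ?thesis using J_neg[OF E] by simp
qed

text \<open>In the composition the terms of orders one to three cancel, and the one of order four
  contains (ad u)^3 x, which lies in \<open>J\<close>.\<close>

lemma phi_inv:
  assumes u: "u \<in> U" and x: "x \<in> carrier L"
  shows "phi u (phi (\<^bold>- u) x) \<^bold>+ \<^bold>- x \<in> J"
proof -
  define x1 x2 x3 where d: "x1 = \<lbrace>u, x\<rbrace>" "x2 = \<lbrace>u, x1\<rbrace>" "x3 = \<lbrace>u, x2\<rbrace>"
  note uc = Uc[OF u]
  have c: "x1 \<in> carrier L" "x2 \<in> carrier L" "x3 \<in> carrier L"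
    unfolding d using x uc by (intro bracket_closed; simp)+
  have "x3 \<in> J" unfolding d using R_D2[OF UR[OF u] u x] .
  then have J3: "h \<^bold>* \<lbrace>u, h \<^bold>* x3\<rbrace> \<in> J" using J_smult J_br uc h by blast
  have m: "phi (\<^bold>- u) x = x \<^bold>+ \<^bold>- x1 \<^bold>+ h \<^bold>* x2"
    unfolding phi_def d using x uc h(1) by algebra
  have m1: "\<lbrace>u, x \<^bold>+ \<^bold>- x1 \<^bold>+ h \<^bold>* x2\<rbrace> = x1 \<^bold>+ \<^bold>- x2 \<^bold>+ h \<^bold>* x3"
    using x c uc h(1) by (simp add: br_simps d[symmetric])
  have m2: "\<lbrace>u, x1 \<^bold>+ \<^bold>- x2 \<^bold>+ h \<^bold>* x3\<rbrace> = x2 \<^bold>+ \<^bold>- x3 \<^bold>+ \<lbrace>u, h \<^bold>* x3\<rbrace>"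
    using x c uc h(1) by (simp add: br_simps d[symmetric])
  have "phi u (phi (\<^bold>- u) x) = x \<^bold>+ \<^bold>- x1 \<^bold>+ h \<^bold>* x2 \<^bold>+ (x1 \<^bold>+ \<^bold>- x2 \<^bold>+ h \<^bold>* x3) \<^bold>+
      h \<^bold>* (x2 \<^bold>+ \<^bold>- x3 \<^bold>+ \<lbrace>u, h \<^bold>* x3\<rbrace>)"
    unfolding m unfolding phi_def unfolding m1 unfolding m2 ..
  also have "\<dots> = x \<^bold>+ (h \<^bold>* x2 \<^bold>+ h \<^bold>* x2) \<^bold>+ \<^bold>- x2 \<^bold>+ h \<^bold>* \<lbrace>u, h \<^bold>* x3\<rbrace>"
    using x c uc h(1) by algebra
  also have "\<dots> \<^bold>+ \<^bold>- x = h \<^bold>* \<lbrace>u, h \<^bold>* x3\<rbrace>"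
    unfolding hh[OF c(2)] using x c uc h(1) by algebra
  finally show ?thesis using J3 by simp
qed

text \<open>The image of \<open>M\<close> under \<open>phi u\<close>, enlarged by \<open>B\<close>.
  The quadratic term of \<open>phi u m\<close> lies in \<open>B\<close> and is absorbed
  there.\<close>

definition conj_alg :: "'c \<Rightarrow> 'c set" where
  "conj_alg u = {m \<^bold>+ \<lbrace>u, m\<rbrace> \<^bold>+ b | m b. m \<in> M \<and> b \<in> B}"

lemma conj_algI: "m \<in> M \<Longrightarrow> b \<in> B \<Longrightarrow> m \<^bold>+ \<lbrace>u, m\<rbrace> \<^bold>+ b \<in> conj_alg u"
  unfolding conj_alg_def by blast

lemma B_subset_conj_alg: "u \<in> carrier L \<Longrightarrow> B \<subseteq> conj_alg u"
proof
  fix b assume "u \<in> carrier L" "b \<in> B"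
  then show "b \<in> conj_alg u" using conj_algI[OF sub_zero[OF alg_sub[OF M]], of b u] Bc by simp
qed

lemma alg_conj_alg: assumes u: "u \<in> U" shows "alg (conj_alg u)"
proof -
  note uc = Uc[OF u]
  have eq: "conj_alg u = (\<lambda>m. m \<^bold>+ \<lbrace>u, m\<rbrace>) ` M [+] B"
    unfolding conj_alg_def set_eq_iff ssum_iff by blast
  have i: "sub ((\<lambda>m. m \<^bold>+ \<lbrace>u, m\<rbrace>) ` M)"
  proof (rule sub_image[OF alg_sub[OF M]])
    show "m \<^bold>+ \<lbrace>u, m\<rbrace> \<in> carrier L" if "m \<in> M" for m using Mc[OF that] uc bracket_closed by simp
    show "x \<^bold>+ y \<^bold>+ \<lbrace>u, x \<^bold>+ y\<rbrace> = x \<^bold>+ \<lbrace>u, x\<rbrace> \<^bold>+ (y \<^bold>+ \<lbrace>u, y\<rbrace>)" if "x \<in> M" "y \<in> M" for x y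
      using Mc[OF that(1)] Mc[OF that(2)] uc by algebra
    show "a \<^bold>* x \<^bold>+ \<lbrace>u, a \<^bold>* x\<rbrace> = a \<^bold>* (x \<^bold>+ \<lbrace>u, x\<rbrace>)" if "a \<in> carrier F" "x \<in> M" for x a
      using that Mc[OF that(2)] uc by algebra
  qed
  show ?thesis
  proof (rule algI)
    show "sub (conj_alg u)" unfolding eq using i ide_sub[OF B] sub_ssum by blast
    fix x y assume "x \<in> conj_alg u" "y \<in> conj_alg u"
    then obtain m b n d where x: "m \<in> M" "b \<in> B" "x = m \<^bold>+ \<lbrace>u, m\<rbrace> \<^bold>+ b"
      and y: "n \<in> M" "d \<in> B" "y = n \<^bold>+ \<lbrace>u, n\<rbrace> \<^bold>+ d" unfolding conj_alg_def by blast
    note c = Mc[OF x(1)] Bc[OF x(2)] Mc[OF y(1)] Bc[OF y(2)] uc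
    have xy: "x \<in> carrier L" "y \<in> carrier L" unfolding x y using c bracket_closed by auto
    let ?b = "\<lbrace>\<lbrace>u, m\<rbrace>, \<lbrace>u, n\<rbrace>\<rbrace> \<^bold>+ (\<lbrace>b, y\<rbrace> \<^bold>+ \<lbrace>m \<^bold>+ \<lbrace>u, m\<rbrace>, d\<rbrace>)"
    have mc: "m \<^bold>+ \<lbrace>u, m\<rbrace> \<in> carrier L" using c bracket_closed by simp
    have b: "?b \<in> B"
      by (rule sub_add[OF ide_sub[OF B] UU_br[OF UM_br[OF u x(1)] UM_br[OF u y(1)]]
            sub_add[OF ide_sub[OF B] ide_br'[OF B x(2) xy(2)] ide_br[OF B mc y(2)]]])
    have "\<lbrace>x, y\<rbrace> = \<lbrace>m, n\<rbrace> \<^bold>+ (\<lbrace>\<lbrace>u, m\<rbrace>, n\<rbrace> \<^bold>+ \<lbrace>m, \<lbrace>u, n\<rbrace>\<rbrace>) \<^bold>+ ?b"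
      unfolding x(3) using c xy(2) by (simp add: br_simps y(3) M.a_ac)
    also have "\<lbrace>\<lbrace>u, m\<rbrace>, n\<rbrace> \<^bold>+ \<lbrace>m, \<lbrace>u, n\<rbrace>\<rbrace> = \<lbrace>u, \<lbrace>m, n\<rbrace>\<rbrace>"
      using jacobi_right[OF c(5,1,3)] by simp
    finally show "\<lbrace>x, y\<rbrace> \<in> conj_alg u" using conj_algI[OF alg_br[OF M x(1) y(1)] b] by simp
  qed
qed

lemma phi_conj_alg: assumes u: "u \<in> U" and m: "m \<in> M" shows "phi u m \<in> conj_alg u"
proof -
  have "\<lbrace>u, \<lbrace>u, m\<rbrace>\<rbrace> \<in> B" using UU_br UM_br u m by blast
  then show ?thesis unfolding phi_def using conj_algI[OF m] sub_smult[OF ide_sub[OF B] h(1)] by blast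
qed

text \<open>As [u, m] and \<open>b\<close> lie in \<open>R\<close>, so does \<open>m\<close>, which
  puts it into \<open>B\<close>. This shows later that \<open>conj_alg u\<close> is proper and that
  its residuals contained in \<open>R\<close> lie in \<open>B\<close>.\<close>

lemma R_Int_conj_alg: assumes u: "u \<in> U" shows "R \<inter> conj_alg u \<subseteq> B"
proof
  fix r assume r: "r \<in> R \<inter> conj_alg u"
  then obtain m b where m: "m \<in> M" "b \<in> B" "r = m \<^bold>+ \<lbrace>u, m\<rbrace> \<^bold>+ b" unfolding conj_alg_def by blast
  note c = Mc[OF m(1)] Bc[OF m(2)] Uc[OF u]
  have um: "\<lbrace>u, m\<rbrace> \<in> R" using R_br[OF UR[OF u] c(1)] .
  have "m \<^bold>+ (\<lbrace>u, m\<rbrace> \<^bold>+ b) \<in> R" using r m c bracket_closed by (simp add: M.a_assoc)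
  then have "m \<in> R"
    using sub_add_cancel[OF ide_sub[OF R] c(1)] sub_add[OF ide_sub[OF R] um, of b] m BR by blast
  then have mB: "m \<in> B" using m subs(3) by blast
  then have "\<lbrace>u, m\<rbrace> \<in> B" using ide_br[OF B c(3)] by blast
  then show "r \<in> B" unfolding m(3) using mB m by (intro sub_add[OF ide_sub[OF B]])
qed

lemma phi_nres:
  assumes u: "u \<in> U" and z: "z \<in> nres i M" shows "phi u z \<in> nres i (conj_alg u) [+] J"
proof -
  note a = alg_conj_alg[OF u]
  have up: "conj_alg u \<subseteq> conj_alg u [+] J" using ssum_upper1[OF alg_sub[OF a] ide_sub[OF J]] .
  show ?thesis
  proof (rule nres_hom_mod[OF M a J _ _ _ _ z])
    show "phi u x \<in> conj_alg u [+] J" if "x \<in> M" for x using phi_conj_alg[OF u that] up by blast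
    show "phi u (x \<^bold>+ y) = phi u x \<^bold>+ phi u y" if "x \<in> M" "y \<in> M" for x y
      using phi_add[OF Uc[OF u] Mc[OF that(1)] Mc[OF that(2)]] .
    show "phi u (b \<^bold>* x) = b \<^bold>* phi u x" if "b \<in> carrier F" "x \<in> M" for b x
      using phi_smult[OF Uc[OF u] that(1) Mc[OF that(2)]] .
    show "phi u \<lbrace>x, y\<rbrace> \<^bold>+ \<^bold>- \<lbrace>phi u x, phi u y\<rbrace> \<in> J" if "x \<in> M" "y \<in> M" for x y
      using phi_hom[OF u Mc[OF that(1)] Mc[OF that(2)]] .
  qed
qed

lemma surjn: "u \<in> U \<Longrightarrow> \<exists>u'\<in>U. \<exists>j\<in>J. u = (ad s ^^ n) u' \<^bold>+ j"
proof (induction n arbitrary: u)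
  case 0
  then show ?case using Uc[OF 0] by (intro bexI[OF _ 0] bexI[OF _ sub_zero[OF ide_sub[OF J]]]) simp
next
  case (Suc n)
  obtain v j where v: "v \<in> U" "j \<in> J" "u = \<lbrace>s, v\<rbrace> \<^bold>+ j" using surj[OF Suc.prems] by blast
  obtain w i where w: "w \<in> U" "i \<in> J" "v = (ad s ^^ n) w \<^bold>+ i" using Suc.IH[OF v(1)] by blast
  have c: "(ad s ^^ n) w \<in> carrier L" "i \<in> carrier L" "j \<in> carrier L"
    using adn_closed[OF sc Uc[OF w(1)]] Jc v w by auto
  have "u = (ad s ^^ Suc n) w \<^bold>+ (\<lbrace>s, i\<rbrace> \<^bold>+ j)"
    unfolding v(3) w(3) adn_Suc using sc c by algebra
  then show ?case using w(1) J_add[OF J_br[OF sc w(2)] v(2)] by blast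
qed

lemma phi_adn:
  assumes u: "u \<in> U" and x: "x \<in> carrier L"
  shows "\<exists>j\<in>J. (ad (phi u s) ^^ n) (phi u x) = phi u ((ad s ^^ n) x) \<^bold>+ j"
proof (induction n)
  case 0
  show ?case using phi_closed[OF Uc[OF u] x] sub_zero[OF ide_sub[OF J]] by (intro bexI[of _ "\<^bold>0"]) auto
next
  case (Suc n)
  then obtain j where j: "j \<in> J" "(ad (phi u s) ^^ n) (phi u x) = phi u ((ad s ^^ n) x) \<^bold>+ j" by blast
  let ?y = "(ad s ^^ n) x" and ?p = "phi u s"
  note uc = Uc[OF u]
  have y: "?y \<in> carrier L" using adn_closed[OF sc x] .
  have c: "?p \<in> carrier L" "phi u ?y \<in> carrier L" "j \<in> carrier L" "phi u \<lbrace>s, ?y\<rbrace> \<in> carrier L"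
    using phi_closed[OF uc] sc y Jc j bracket_closed by auto
  define e where "e = phi u \<lbrace>s, ?y\<rbrace> \<^bold>+ \<^bold>- \<lbrace>?p, phi u ?y\<rbrace>"
  have e: "e \<in> J" unfolding e_def by (rule phi_hom[OF u sc y])
  have "\<lbrace>?p, phi u ?y\<rbrace> = phi u \<lbrace>s, ?y\<rbrace> \<^bold>+ \<^bold>- e"
    unfolding e_def using c by algebra
  then have "(ad ?p ^^ Suc n) (phi u x) = phi u ((ad s ^^ Suc n) x) \<^bold>+ (\<^bold>- e \<^bold>+ \<lbrace>?p, j\<rbrace>)"
    unfolding adn_Suc j(2) using c Jc[OF e] bracket_closed
    by (simp add: bracket_add_right M.a_assoc)
  moreover have "\<^bold>- e \<^bold>+ \<lbrace>?p, j\<rbrace> \<in> J" using J_add[OF J_neg[OF e] J_br[OF c(1) j(1)]] .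
  ultimately show ?case by blast
qed

text \<open>Modulo \<open>J\<close> the element \<open>s\<close> is \<open>phi u (phi (-u) s)\<close>, and \<open>(ad s)^n\<close> is easy to apply to
  \<open>phi (-u) s\<close>.\<close>

lemma adn_phi_s:
  assumes u: "u \<in> U" and n: "stab < n"
  defines "w \<equiv> (ad s ^^ n) u"
  shows "\<exists>j\<in>J. (ad (phi u s) ^^ n) s = \<lbrace>s, w\<rbrace> \<^bold>+ \<lbrace>u, \<lbrace>s, w\<rbrace>\<rbrace> \<^bold>+ j"
proof -
  note uc = Uc[OF u]
  let ?p = "phi u s" and ?x = "phi (\<^bold>- u) s"
  have wU: "w \<in> U" unfolding w_def using adn_in[of U s] MU[OF s] u by blast
  have wc: "w \<in> carrier L" using Uc wU .
  have nuc: "\<^bold>- u \<in> carrier L" using uc by simp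
  have c: "?p \<in> carrier L" "?x \<in> carrier L" using phi_closed sc uc nuc by auto
  define e where "e = phi u ?x \<^bold>+ \<^bold>- s"
  have eJ: "e \<in> J" unfolding e_def by (rule phi_inv[OF u sc])
  have ps: "phi u ?x = s \<^bold>+ e" unfolding e_def using phi_closed[OF uc c(2)] sc by algebra
  have split: "(ad ?p ^^ n) (phi u ?x) = (ad ?p ^^ n) s \<^bold>+ (ad ?p ^^ n) e"
    unfolding ps by (rule adn_add[OF c(1) sc Jc[OF eJ]])
  have e': "(ad ?p ^^ n) e \<in> J" using adn_in[of J ?p] J_br[OF c(1)] eJ by blast
  obtain j where j: "j \<in> J" "(ad ?p ^^ n) (phi u ?x) = phi u ((ad s ^^ n) ?x) \<^bold>+ j"
    using phi_adn[OF u c(2)] by blast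
  let ?t = "h \<^bold>* \<lbrace>u, \<lbrace>u, s\<rbrace>\<rbrace>"
  \<comment> \<open>The power (ad s)^n kills \<open>s\<close>, takes [s, u] to [s, w], and takes
    \<open>?t\<close> into \<open>J\<close> by \<open>nil\<close>, since \<open>?t\<close> lies in
    \<open>B\<close> and hence in \<open>M\<close>.\<close>
  have x: "?x = s \<^bold>+ \<lbrace>s, u\<rbrace> \<^bold>+ ?t"
    unfolding phi_def bracket_anti[OF sc uc] using sc uc h(1) by algebra
  have tM: "?t \<in> M" by (rule BM[OF sub_smult[OF ide_sub[OF B] h(1) UU_br[OF u UM_br[OF u s]]]])
  have n0: "n = Suc (n - 1)" using n by simp
  have s0: "(ad s ^^ n) s = \<^bold>0"
    by (subst n0, subst adn_Suc') (simp add: bracket_self sc adn_in[of "{\<^bold>0}", simplified])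
  have su: "(ad s ^^ n) \<lbrace>s, u\<rbrace> = \<lbrace>s, w\<rbrace>" unfolding w_def adn_Suc'[symmetric] by simp
  have "(ad s ^^ n) ?x = \<lbrace>s, w\<rbrace> \<^bold>+ (ad s ^^ n) ?t"
    unfolding x using sc uc Mc[OF tM] bracket_closed adn_closed wc by (simp add: adn_add s0 su)
  moreover define e2 where "e2 = (ad s ^^ n) ?t"
  moreover have e2: "e2 \<in> J" unfolding e2_def using nil[OF tM n] .
  ultimately have "phi u ((ad s ^^ n) ?x) = phi u \<lbrace>s, w\<rbrace> \<^bold>+ phi u e2"
    using phi_add[OF uc, of "\<lbrace>s, w\<rbrace>" e2] sc wc Jc bracket_closed by simp
  moreover have pe: "phi u e2 \<in> J" using phi_J[OF uc e2] .
  moreover have "\<lbrace>u, \<lbrace>u, \<lbrace>s, w\<rbrace>\<rbrace>\<rbrace> \<in> J" using UB_br[OF u UU_br[OF u MU[OF s wU]]] .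
  then have r: "h \<^bold>* \<lbrace>u, \<lbrace>u, \<lbrace>s, w\<rbrace>\<rbrace>\<rbrace> \<in> J" using J_smult h by blast
  let ?r = "h \<^bold>* \<lbrace>u, \<lbrace>u, \<lbrace>s, w\<rbrace>\<rbrace>\<rbrace>" and ?e' = "(ad ?p ^^ n) e"
  let ?j = "?r \<^bold>+ phi u e2 \<^bold>+ j \<^bold>+ \<^bold>- ?e'"
  have jJ: "?j \<in> J" using r pe j e' by (intro J_add J_neg)
  have cc: "?r \<in> carrier L" "phi u e2 \<in> carrier L" "j \<in> carrier L" "?e' \<in> carrier L"
    "\<lbrace>s, w\<rbrace> \<in> carrier L" "\<lbrace>u, \<lbrace>s, w\<rbrace>\<rbrace> \<in> carrier L" "(ad ?p ^^ n) s \<in> carrier L"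
    using Jc r pe j(1) e' sc wc uc bracket_closed adn_closed[OF c(1) sc] by auto
  have "(ad ?p ^^ n) s \<^bold>+ ?e' = \<lbrace>s, w\<rbrace> \<^bold>+ \<lbrace>u, \<lbrace>s, w\<rbrace>\<rbrace> \<^bold>+ ?r \<^bold>+ phi u e2 \<^bold>+ j"
    using calculation j(2) split unfolding phi_def[of u "\<lbrace>s, w\<rbrace>"] by simp
  then have fin: "(ad ?p ^^ n) s = \<lbrace>s, w\<rbrace> \<^bold>+ \<lbrace>u, \<lbrace>s, w\<rbrace>\<rbrace> \<^bold>+ ?r \<^bold>+ phi u e2 \<^bold>+ j \<^bold>+ \<^bold>- ?e'"
    using cc by (metis M.add.inv_solve_right M.add.m_closed)
  have "(ad ?p ^^ n) s = \<lbrace>s, w\<rbrace> \<^bold>+ \<lbrace>u, \<lbrace>s, w\<rbrace>\<rbrace> \<^bold>+ ?j"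
    unfolding fin using cc by (simp add: M.a_assoc)
  then show ?thesis using jJ by blast
qed

end

section \<open>Polynomial functions with values in \<open>L\<close>\<close>

context lie_algebra
begin

definition is_vpoly :: "('f \<Rightarrow> 'a) \<Rightarrow> bool" where
  "is_vpoly f \<longleftrightarrow> (\<exists>cs. set cs \<subseteq> carrier L \<and> (\<forall>a\<in>carrier F. f a = vpoly cs a))"

lemma is_vpoly_const: "x \<in> carrier L \<Longrightarrow> is_vpoly (\<lambda>a. x)"
  unfolding is_vpoly_def by (rule exI[of _ "[x]"]) simp

lemma is_vpoly_times:
  assumes "is_vpoly f" shows "is_vpoly (\<lambda>a. a \<^bold>* f a)"
proof -
  obtain cs where "set cs \<subseteq> carrier L" "\<And>a. a \<in> carrier F \<Longrightarrow> f a = vpoly cs a"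
    using assms unfolding is_vpoly_def by blast
  then show ?thesis unfolding is_vpoly_def by (intro exI[of _ "\<^bold>0 # cs"]) (simp add: vpoly_closed)
qed

lemma vpoly_add:
  "set cs \<subseteq> carrier L \<Longrightarrow> set ds \<subseteq> carrier L \<Longrightarrow> \<exists>es. set es \<subseteq> carrier L \<and> (\<forall>a\<in>carrier F. vpoly cs a \<^bold>+ vpoly ds a = vpoly es a)"
proof (induction cs arbitrary: ds)
  case Nil
  then show ?case by (intro exI[of _ ds]) (simp add: vpoly_closed)
next
  case (Cons c cs)
  show ?case
  proof (cases ds)
    case Nil
    then show ?thesis using Cons.prems by (intro exI[of _ "c # cs"]) (simp add: vpoly_closed)
  next
    case (Cons d ds')
    then obtain es where es: "set es \<subseteq> carrier L" "\<And>a. a \<in> carrier F \<Longrightarrow> vpoly cs a \<^bold>+ vpoly ds' a = vpoly es a"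
      using Cons.IH[of ds'] Cons.prems by auto
    have "vpoly (c # cs) a \<^bold>+ vpoly ds a = vpoly ((c \<^bold>+ d) # es) a" if a: "a \<in> carrier F" for a
    proof -
      have "vpoly cs a \<in> carrier L" "vpoly ds' a \<in> carrier L" "c \<in> carrier L" "d \<in> carrier L"
        using Cons.prems Cons a vpoly_closed by auto
      then show ?thesis unfolding Cons using a es(2)[OF a, symmetric] by (simp add: smult_r_distr M.a_ac)
    qed
    then show ?thesis using es(1) Cons.prems Cons by (intro exI[of _ "(c \<^bold>+ d) # es"]) auto
  qed
qed

lemma is_vpoly_add:
  assumes "is_vpoly f" "is_vpoly g" shows "is_vpoly (\<lambda>a. f a \<^bold>+ g a)"
proof -
  obtain cs where cs: "set cs \<subseteq> carrier L" "\<And>a. a \<in> carrier F \<Longrightarrow> f a = vpoly cs a"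
    using assms(1) unfolding is_vpoly_def by blast
  obtain ds where ds: "set ds \<subseteq> carrier L" "\<And>a. a \<in> carrier F \<Longrightarrow> g a = vpoly ds a"
    using assms(2) unfolding is_vpoly_def by blast
  then show ?thesis using vpoly_add[OF cs(1) ds(1)] cs unfolding is_vpoly_def by auto
qed

lemma is_vpoly_br:
  assumes x: "x \<in> carrier L" and f: "is_vpoly f" shows "is_vpoly (\<lambda>a. \<lbrace>x, f a\<rbrace>)"
proof -
  obtain cs where cs: "set cs \<subseteq> carrier L" "\<And>a. a \<in> carrier F \<Longrightarrow> f a = vpoly cs a"
    using f unfolding is_vpoly_def by blast
  have "\<lbrace>x, vpoly cs a\<rbrace> = vpoly (map (ad x) cs) a" if "a \<in> carrier F" for a
    using cs(1)
  proof (induction cs)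
    case (Cons c cs)
    then have "c \<in> carrier L" "vpoly cs a \<in> carrier L" using vpoly_closed that by auto
    then show ?case using Cons x that by (simp add: br_simps)
  qed (use x in simp)
  then show ?thesis unfolding is_vpoly_def using cs bracket_closed[OF x]
    by (intro exI[of _ "map (ad x) cs"]) auto
qed

lemma is_vpoly_closed: "is_vpoly f \<Longrightarrow> a \<in> carrier F \<Longrightarrow> f a \<in> carrier L"
  unfolding is_vpoly_def using vpoly_closed by force

end

section \<open>Brackets of \<open>U\<close> with \<open>J\<close>\<close>

context lie_split
begin

lemma J_adn: "x \<in> carrier L \<Longrightarrow> z \<in> J \<Longrightarrow> (ad x ^^ n) z \<in> J"
  using adn_in[of J x z n] J_br by blast

lemma JJ: "ide (brs J J)" "brs J J \<subseteq> J"
  using ide_brs[OF J J] brs_least[OF ide_sub[OF J]] J_br Jc by auto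

text \<open>Since phi (a u) s = s + a [u, s] + ..., the left side is a polynomial in
  \<open>a\<close>. Its linear coefficient is the commutator of \<open>ad u\<close> with (ad s)^n,
  as conjugation by exponentials suggests; the higher ones go into \<open>P\<close>.\<close>

lemma phi_expand:
  assumes u: "u \<in> carrier L" and z: "z \<in> carrier L"
  shows "\<exists>P. is_vpoly P \<and> (\<forall>a\<in>carrier F. (ad (phi (a \<^bold>* u) s) ^^ n) z =
    (ad s ^^ n) z \<^bold>+ a \<^bold>* ((\<lbrace>u, (ad s ^^ n) z\<rbrace> \<^bold>+ \<^bold>- (ad s ^^ n) \<lbrace>u, z\<rbrace>) \<^bold>+ a \<^bold>* P a))"
proof (induction n)
  case 0
  have "(ad (phi (a \<^bold>* u) s) ^^ 0) z =
    (ad s ^^ 0) z \<^bold>+ a \<^bold>* ((\<lbrace>u, (ad s ^^ 0) z\<rbrace> \<^bold>+ \<^bold>- (ad s ^^ 0) \<lbrace>u, z\<rbrace>) \<^bold>+ a \<^bold>* \<^bold>0)"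
    if "a \<in> carrier F" for a
    using that z u bracket_closed by (simp add: M.r_neg)
  then show ?case using is_vpoly_const[of "\<^bold>0"] by (intro exI[of _ "\<lambda>a. \<^bold>0"]) auto
next
  case (Suc n)
  let ?v = "\<lbrace>u, s\<rbrace>" and ?y = "h \<^bold>* \<lbrace>u, \<lbrace>u, s\<rbrace>\<rbrace>"
  let ?A = "(ad s ^^ n) z" and ?B = "\<lbrace>u, (ad s ^^ n) z\<rbrace> \<^bold>+ \<^bold>- (ad s ^^ n) \<lbrace>u, z\<rbrace>"
  obtain P where P: "is_vpoly P" "\<And>a. a \<in> carrier F \<Longrightarrow> (ad (phi (a \<^bold>* u) s) ^^ n) z = ?A \<^bold>+ a \<^bold>* (?B \<^bold>+ a \<^bold>* P a)"
    using Suc by blast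
  have c: "?v \<in> carrier L" "?y \<in> carrier L" "?A \<in> carrier L" "?B \<in> carrier L" "(ad s ^^ n) \<lbrace>u, z\<rbrace> \<in> carrier L"
    using u z sc h(1) bracket_closed adn_closed[OF sc] by auto
  \<comment> \<open>The coefficient of a^2, with all higher terms, in the bracket of s + a v + a^2 y
    with A + a (B + a P a).\<close>
  define Q where "Q a = (\<lbrace>s, P a\<rbrace> \<^bold>+ \<lbrace>?v, ?B\<rbrace> \<^bold>+ \<lbrace>?y, ?A\<rbrace>) \<^bold>+ a \<^bold>* ((\<lbrace>?v, P a\<rbrace> \<^bold>+ \<lbrace>?y, ?B\<rbrace>) \<^bold>+ a \<^bold>* \<lbrace>?y, P a\<rbrace>)" for a
  have Q: "is_vpoly Q"
    unfolding Q_def[abs_def]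
    by (rule is_vpoly_add[OF is_vpoly_add[OF is_vpoly_add[OF is_vpoly_br[OF sc P(1)]
          is_vpoly_const[OF bracket_closed[OF c(1,4)]]] is_vpoly_const[OF bracket_closed[OF c(2,3)]]]
        is_vpoly_times[OF is_vpoly_add[OF is_vpoly_add[OF is_vpoly_br[OF c(1) P(1)]
          is_vpoly_const[OF bracket_closed[OF c(2,4)]]] is_vpoly_times[OF is_vpoly_br[OF c(2) P(1)]]]]])
  have "(ad (phi (a \<^bold>* u) s) ^^ Suc n) z = (ad s ^^ Suc n) z \<^bold>+
      a \<^bold>* ((\<lbrace>u, (ad s ^^ Suc n) z\<rbrace> \<^bold>+ \<^bold>- (ad s ^^ Suc n) \<lbrace>u, z\<rbrace>) \<^bold>+ a \<^bold>* Q a)"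
    if a: "a \<in> carrier F" for a
  proof -
    define p A C where d: "p = P a" "A = ?A" "C = ?B"
    have pc: "p \<in> carrier L" "A \<in> carrier L" "C \<in> carrier L" unfolding d using is_vpoly_closed[OF P(1) a] c by auto
    have phi: "phi (a \<^bold>* u) s = s \<^bold>+ a \<^bold>* ?v \<^bold>+ a \<^bold>* (a \<^bold>* ?y)"
      unfolding phi_def using a u sc h(1) bracket_closed
      by (simp add: br_simps smult_assoc1[symmetric] m_ac)
    have "\<lbrace>?v, A\<rbrace> \<^bold>+ \<lbrace>s, C\<rbrace> = \<lbrace>u, \<lbrace>s, A\<rbrace>\<rbrace> \<^bold>+ \<^bold>- \<lbrace>s, (ad s ^^ n) \<lbrace>u, z\<rbrace>\<rbrace>"
    proof -
      have "\<lbrace>s, C\<rbrace> = \<lbrace>s, \<lbrace>u, A\<rbrace>\<rbrace> \<^bold>+ \<^bold>- \<lbrace>s, (ad s ^^ n) \<lbrace>u, z\<rbrace>\<rbrace>"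
        unfolding d using c(3,5) u sc bracket_closed by (simp add: br_simps)
      then show ?thesis
        unfolding jacobi_right[OF u sc pc(2)] using u sc pc(2) c bracket_closed by (simp add: M.a_assoc)
    qed
    then have lin: "\<lbrace>?v, A\<rbrace> \<^bold>+ \<lbrace>s, C\<rbrace> = \<lbrace>u, (ad s ^^ Suc n) z\<rbrace> \<^bold>+ \<^bold>- (ad s ^^ Suc n) \<lbrace>u, z\<rbrace>"
      unfolding d by simp
    have "(ad (phi (a \<^bold>* u) s) ^^ Suc n) z = \<lbrace>s \<^bold>+ a \<^bold>* ?v \<^bold>+ a \<^bold>* (a \<^bold>* ?y), A \<^bold>+ a \<^bold>* (C \<^bold>+ a \<^bold>* p)\<rbrace>"
      unfolding adn_Suc P(2)[OF a] unfolding phi d ..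
    also have "\<dots> = \<lbrace>s, A\<rbrace> \<^bold>+ a \<^bold>* ((\<lbrace>?v, A\<rbrace> \<^bold>+ \<lbrace>s, C\<rbrace>) \<^bold>+ a \<^bold>*
        ((\<lbrace>s, p\<rbrace> \<^bold>+ \<lbrace>?v, C\<rbrace> \<^bold>+ \<lbrace>?y, A\<rbrace>) \<^bold>+ a \<^bold>* ((\<lbrace>?v, p\<rbrace> \<^bold>+ \<lbrace>?y, C\<rbrace>) \<^bold>+ a \<^bold>* \<lbrace>?y, p\<rbrace>)))"
    proof -
      define v y where vy: "v = ?v" "y = ?y"
      have "v \<in> carrier L" "y \<in> carrier L" unfolding vy using c by auto
      then show ?thesis unfolding vy(2)[symmetric] unfolding vy(1)[symmetric]
        using pc a sc by (simp add: br_simps smult_r_distr M.a_ac)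
    qed
    finally show ?thesis unfolding lin unfolding Q_def d by (simp only: adn_Suc)
  qed
  then show ?case using Q by blast
qed

text \<open>Writing u = [s, v] + j gives [u, z] = [s, [v, z]] - [v, [s, z]] + [j, z]. The induction
  on \<open>k\<close> covers [v, [s, z]], the last term lies in [J, J], and an inner induction gains
  a power of \<open>ad s\<close> through [s, [v, z]] until \<open>n\<close> are reached.\<close>

lemma br_kernel:
  assumes n: "n \<ge> stab"
  shows "z \<in> J \<Longrightarrow> (ad s ^^ k) z \<in> brs J J \<Longrightarrow> u \<in> U \<Longrightarrow> \<lbrace>u, z\<rbrace> \<in> (ad s ^^ n) ` J [+] brs J J"
proof (induction k arbitrary: z u)
  case 0
  then show ?case
    using ide_br[OF JJ(1) Uc] ssum_upper2[OF adn_image[OF sc ide_sub[OF J]] ide_sub[OF JJ(1)]] by auto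
next
  case (Suc k)
  let ?S = "(ad s ^^ n) ` J [+] brs J J"
  have im: "sub ((ad s ^^ i) ` J)" for i using adn_image[OF sc ide_sub[OF J]] .
  have S: "sub ?S" "(ad s ^^ n) ` J \<subseteq> ?S" "brs J J \<subseteq> ?S"
    using sub_ssum[OF im ide_sub[OF JJ(1)]] ssum_upper1[OF im ide_sub[OF JJ(1)]] ssum_upper2[OF im ide_sub[OF JJ(1)]] by auto
  have sS: "\<lbrace>s, x\<rbrace> \<in> ?S" if x: "x \<in> ?S" for x
  proof -
    obtain a b where ab: "a \<in> J" "b \<in> brs J J" "x = (ad s ^^ n) a \<^bold>+ b" using x unfolding ssum_iff by blast
    have "\<lbrace>s, (ad s ^^ n) a\<rbrace> = (ad s ^^ n) \<lbrace>s, a\<rbrace>" using adn_Suc adn_Suc' by simp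
    then have 1: "\<lbrace>s, (ad s ^^ n) a\<rbrace> \<in> ?S" using S(2) J_br[OF sc ab(1)] by auto
    have 2: "\<lbrace>s, b\<rbrace> \<in> ?S" using S(3) ide_br[OF JJ(1) sc ab(2)] by auto
    have "\<lbrace>s, x\<rbrace> = \<lbrace>s, (ad s ^^ n) a\<rbrace> \<^bold>+ \<lbrace>s, b\<rbrace>"
      unfolding ab(3) using adn_closed[OF sc Jc[OF ab(1)]] sub_mem[OF ide_sub[OF JJ(1)] ab(2)]
      by (intro bracket_add_right sc)
    then show ?thesis using 1 2 sub_add[OF S(1)] by simp
  qed
  have sz: "(ad s ^^ k) \<lbrace>s, z\<rbrace> \<in> brs J J" using Suc.prems(2) by (simp only: adn_Suc')
  have vsz: "\<lbrace>v, \<lbrace>s, z\<rbrace>\<rbrace> \<in> ?S" if "v \<in> U" for v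
    by (rule Suc.IH[OF J_br[OF sc Suc.prems(1)] sz that])
  note zJ = Suc.prems(1)
  have "\<forall>u\<in>U. \<lbrace>u, z\<rbrace> \<in> (ad s ^^ i) ` J [+] ?S" for i
  proof (induction i)
    case 0
    have "J \<subseteq> (ad s ^^ 0) ` J [+] ?S" using ssum_upper1[OF ide_sub[OF J] S(1)] by simp
    then show ?case using J_br[OF Uc zJ] by blast
  next
    case (Suc i)
    let ?S' = "(ad s ^^ Suc i) ` J [+] ?S"
    have S': "sub ?S'" "(ad s ^^ Suc i) ` J \<subseteq> ?S'" "?S \<subseteq> ?S'"
      using sub_ssum[OF im[of "Suc i"] S(1)] ssum_upper1[OF im[of "Suc i"] S(1)]
        ssum_upper2[OF im[of "Suc i"] S(1)] by (simp_all only:)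
    show ?case
    proof
      fix u assume u: "u \<in> U"
      obtain v j where v: "v \<in> U" "j \<in> J" "u = \<lbrace>s, v\<rbrace> \<^bold>+ j" using surj[OF u] by blast
      note c = sc Uc[OF v(1)] Jc[OF zJ] Jc[OF v(2)]
      have 1: "\<lbrace>v, \<lbrace>s, z\<rbrace>\<rbrace> \<in> ?S'" using vsz[OF v(1)] S'(3) by blast
      obtain a b where ab: "a \<in> J" "b \<in> ?S" "\<lbrace>v, z\<rbrace> = (ad s ^^ i) a \<^bold>+ b"
        using Suc.IH v(1) by (blast elim: ssumE)
      have "\<lbrace>s, \<lbrace>v, z\<rbrace>\<rbrace> = (ad s ^^ Suc i) a \<^bold>+ \<lbrace>s, b\<rbrace>"
        unfolding ab(3) adn_Suc
        using adn_closed[OF sc Jc[OF ab(1)]] sub_mem[OF S(1) ab(2)] by (intro bracket_add_right sc)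
      then have 2: "\<lbrace>s, \<lbrace>v, z\<rbrace>\<rbrace> \<in> ?S'" using ab(1) sS[OF ab(2)] by (auto intro!: ssumI simp del: funpow.simps)
      have 3: "\<lbrace>j, z\<rbrace> \<in> ?S'" using brsI[OF v(2) zJ] S(3) S'(3) by blast
      have "\<lbrace>u, z\<rbrace> = (\<lbrace>s, \<lbrace>v, z\<rbrace>\<rbrace> \<^bold>+ \<^bold>- \<lbrace>v, \<lbrace>s, z\<rbrace>\<rbrace>) \<^bold>+ \<lbrace>j, z\<rbrace>"
        unfolding v(3) jacobi_left[OF c(1,2,3), symmetric] using c by (intro bracket_add_left bracket_closed)
      then show "\<lbrace>u, z\<rbrace> \<in> ?S'"
        using sub_add[OF S'(1) sub_add[OF S'(1) 2 sub_neg[OF S'(1) 1]] 3] by simp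
    qed
  qed
  then have "\<lbrace>u, z\<rbrace> \<in> (ad s ^^ n) ` J [+] ?S" using Suc.prems(3) by blast
  then show ?case using ssum_least[OF S(1,2) order_refl] by blast
qed

text \<open>Scaling \<open>u\<close> in \<open>phi_expand\<close> puts the constant and linear
  coefficients into \<open>W\<close>. On the Fitting null component of \<open>J\<close> modulo
  [J, J] the claim is \<open>br_kernel\<close>; on the image of (ad s)^n the linear coefficient
  reduces it to (ad s)^n [u, z1], a constant coefficient.\<close>

lemma br_U_J_infinite:
  assumes W: "sub W" "brs J J \<subseteq> W" and n: "n \<ge> stab" and inf: "infinite (carrier F)"
    and phiW: "\<And>u z. u \<in> U \<Longrightarrow> z \<in> J \<Longrightarrow> (ad (phi u s) ^^ n) z \<in> W"
  shows "u \<in> U \<Longrightarrow> z \<in> J \<Longrightarrow> \<lbrace>u, z\<rbrace> \<in> W"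
proof -
  have coeffs: "(ad s ^^ n) z \<in> W" "\<lbrace>u, (ad s ^^ n) z\<rbrace> \<^bold>+ \<^bold>- (ad s ^^ n) \<lbrace>u, z\<rbrace> \<in> W"
    if u: "u \<in> U" and z: "z \<in> J" for u z
  proof -
    let ?A = "(ad s ^^ n) z" and ?B = "\<lbrace>u, (ad s ^^ n) z\<rbrace> \<^bold>+ \<^bold>- (ad s ^^ n) \<lbrace>u, z\<rbrace>"
    note c = Uc[OF u] Jc[OF z]
    obtain P where P: "is_vpoly P" "\<And>a. a \<in> carrier F \<Longrightarrow> (ad (phi (a \<^bold>* u) s) ^^ n) z = ?A \<^bold>+ a \<^bold>* (?B \<^bold>+ a \<^bold>* P a)"
      using phi_expand[OF c] by blast
    obtain cs where cs: "set cs \<subseteq> carrier L" "\<And>a. a \<in> carrier F \<Longrightarrow> P a = vpoly cs a"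
      using P(1) unfolding is_vpoly_def by blast
    have AB: "?A \<in> carrier L" "?B \<in> carrier L" using c sc adn_closed bracket_closed by auto
    have "set (?A # ?B # cs) \<subseteq> W"
    proof (rule vpoly_coeffs[OF W(1) inf])
      show "set (?A # ?B # cs) \<subseteq> carrier L" using AB cs by simp
      show "finite {}" by simp
      fix a assume a: "a \<in> carrier F"
      have "(ad (phi (a \<^bold>* u) s) ^^ n) z \<in> W" using phiW[OF sub_smult[OF U a u] z] .
      then show "vpoly (?A # ?B # cs) a \<in> W" using P(2)[OF a] cs(2)[OF a] by simp
    qed
    then show "?A \<in> W" "?B \<in> W" by auto
  qed
  have im: "(ad s ^^ n) ` J [+] brs J J \<subseteq> W"
    using coeffs(1)[OF sub_zero[OF U]] by (intro ssum_least[OF W(1) _ W(2)]) auto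
  assume u: "u \<in> U" and z: "z \<in> J"
  note uc = Uc[OF u]
  obtain z0 z1 where z01: "z0 \<in> J" "(ad s ^^ n) z0 \<in> brs J J" "z1 \<in> J" "z = z0 \<^bold>+ (ad s ^^ n) z1"
    by (rule fitting[OF sc ide_sub[OF J] J_br[OF sc] ide_sub[OF JJ(1)] JJ(2) ide_br[OF JJ(1) sc] n z])
  have 0: "\<lbrace>u, z0\<rbrace> \<in> W" using br_kernel[OF n z01(1,2) u] im by blast
  have c: "\<lbrace>u, (ad s ^^ n) z1\<rbrace> \<in> carrier L" "(ad s ^^ n) \<lbrace>u, z1\<rbrace> \<in> carrier L"
    using uc Jc[OF z01(3)] sc adn_closed bracket_closed by auto
  have "(ad s ^^ n) \<lbrace>u, z1\<rbrace> \<in> W" using coeffs(1)[OF u J_br[OF uc z01(3)]] .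
  then have 1: "\<lbrace>u, (ad s ^^ n) z1\<rbrace> \<in> W"
    using sub_add_cancel[OF W(1) c(1) sub_neg[OF W(1)] coeffs(2)[OF u z01(3)]] by blast
  have "\<lbrace>u, z\<rbrace> = \<lbrace>u, z0\<rbrace> \<^bold>+ \<lbrace>u, (ad s ^^ n) z1\<rbrace>"
    unfolding z01(4) using uc Jc[OF z01(1)] adn_closed[OF sc Jc[OF z01(3)]] by (intro bracket_add_right)
  then show "\<lbrace>u, z\<rbrace> \<in> W" using 0 1 sub_add[OF W(1)] by simp
qed

text \<open>In characteristic \<open>p\<close> the powers \<open>(ad x)^(p^e)\<close> are derivations; the odd part of
  \<open>u \<mapsto> (ad (phi u s))^(p^e)\<close> agrees with \<open>-2 ad w\<close> up to an operator that commutes with \<open>ad s\<close>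
  on \<open>J\<close> modulo \<open>[J, J]\<close>.\<close>

lemma br_U_J_prime:
  assumes W: "sub W" "brs J J \<subseteq> W" and p: "prime p" "nscal p = \<zero>\<^bsub>F\<^esub>" and n: "n = p ^ e" "stab < n"
    and phiW: "\<And>u z. u \<in> U \<Longrightarrow> z \<in> J \<Longrightarrow> (ad (phi u s) ^^ n) z \<in> W"
    and sW: "\<And>z. z \<in> J \<Longrightarrow> (ad s ^^ n) z \<in> W"
  shows "u \<in> U \<Longrightarrow> z \<in> J \<Longrightarrow> \<lbrace>u, z\<rbrace> \<in> W"
proof -
  note W_add = sub_add[OF W(1)] and W_neg = sub_neg[OF W(1)]
  have der: "lie_deriv (ad x ^^ n)" if "x \<in> carrier L" for x
    unfolding n(1) using lie_deriv_prime_power[OF lie_deriv_ad[OF that] p] .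
  note derD = lie_derivD[OF der]
  have main: "\<lbrace>(ad s ^^ n) u, (ad s ^^ n) z\<rbrace> \<in> W" if u: "u \<in> U" and z: "z \<in> J" for u z
  proof -
    note uc = Uc[OF u] and zc = Jc[OF z]
    define w where "w = (ad s ^^ n) u"
    have wc: "w \<in> carrier L" unfolding w_def using adn_closed[OF sc uc] .
    have nu: "\<^bold>- u \<in> U" using sub_neg[OF U u] .
    have nw: "(ad s ^^ n) (\<^bold>- u) = \<^bold>- w" unfolding w_def using adn_neg[OF sc uc] .
    let ?x = "phi u s" and ?y = "phi (\<^bold>- u) s"
    have xc: "?x \<in> carrier L" and yc: "?y \<in> carrier L" using phi_closed sc uc by auto
    define dp where "dp = ad ?x ^^ n"
    define dm where "dm = ad ?y ^^ n"
    note dpD = derD[OF xc, folded dp_def] and dmD = derD[OF yc, folded dm_def]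
    have dc: "dp a \<in> carrier L" "dm a \<in> carrier L" if "a \<in> carrier L" for a
      using dpD(1)[OF that] dmD(1)[OF that] by auto
    obtain j where j: "j \<in> J" "dp s = \<lbrace>s, w\<rbrace> \<^bold>+ \<lbrace>u, \<lbrace>s, w\<rbrace>\<rbrace> \<^bold>+ j"
      using adn_phi_s[OF u n(2)] unfolding w_def dp_def by blast
    obtain i where i: "i \<in> J" "dm s = \<lbrace>s, \<^bold>- w\<rbrace> \<^bold>+ \<lbrace>\<^bold>- u, \<lbrace>s, \<^bold>- w\<rbrace>\<rbrace> \<^bold>+ i"
      using adn_phi_s[OF nu n(2)] unfolding nw dm_def by blast
    \<comment> \<open>By \<open>adn_phi_s\<close>, modulo \<open>J\<close> both \<open>dp s\<close>
      and \<open>dm s\<close> contain [u, [s, w]], while [s, w] occurs with opposite signs. The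
      difference cancels the former and the added 2 ad w the latter, so \<open>chi\<close> commutes
      with \<open>ad s\<close> on \<open>J\<close> modulo [J, J].\<close>
    define chi where "chi a = dp a \<^bold>+ \<^bold>- dm a \<^bold>+ (\<lbrace>w, a\<rbrace> \<^bold>+ \<lbrace>w, a\<rbrace>)" for a
    have chiJ: "chi a \<in> J" if "a \<in> J" for a
      unfolding chi_def dp_def dm_def
      using J_add[OF J_add[OF J_adn[OF xc that] J_neg[OF J_adn[OF yc that]]] J_add[OF J_br[OF wc that] J_br[OF wc that]]] .
    have chi1: "\<exists>b\<in>brs J J. chi \<lbrace>s, a\<rbrace> = \<lbrace>s, chi a\<rbrace> \<^bold>+ b" if a: "a \<in> J" for a
    proof -
      note ac = Jc[OF a]
      have d: "dp \<lbrace>s, a\<rbrace> = \<lbrace>dp s, a\<rbrace> \<^bold>+ \<lbrace>s, dp a\<rbrace>" "dm \<lbrace>s, a\<rbrace> = \<lbrace>dm s, a\<rbrace> \<^bold>+ \<lbrace>s, dm a\<rbrace>"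
        using dpD(4)[OF sc ac] dmD(4)[OF sc ac] .
      have ws: "\<lbrace>w, \<lbrace>s, a\<rbrace>\<rbrace> = \<^bold>- \<lbrace>\<lbrace>s, w\<rbrace>, a\<rbrace> \<^bold>+ \<lbrace>s, \<lbrace>w, a\<rbrace>\<rbrace>"
        unfolding jacobi_right[OF wc sc ac] bracket_anti[OF wc sc] using wc sc ac by (simp add: br_simps)
      define g where "g = \<lbrace>u, \<lbrace>s, w\<rbrace>\<rbrace>"
      define f where "f = \<lbrace>s, w\<rbrace>"
      have gf: "g \<in> carrier L" "f \<in> carrier L" unfolding g_def f_def using uc sc wc bracket_closed by auto
      have dps: "dp s = f \<^bold>+ g \<^bold>+ j" unfolding j(2) g_def f_def ..
      have dms: "dm s = \<^bold>- f \<^bold>+ g \<^bold>+ i"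
        unfolding i(2) g_def f_def using uc sc wc by (simp add: br_simps)
      have jc: "j \<in> carrier L" "i \<in> carrier L" using Jc i j by auto
      define P where "P = dp a"
      define Q where "Q = dm a"
      have PQ: "P \<in> carrier L" "Q \<in> carrier L" unfolding P_def Q_def using dc[OF ac] .
      have "chi \<lbrace>s, a\<rbrace> = (\<lbrace>f \<^bold>+ g \<^bold>+ j, a\<rbrace> \<^bold>+ \<lbrace>s, P\<rbrace>) \<^bold>+ \<^bold>- (\<lbrace>\<^bold>- f \<^bold>+ g \<^bold>+ i, a\<rbrace> \<^bold>+ \<lbrace>s, Q\<rbrace>) \<^bold>+
          ((\<^bold>- \<lbrace>f, a\<rbrace> \<^bold>+ \<lbrace>s, \<lbrace>w, a\<rbrace>\<rbrace>) \<^bold>+ (\<^bold>- \<lbrace>f, a\<rbrace> \<^bold>+ \<lbrace>s, \<lbrace>w, a\<rbrace>\<rbrace>))"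
        unfolding chi_def d dps dms ws P_def Q_def f_def ..
      also have "\<dots> = \<lbrace>s, P \<^bold>+ \<^bold>- Q \<^bold>+ (\<lbrace>w, a\<rbrace> \<^bold>+ \<lbrace>w, a\<rbrace>)\<rbrace> \<^bold>+ (\<lbrace>j, a\<rbrace> \<^bold>+ \<^bold>- \<lbrace>i, a\<rbrace>)"
        using gf jc PQ ac sc wc by algebra
      also have "P \<^bold>+ \<^bold>- Q \<^bold>+ (\<lbrace>w, a\<rbrace> \<^bold>+ \<lbrace>w, a\<rbrace>) = chi a" unfolding chi_def P_def Q_def ..
      finally show ?thesis
        using sub_add[OF ide_sub[OF JJ(1)] brsI[OF j(1) a] sub_neg[OF ide_sub[OF JJ(1)] brsI[OF i(1) a]]] by blast
    qed
    have chin: "\<exists>b\<in>brs J J. chi ((ad s ^^ m) a) = (ad s ^^ m) (chi a) \<^bold>+ b" if a: "a \<in> J" for a m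
    proof (induction m)
      case 0
      show ?case using sub_zero[OF ide_sub[OF JJ(1)]] Jc[OF chiJ[OF a]] by (intro bexI[of _ "\<^bold>0"]) auto
    next
      case (Suc m)
      then obtain b where b: "b \<in> brs J J" "chi ((ad s ^^ m) a) = (ad s ^^ m) (chi a) \<^bold>+ b" by blast
      obtain b' where b': "b' \<in> brs J J" "chi \<lbrace>s, (ad s ^^ m) a\<rbrace> = \<lbrace>s, chi ((ad s ^^ m) a)\<rbrace> \<^bold>+ b'"
        using chi1[OF J_adn[OF sc a]] by blast
      have c: "(ad s ^^ m) (chi a) \<in> carrier L" "b \<in> carrier L" "b' \<in> carrier L"
        using adn_closed[OF sc Jc[OF chiJ[OF a]]] sub_mem[OF ide_sub[OF JJ(1)]] b b' by auto
      have "chi ((ad s ^^ Suc m) a) = (ad s ^^ Suc m) (chi a) \<^bold>+ (\<lbrace>s, b\<rbrace> \<^bold>+ b')"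
        unfolding adn_Suc b'(2) b(2) using c sc bracket_closed by (simp add: bracket_add_right M.a_assoc)
      moreover have "\<lbrace>s, b\<rbrace> \<^bold>+ b' \<in> brs J J"
        using sub_add[OF ide_sub[OF JJ(1)] ide_br[OF JJ(1) sc b(1)] b'(1)] .
      ultimately show ?case by blast
    qed
    define t where "t = (ad s ^^ n) z"
    have tJ: "t \<in> J" unfolding t_def using J_adn[OF sc z] .
    note tc = Jc[OF tJ]
    obtain b where b: "b \<in> brs J J" "chi t = (ad s ^^ n) (chi z) \<^bold>+ b" unfolding t_def using chin[OF z] by blast
    \<comment> \<open>Up to [J, J], \<open>chi t\<close> is the image of \<open>chi z\<close> under
      (ad s)^n and hence lies in \<open>W\<close>. So do \<open>dp t\<close> and
      \<open>dm t\<close>, which leaves twice [w, t].\<close>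
    have chiW: "chi t \<in> W" unfolding b(2) using W_add[OF sW[OF chiJ[OF z]]] b(1) W(2) by blast
    have dW: "dp t \<in> W" "dm t \<in> W" unfolding dp_def dm_def using phiW[OF u tJ] phiW[OF nu tJ] .
    have wt: "\<lbrace>w, t\<rbrace> \<in> carrier L" using bracket_closed[OF wc tc] .
    have "\<lbrace>w, t\<rbrace> \<^bold>+ \<lbrace>w, t\<rbrace> = chi t \<^bold>+ (\<^bold>- dp t \<^bold>+ dm t)"
      unfolding chi_def using dc[OF tc] wt by algebra
    then have "\<lbrace>w, t\<rbrace> \<^bold>+ \<lbrace>w, t\<rbrace> \<in> W" using W_add[OF chiW W_add[OF W_neg[OF dW(1)] dW(2)]] by simp
    then have "h \<^bold>* (\<lbrace>w, t\<rbrace> \<^bold>+ \<lbrace>w, t\<rbrace>) \<in> W" using sub_smult[OF W(1) h(1)] by blast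
    then have "\<lbrace>w, t\<rbrace> \<in> W" using hh[OF wt] wt h(1) by (simp add: smult_r_distr)
    then show ?thesis unfolding w_def t_def .
  qed
  \<comment> \<open>Modulo \<open>J\<close> all of \<open>U\<close> is hit by (ad s)^n, which frees
    the first argument. The power on the second one is removed afterwards, because (ad s)^n is a
    derivation.\<close>
  have main2: "\<lbrace>u, (ad s ^^ n) z\<rbrace> \<in> W" if u: "u \<in> U" and z: "z \<in> J" for u z
  proof -
    obtain v j where v: "v \<in> U" "j \<in> J" "u = (ad s ^^ n) v \<^bold>+ j" using surjn[OF u] by blast
    have "\<lbrace>u, (ad s ^^ n) z\<rbrace> = \<lbrace>(ad s ^^ n) v, (ad s ^^ n) z\<rbrace> \<^bold>+ \<lbrace>j, (ad s ^^ n) z\<rbrace>"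
      unfolding v(3) using adn_closed[OF sc] Uc[OF v(1)] Jc[OF v(2)] Jc[OF z] by (intro bracket_add_left)
    moreover have "\<lbrace>j, (ad s ^^ n) z\<rbrace> \<in> W" using brsI[OF v(2) J_adn[OF sc z]] W(2) by blast
    ultimately show ?thesis using main[OF v(1) z] W_add by simp
  qed
  assume u: "u \<in> U" and z: "z \<in> J"
  obtain v j where v: "v \<in> U" "j \<in> J" "u = (ad s ^^ n) v \<^bold>+ j" using surjn[OF u] by blast
  note c = adn_closed[OF sc Uc[OF v(1)], of n] Jc[OF v(2)] Jc[OF z] Uc[OF v(1)]
  have eq: "(ad s ^^ n) \<lbrace>v, z\<rbrace> = \<lbrace>(ad s ^^ n) v, z\<rbrace> \<^bold>+ \<lbrace>v, (ad s ^^ n) z\<rbrace>"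
    using derD(4)[OF sc c(4,3)] .
  have "\<lbrace>(ad s ^^ n) v, z\<rbrace> \<in> W"
  proof (rule sub_add_cancel[OF W(1) bracket_closed[OF c(1,3)] main2[OF v(1) z]])
    show "\<lbrace>(ad s ^^ n) v, z\<rbrace> \<^bold>+ \<lbrace>v, (ad s ^^ n) z\<rbrace> \<in> W"
      unfolding eq[symmetric] using sW[OF J_br[OF c(4) z]] .
  qed
  moreover have "\<lbrace>j, z\<rbrace> \<in> W" using brsI[OF v(2) z] W(2) by blast
  ultimately show "\<lbrace>u, z\<rbrace> \<in> W"
    unfolding v(3) bracket_add_left[OF c(1-3)] by (rule W_add)
qed

end

section \<open>Maximal subalgebras and the lower nilpotent series\<close>

context field
begin

lemma finite_field_prime:
  assumes "finite (carrier R)"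
  obtains p where "prime p" "nscal p = \<zero>"
proof -
  have "range nscal \<subseteq> carrier R" by auto
  then have "\<not> inj nscal" using assms finite_subset range_inj_infinite by blast
  then obtain a b :: nat where ab: "a < b" "nscal a = nscal b"
    unfolding inj_def by (metis nat_neq_iff)
  have "nscal a \<oplus> nscal (b - a) = nscal a" using nscal_add[of a "b - a"] ab by simp
  then have "nscal (b - a) = \<zero>" by simp
  then have ex: "\<exists>n. n > 0 \<and> nscal n = \<zero>" using ab(1) by (intro exI[of _ "b - a"]) simp
  define p where "p = (LEAST n. n > 0 \<and> nscal n = \<zero>)"
  have p: "p > 0" "nscal p = \<zero>" unfolding p_def using LeastI_ex[OF ex] by auto
  have least: "p \<le> n" if "n > 0" "nscal n = \<zero>" for n unfolding p_def using that by (intro Least_le) auto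
  have "p \<noteq> 1" using p(2) by (metis One_nat_def nscal_1 one_not_zero)
  moreover have "a = 1 \<or> a = p" if dvd: "a dvd p" for a
  proof -
    obtain b where b: "p = a * b" using dvd by auto
    then have pos: "a > 0" "b > 0" using p(1) by auto
    have "nscal a \<otimes> nscal b = \<zero>" using p(2) b nscal_mult by simp
    then have "nscal a = \<zero> \<or> nscal b = \<zero>" using integral nscal_closed by blast
    then show ?thesis
    proof
      assume "nscal a = \<zero>" then show ?thesis using least[OF pos(1)] b pos by simp
    next
      assume "nscal b = \<zero>" then show ?thesis using least[OF pos(2)] b pos by simp
    qed
  qed
  ultimately have "prime p" using p(1) by (simp add: prime_nat_iff)
  then show ?thesis using that p(2) by blast
qed

end

context lie_algebra
begin

lemma ssum_comm: "sub A \<Longrightarrow> sub B \<Longrightarrow> A [+] B = B [+] A"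
  using sub_mem[of A] sub_mem[of B] M.a_comm unfolding set_eq_iff ssum_iff by metis

lemma nres_trivial: "nres i {\<^bold>0} = {\<^bold>0}"
  using nres_subset[OF ide_alg[OF ide_zero], of i] sub_zero[OF sub_nres[OF ide_alg[OF ide_zero], of i]] by auto

lemma ide_lc: "ide S \<Longrightarrow> ide (lc S i)"
  using lc_norm[of S] by (intro ideI sub_lc) (auto intro: ide_alg ide_br)

end

context fd_lie
begin

text \<open>Let N be a lower central term of \<open>S\<close> outside \<open>M\<close> whose
  successor lies in \<open>M\<close>. Then L = M + N, and N normalizes \<open>S \<inter> M\<close>
  because [N, S] is that successor.\<close>

lemma maximal_Int_ide:
  assumes M: "maximal_lie_subalgebra F L M" and S: "ide S" and r: "resid S \<subseteq> M" "\<not> S \<subseteq> M"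
  shows "ide (S \<inter> M)"
proof -
  have aM: "alg M" using M unfolding maximal_lie_subalgebra_def by blast
  have "lc S stab \<subseteq> M" using resid_eq_lc[OF ide_alg[OF S] order_refl] r by simp
  moreover have "\<not> lc S n \<subseteq> M" if "\<And>i. lc S (Suc i) \<subseteq> M \<Longrightarrow> lc S i \<subseteq> M" for n
    using that r(2) by (induction n) auto
  ultimately obtain i where i: "lc S (Suc i) \<subseteq> M" "\<not> lc S i \<subseteq> M" by blast
  note N = ide_lc[OF S, of i]
  show ?thesis
  proof (rule ide_of_ssum[OF _ alg_sub[OF aM] ide_sub[OF N] maximal_ssum[OF M N i(2)]])
    show "sub (S \<inter> M)" using sub_Int ide_sub[OF S] alg_sub[OF aM] by blast
    show "\<lbrace>p, x\<rbrace> \<in> S \<inter> M" if "p \<in> M" "x \<in> S \<inter> M" for p x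
      using that ide_br[OF S] alg_br[OF aM] sub_mem[OF alg_sub[OF aM]] by blast
    show "\<lbrace>p, x\<rbrace> \<in> S \<inter> M" if "p \<in> lc S i" "x \<in> S \<inter> M" for p x
    proof -
      have "\<lbrace>p, x\<rbrace> \<in> lc S (Suc i)" using brsI[of p "lc S i" x S] that by simp
      then show ?thesis using i(1) lc_subset[OF ide_alg[OF S], of "Suc i"] by blast
    qed
  qed
qed

end

context solv_lie
begin

text \<open>For \<open>j > 0\<close> some \<open>s\<close> in the preceding term \<open>Q\<close>
  acts injectively on a chief factor V2 / V1 above \<open>A\<close>. A maximal subalgebra containing
  \<open>V1\<close> and the Fitting null component of \<open>s\<close> then misses
  \<open>X\<close>.\<close>

lemma ex_maximal_not_nres:
  assumes A: "ide A" and j: "\<not> nres j (carrier L) \<subseteq> A"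
  obtains M where "maximal_lie_subalgebra F L M" "A \<subseteq> M" "\<not> nres j (carrier L) \<subseteq> M"
proof (cases j)
  case 0
  then have "A \<noteq> carrier L" using j by simp
  then obtain M where M: "maximal_lie_subalgebra F L M" "A \<subseteq> M" using ex_maximal_alg[OF ide_alg[OF A]] by blast
  then have "\<not> carrier L \<subseteq> M"
    unfolding maximal_lie_subalgebra_def using sub_carrier[OF alg_sub, of M] by auto
  then have "\<not> nres j (carrier L) \<subseteq> M" using 0 by simp
  then show ?thesis by (rule that[OF M])
next
  case (Suc i)
  define Q where "Q = nres i (carrier L)"
  define X where "X = resid Q"
  have X: "nres j (carrier L) = X" unfolding X_def Q_def Suc by simp
  have iQ: "ide Q" and iX: "ide X" unfolding Q_def X[symmetric] using ide_nres[OF ide_carrier] by auto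
  define V2 where "V2 = X [+] A"
  have V2: "ide V2" "X \<subseteq> V2" "A \<subseteq> V2"
    unfolding V2_def using ide_ssum[OF iX A] ssum_upper1 ssum_upper2 ide_sub iX A by auto
  have "A \<noteq> V2" using V2 j X by auto
  then obtain V1 where V1: "ide V1 \<and> A \<subseteq> V1 \<and> V1 \<subseteq> V2 \<and> V1 \<noteq> V2"
    and max: "\<And>K. ide K \<and> A \<subseteq> K \<and> K \<subseteq> V2 \<and> K \<noteq> V2 \<Longrightarrow> V1 \<subseteq> K \<Longrightarrow> K = V1"
    by (rule_tac ex_maximal_sub[of "\<lambda>K. ide K \<and> A \<subseteq> K \<and> K \<subseteq> V2 \<and> K \<noteq> V2" A]) (use A V2 ide_sub in auto)
  have iV1: "ide V1" using V1 by blast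
  have XV1: "\<not> X \<subseteq> V1" using V1 ssum_least[OF ide_sub[OF iV1], of X A] unfolding V2_def by blast
  have irr: "K = V1 \<or> K = V2" if "ide K" "V1 \<subseteq> K" "K \<subseteq> V2" for K
    using max[of K] that V1 by auto
  \<comment> \<open>V2 / V1 is abelian: otherwise it would equal its derived algebra, against
    solvability.\<close>
  let ?B = "V1 [+] brs V2 V2"
  have ib: "ide (brs V2 V2)" using ide_brs V2(1) by blast
  have brsV2: "brs V2 V2 \<subseteq> V2" using brs_least[OF ide_sub[OF V2(1)]] alg_br[OF ide_alg[OF V2(1)]] by blast
  have B: "ide ?B" "V1 \<subseteq> ?B" "brs V2 V2 \<subseteq> ?B" "?B \<subseteq> V2"
    using ide_ssum[OF iV1 ib] ssum_upper1[OF ide_sub[OF iV1] ide_sub[OF ib]]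
      ssum_upper2[OF ide_sub[OF iV1] ide_sub[OF ib]] ssum_least[OF ide_sub[OF V2(1)] _ brsV2] V1 by auto
  have "?B \<noteq> V2"
  proof
    assume eq: "?B = V2"
    have "V2 = V1"
      using V1 eq by (intro solvable_sum[OF ide_sub[OF V2(1)] ide_sub[OF iV1]])
        (auto intro: ide_br[OF iV1] sub_mem[OF ide_sub[OF V2(1)]])
    then show False using V1 by simp
  qed
  then have ab: "brs V2 V2 \<subseteq> V1" using irr[OF B(1,2,4)] B(3) by auto
  obtain s where s: "s \<in> Q" and inj: "\<And>v j. v \<in> V2 \<Longrightarrow> (ad s ^^ j) v \<in> V1 \<Longrightarrow> v \<in> V1"
  proof (rule ex_nonnilpotent[of "carrier L" Q V1 V2])
    show "\<exists>y\<in>Q. \<exists>v\<in>V2. \<lbrace>y, v\<rbrace> \<notin> V1"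
    proof (rule ccontr)
      assume no: "\<not> ?thesis"
      \<comment> \<open>A trivial action of \<open>Q\<close> would put X = [X, Q] into
        \<open>V1\<close>.\<close>
      have "brs X Q \<subseteq> V1"
      proof (rule brs_least[OF ide_sub[OF iV1]])
        fix x y assume xy: "x \<in> X" "y \<in> Q"
        then have "\<lbrace>y, x\<rbrace> \<in> V1" using no V2(2) by blast
        then show "\<lbrace>x, y\<rbrace> \<in> V1"
          using br_swap[OF ide_sub[OF iV1]] xy sub_mem[OF ide_sub[OF iX]] sub_mem[OF ide_sub[OF iQ]] by blast
      qed
      then show False using brs_resid[OF ide_alg[OF iQ]] XV1 unfolding X_def by simp
    qed
    show "\<lbrace>y, v\<rbrace> \<in> V1" if "y \<in> resid Q" "v \<in> V2" for y v
      using that brsI[of y V2 v V2] ab V2(2) unfolding X_def by blast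
    show "K = V1 \<or> K = V2" if "sub K" "V1 \<subseteq> K" "K \<subseteq> V2" "\<And>m v. m \<in> carrier L \<Longrightarrow> v \<in> K \<Longrightarrow> \<lbrace>m, v\<rbrace> \<in> K" for K
      using irr[OF ideI[OF that(1,4)] that(2,3)] .
  qed (use alg_carrier iQ iV1 V2(1) V1 in \<open>auto intro: ide_alg ide_sub ide_br sub_mem\<close>)
  have sc: "s \<in> carrier L" using s sub_mem[OF ide_sub[OF iQ]] by blast
  \<comment> \<open>The Fitting null component of \<open>ad s\<close>. A high power of
    \<open>ad s\<close> maps \<open>L\<close> into the residual \<open>X\<close> of
    \<open>Q\<close>, so L = L0 + X, and no proper subalgebra contains both. Injectivity on V2 / V1
    keeps \<open>X\<close> out of L0 + V1, so that sum is proper.\<close>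
  define L0 where "L0 = {x \<in> carrier L. (ad s ^^ stab) x \<in> {\<^bold>0}}"
  have ker: "x \<in> L0" if "x \<in> carrier L" "(ad s ^^ n) x = \<^bold>0" for x n
    unfolding L0_def using adn_kernel_stab[OF sc carrier_is_submodule bracket_closed[OF sc] sub_trivial _ that(1), of n stab] that sc
    by simp
  have sL0: "sub L0" unfolding L0_def by (rule adn_preimage[OF sc carrier_is_submodule sub_trivial])
  have aL0: "alg L0"
  proof (rule algI[OF sL0])
    fix x y assume xy: "x \<in> L0" "y \<in> L0"
    then have c: "x \<in> carrier L" "y \<in> carrier L" "(ad s ^^ stab) x = \<^bold>0" "(ad s ^^ stab) y = \<^bold>0"
      unfolding L0_def by auto
    have "(ad s ^^ (stab + stab)) \<lbrace>x, y\<rbrace> \<in> {\<^bold>0}"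
      by (rule br_adn_kernel[where M = "carrier L" and V = "carrier L", OF sc carrier_is_submodule sub_trivial])
        (use c sc bracket_closed in auto)
    then show "\<lbrace>x, y\<rbrace> \<in> L0" using ker bracket_closed[OF c(1,2)] by blast
  qed
  have L0X: "\<exists>a\<in>L0. \<exists>b\<in>X. x = a \<^bold>+ b" if x: "x \<in> carrier L" for x
  proof -
    obtain v0 v1 where v: "v0 \<in> carrier L" "(ad s ^^ Suc stab) v0 \<in> {\<^bold>0}" "v1 \<in> carrier L" "x = v0 \<^bold>+ (ad s ^^ Suc stab) v1"
      by (rule fitting[OF sc carrier_is_submodule bracket_closed[OF sc] sub_trivial _ _ _ x, of "Suc stab"]) (use sc in auto)
    have "\<lbrace>s, v1\<rbrace> \<in> Q" using ide_br'[OF iQ s v(3)] .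
    then have "(ad s ^^ Suc stab) v1 \<in> lc Q stab" unfolding adn_Suc' using adn_lc[OF ide_alg[OF iQ] s] by blast
    then have "(ad s ^^ Suc stab) v1 \<in> X" unfolding X_def using resid_eq_lc[OF ide_alg[OF iQ] order_refl] by simp
    moreover have "v0 \<in> L0" using ker[OF v(1), of "Suc stab"] v(2) by blast
    ultimately show ?thesis using v(4) by blast
  qed
  let ?M = "L0 [+] V1"
  have aM: "alg ?M" using alg_ssum_ide[OF aL0 iV1] .
  have up: "L0 \<subseteq> ?M" "V1 \<subseteq> ?M" using ssum_upper1 ssum_upper2 sL0 ide_sub[OF iV1] by auto
  have XM: "\<not> X \<subseteq> ?M"
  proof
    assume XM: "X \<subseteq> ?M"
    have "X \<subseteq> V1"
    proof
      fix x assume x: "x \<in> X"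
      obtain a v where av: "a \<in> L0" "v \<in> V1" "x = a \<^bold>+ v" using subsetD[OF XM x] by (blast elim: ssumE)
      have "a \<in> V2"
        using sub_add_cancel[OF ide_sub[OF V2(1)], of a v] av x V2(2) V1 sub_mem[OF sL0] by blast
      moreover have "(ad s ^^ stab) a \<in> V1" using av(1) sub_zero[OF ide_sub[OF iV1]] unfolding L0_def by auto
      ultimately have "a \<in> V1" using inj by blast
      then show "x \<in> V1" using av sub_add[OF ide_sub[OF iV1]] by blast
    qed
    then show False using XV1 by blast
  qed
  then have "?M \<noteq> carrier L" using sub_carrier[OF ide_sub[OF iX]] by blast
  then obtain M where M: "maximal_lie_subalgebra F L M" "?M \<subseteq> M" using ex_maximal_alg[OF aM] by blast
  have aM': "alg M" "M \<noteq> carrier L" using M(1) unfolding maximal_lie_subalgebra_def by auto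
  have "\<not> X \<subseteq> M"
  proof
    assume "X \<subseteq> M"
    moreover have "L0 \<subseteq> M" using up M(2) by blast
    ultimately have "carrier L \<subseteq> M" using L0X sub_add[OF alg_sub[OF aM'(1)]] by blast
    then show False using aM' sub_carrier[OF alg_sub[OF aM'(1)]] by blast
  qed
  moreover have "A \<subseteq> M" using V1 up M(2) by blast
  ultimately show ?thesis using that M(1) X by blast
qed

end

text \<open>Minimality for nilpotent length at most \<open>k\<close>, expressed through the lower
  nilpotent series; \<open>nilpotent_length_le_iff\<close> provides the translation.\<close>

locale min_non_N = solv_lie +
  fixes k :: nat
  assumes proper: "\<And>S. lie_subalgebra F L S \<Longrightarrow> S \<noteq> carrier L \<Longrightarrow> lie_nres F L k S = {\<zero>\<^bsub>L\<^esub>}"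
    and nonzero: "lie_nres F L k (carrier L) \<noteq> {\<zero>\<^bsub>L\<^esub>}"
begin

lemma nres_Suc_zero: "nres (Suc k) (carrier L) = {\<^bold>0}"
proof -
  have a: "alg (nres 1 (carrier L))" using alg_nres alg_carrier by blast
  have "nres 1 (carrier L) \<noteq> carrier L"
  proof
    assume "nres 1 (carrier L) = carrier L"
    then have "carrier L = {\<^bold>0}" using resid_proper[OF alg_carrier] by simp
    then show False using nonzero nres_trivial by simp
  qed
  then show ?thesis using proper[OF a] nres_add[of k 1 "carrier L"] by simp
qed

text \<open>The series starts with \<open>L\<close>, outside \<open>M\<close>, and reaches 0 at
  \<open>Suc k\<close>. The index \<open>l\<close> of its last term outside \<open>M\<close> is
  called the level of \<open>M\<close> below.\<close>

lemma ex_level: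
  assumes M: "maximal_lie_subalgebra F L M"
  obtains l where "l \<le> k" "\<not> nres l (carrier L) \<subseteq> M" "nres (Suc l) (carrier L) \<subseteq> M"
proof -
  have aM: "alg M" "M \<noteq> carrier L" using M unfolding maximal_lie_subalgebra_def by auto
  have z: "nres (Suc k) (carrier L) \<subseteq> M" using nres_Suc_zero sub_zero[OF alg_sub[OF aM(1)]] by simp
  have "\<not> nres n (carrier L) \<subseteq> M" if "\<And>l. l \<le> k \<Longrightarrow> nres (Suc l) (carrier L) \<subseteq> M \<Longrightarrow> nres l (carrier L) \<subseteq> M" "n \<le> Suc k" for n
    using that(2)
  proof (induction n)
    case 0
    then show ?case using aM sub_carrier[OF alg_sub[OF aM(1)]] by auto
  next
    case (Suc n)
    then show ?case using that(1)[of n] by auto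
  qed
  from this[of "Suc k"] z show ?thesis using that by blast
qed

lemma level_unique:
  assumes "maximal_lie_subalgebra F L M" "\<not> nres l (carrier L) \<subseteq> M" "nres (Suc l) (carrier L) \<subseteq> M"
    and "nres i (carrier L) \<subseteq> M"
  shows "l < i"
proof (rule ccontr)
  assume "\<not> l < i"
  then have "nres l (carrier L) \<subseteq> nres i (carrier L)" using nres_antimono[OF alg_carrier] by simp
  then show False using assms(2,4) by blast
qed

text \<open>The witness is the ideal generated by \<open>nres l M\<close>; the work lies in the
  vanishing of its residual. A positive level provides the preceding term \<open>nres l' M\<close>,
  from which the acting element \<open>s\<close> is taken.\<close>

lemma ex_ideal_Suc:
  assumes M: "maximal_lie_subalgebra F L M" and l: "l = Suc l'" "l \<le> k" "\<not> nres l (carrier L) \<subseteq> M" "nres (Suc l) (carrier L) \<subseteq> M"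
    and h: "h \<in> carrier F" "h \<oplus>\<^bsub>F\<^esub> h = \<one>\<^bsub>F\<^esub>"
  obtains J where "ide J" "nres l M \<subseteq> J" "nres (k - l) J = {\<^bold>0}"
proof -
  have aM: "alg M" "M \<noteq> carrier L" using M unfolding maximal_lie_subalgebra_def by auto
  note sM = alg_sub[OF aM(1)] and Mc = sub_mem[OF alg_sub[OF aM(1)]]

  \<comment> \<open>The irreducible module R / B\<close>
  define G where "G = nres l' (carrier L)"
  define R where "R = resid G"
  define Y where "Y = nres l' M"
  define T where "T = resid Y"
  define B where "B = R \<inter> M"
  have Rl: "nres l (carrier L) = R" unfolding R_def G_def l(1) by simp
  have iG: "ide G" unfolding G_def using ide_nres[OF ide_carrier] .
  have iR: "ide R" using ide_nres[OF ide_carrier, of l] Rl by simp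
  note sR = ide_sub[OF iR]
  have RM: "\<not> R \<subseteq> M" using l(3) Rl by simp
  have iB: "ide B" unfolding B_def
    using maximal_Int_ide[OF M iR _ RM] l(4) Rl by simp
  note sB = ide_sub[OF iB]
  have MR: "M [+] R = carrier L" using maximal_ssum[OF M iR RM] .
  have BR: "B \<subseteq> R" "B \<subseteq> M" "B \<noteq> R" unfolding B_def using RM by auto
  have between: "X = R" if X: "ide X" "X \<subseteq> R" "\<not> X \<subseteq> M" "B \<subseteq> X" for X
  proof -
    note sX = ide_sub[OF X(1)]
    have "R \<subseteq> X [+] M" using maximal_ssum[OF M X(1,3)] ssum_comm[OF sM sX] sub_carrier[OF sR] by simp
    then have "R = X [+] (M \<inter> R)" by (rule modular[OF sX sM sR X(2)])
    also have "\<dots> \<subseteq> X" using X(4) unfolding B_def by (intro ssum_least[OF sX]) auto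
    finally show ?thesis using X(2) by blast
  qed
  have ibr: "ide (brs R R)" using ide_brs iR by blast
  have brR: "brs R R \<subseteq> R" using brs_least[OF sR] alg_br[OF ide_alg[OF iR]] by blast
  have RRM: "brs R R \<subseteq> M"
  proof (rule ccontr)
    assume no: "\<not> brs R R \<subseteq> M"
    let ?X = "B [+] brs R R"
    have up: "B \<subseteq> ?X" "brs R R \<subseteq> ?X" using ssum_upper1 ssum_upper2 sB ide_sub[OF ibr] by auto
    have XR: "?X = R"
      by (rule between) (use up no ide_ssum[OF iB ibr] ssum_least[OF sR BR(1) brR] in auto)
    have "R = B"
      by (rule solvable_sum[OF sR sB BR(1)]) (use XR ide_br[OF iB] sub_mem[OF sR] in auto)
    then show False using BR by simp
  qed
  have RR: "\<lbrace>x, y\<rbrace> \<in> B" if "x \<in> R" "y \<in> R" for x y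
    using brsI[OF that] brR RRM unfolding B_def by blast
  have irr: "X = B \<or> X = R"
    if X: "sub X" "B \<subseteq> X" "X \<subseteq> R" "\<And>m v. m \<in> M \<Longrightarrow> v \<in> X \<Longrightarrow> \<lbrace>m, v\<rbrace> \<in> X" for X
  proof (cases "X \<subseteq> M")
    case True
    then show ?thesis using X unfolding B_def by blast
  next
    case False
    have "ide X"
      by (rule ide_of_ssum[OF X(1) sM sR MR X(4)]) (use RR X(2,3) in auto)
    then show ?thesis using between X False by blast
  qed
  have aY: "alg Y" and YM: "Y \<subseteq> M" unfolding Y_def using alg_nres nres_subset aM(1) by auto
  have MY: "\<lbrace>m, y\<rbrace> \<in> Y" if "m \<in> M" "y \<in> Y" for m y
    using nres_norm[OF aM(1) Mc[OF that(1)] alg_br[OF aM(1) that(1)]] that(2) unfolding Y_def by blast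
  have YMbr: "\<lbrace>y, m\<rbrace> \<in> Y" if "m \<in> M" "y \<in> Y" for m y
    using br_swap[OF alg_sub[OF aY] Mc Mc MY[OF that]] that YM by blast
  have Tl: "nres l M = T" unfolding T_def Y_def l(1) by simp
  have TB: "T \<subseteq> B"
    using nres_mono[OF aM(1) alg_carrier sub_carrier[OF sM], of l] nres_subset[OF aM(1), of l] Tl Rl
    unfolding B_def by auto
  have MT: "\<lbrace>m, t\<rbrace> \<in> T" if "m \<in> M" "t \<in> T" for m t
    using nres_norm[OF aM(1) Mc[OF that(1)] alg_br[OF aM(1) that(1)], of t l] that(2) Tl by simp
  have sT: "sub T" using sub_nres[OF aM(1), of l] Tl by simp
  have GY: "G \<subseteq> Y [+] R"
    using nres_ssum_ide[OF aM(1) iR, of l'] MR unfolding G_def Y_def by simp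

  \<comment> \<open>An element of \<open>Y\<close> acting injectively on R / B\<close>
  obtain s where s: "s \<in> Y" and inj: "\<And>v j. v \<in> R \<Longrightarrow> (ad s ^^ j) v \<in> B \<Longrightarrow> v \<in> B"
  proof (rule ex_nonnilpotent[of M Y B R])
    show "\<lbrace>y, v\<rbrace> \<in> B" if "y \<in> resid Y" "v \<in> R" for y v
      using that TB ide_br'[OF iB] sub_mem[OF sR] unfolding T_def by blast
    show "\<exists>y\<in>Y. \<exists>v\<in>R. \<lbrace>y, v\<rbrace> \<notin> B"
    proof (rule ccontr)
      assume no: "\<not> ?thesis"
      \<comment> \<open>\<open>G\<close> is covered by \<open>Y\<close> and \<open>R\<close>, and
        \<open>R\<close> acts trivially on R / B. If \<open>Y\<close> did so too, then R = [R, G]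
        would lie in \<open>B\<close>.\<close>
      have "brs R G \<subseteq> B"
      proof (rule brs_least[OF sB])
        fix r g assume rg: "r \<in> R" "g \<in> G"
        obtain y r' where yr: "y \<in> Y" "r' \<in> R" "g = y \<^bold>+ r'" using subsetD[OF GY rg(2)] by (blast elim: ssumE)
        have c: "r \<in> carrier L" "y \<in> carrier L" "r' \<in> carrier L" using sub_mem[OF sR] sub_mem[OF alg_sub[OF aY]] rg yr by auto
        have 1: "\<lbrace>r, y\<rbrace> \<in> B" using br_swap[OF sB c(2,1)] no yr(1) rg(1) by blast
        show "\<lbrace>r, g\<rbrace> \<in> B"
          unfolding yr(3) bracket_add_right[OF c] using sub_add[OF sB 1 RR[OF rg(1) yr(2)]] .
      qed
      then show False using brs_resid[OF ide_alg[OF iG]] BR unfolding R_def by auto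
    qed
    show "X = B \<or> X = R" if "sub X" "B \<subseteq> X" "X \<subseteq> R" "\<And>m v. m \<in> M \<Longrightarrow> v \<in> X \<Longrightarrow> \<lbrace>m, v\<rbrace> \<in> X" for X
      using irr[OF that] .
  qed (use aM aY YM MY sB sR BR ide_br[OF iB Mc] ide_br[OF iR Mc] in auto)
  have sM': "s \<in> M" using s YM by blast
  have sc: "s \<in> carrier L" using Mc[OF sM'] .

  \<comment> \<open>The ideal generated by the residual of \<open>M\<close>\<close>
  define J where "J = \<Inter>{I. ide I \<and> T \<subseteq> I}"
  have iJ: "ide J" unfolding J_def using ide_carrier sub_carrier[OF sT] by (intro ide_Inter) auto
  have TJ: "T \<subseteq> J" unfolding J_def by blast
  have Jleast: "J \<subseteq> I" if "ide I" "T \<subseteq> I" for I unfolding J_def using that by blast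
  have JB: "J \<subseteq> B" using Jleast[OF iB TB] .
  note sJ = ide_sub[OF iJ]
  have adT: "(ad y ^^ n) m \<in> resid V"
    if V: "alg V" "y \<in> V" "\<lbrace>y, m\<rbrace> \<in> V" "stab < n" for V y m n
  proof -
    obtain n' where n': "n = Suc n'" using V(4) by (cases n) auto
    have "(ad y ^^ n) m \<in> lc V n'" unfolding n' adn_Suc' using adn_lc[OF V(1-3)] .
    then show ?thesis using resid_eq_lc[OF V(1), of n'] V(4) n' by simp
  qed
  have nil: "(ad s ^^ n) m \<in> T" if "m \<in> M" "stab < n" for m n
    unfolding T_def using adT[OF aY s YMbr[OF that(1) s] that(2)] .

  \<comment> \<open>The Fitting one-component modulo \<open>J\<close>\<close>
  define U where "U = (ad s ^^ stab) ` R [+] J"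
  have Rs: "\<lbrace>s, x\<rbrace> \<in> R" if "x \<in> R" for x using ide_br[OF iR sc that] .
  have Js: "\<lbrace>s, x\<rbrace> \<in> J" if "x \<in> J" for x using ide_br[OF iJ sc that] .
  have im: "sub ((ad s ^^ n) ` R)" for n using adn_image[OF sc sR] .
  have U: "sub U" "J \<subseteq> U" "(ad s ^^ stab) ` R \<subseteq> U"
    unfolding U_def using sub_ssum[OF im[of stab] sJ] ssum_upper1[OF im[of stab] sJ] ssum_upper2[OF im[of stab] sJ] by auto
  have Ustab: "U = (ad s ^^ n) ` R [+] J" if "n \<ge> stab" for n
    unfolding U_def using adn_image_stab[OF sc sR Rs sJ Js that] by simp
  have UR: "U \<subseteq> R" unfolding U_def
    using adn_in[of R s] Rs JB BR by (intro ssum_least[OF sR]) auto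
  have MU: "\<lbrace>m, u\<rbrace> \<in> U" if m: "m \<in> M" and u: "u \<in> U" for m u
  proof -
    \<comment> \<open>The exponent fits \<open>br_adn_image\<close> with \<open>k = stab\<close> and
      \<open>i = Suc stab\<close>: the latter power of \<open>ad s\<close> takes \<open>m\<close>
      into \<open>T\<close>, whose brackets with \<open>R\<close> lie in \<open>J\<close>.\<close>
    obtain x j where x: "x \<in> R" "j \<in> J" "u = (ad s ^^ (stab + Suc stab)) x \<^bold>+ j"
      using u Ustab[of "stab + Suc stab"] by (force simp: ssum_iff)
    have c: "(ad s ^^ (stab + Suc stab)) x \<in> carrier L" "j \<in> carrier L"
      using adn_closed[OF sc sub_mem[OF sR x(1)]] sub_mem[OF sJ x(2)] .
    have 1: "\<lbrace>m, (ad s ^^ (stab + Suc stab)) x\<rbrace> \<in> U"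
      unfolding U_def
    proof (rule br_adn_image[where M = M, OF sc sR sJ Rs Js])
      show "\<lbrace>(ad s ^^ Suc stab) m, x\<rbrace> \<in> J" if "x \<in> R" for x
        using ide_br'[OF iJ subsetD[OF TJ nil[OF m]] sub_mem[OF sR that]] by blast
    qed (use m x(1) ide_br[OF iR Mc] alg_br[OF aM(1) sM'] sub_carrier[OF sM] in auto)
    have "\<lbrace>m, j\<rbrace> \<in> U" using ide_br[OF iJ Mc[OF m] x(2)] U(2) by blast
    then show ?thesis unfolding x(3) bracket_add_right[OF Mc[OF m] c] using sub_add[OF U(1) 1] by blast
  qed
  have surj: "\<exists>u'\<in>U. \<exists>j\<in>J. u = \<lbrace>s, u'\<rbrace> \<^bold>+ j" if u: "u \<in> U" for u
  proof -
    obtain x j where x: "x \<in> R" "j \<in> J" "u = (ad s ^^ Suc stab) x \<^bold>+ j"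
      using u Ustab[of "Suc stab"] by (force simp: ssum_iff)
    then show ?thesis using U(3) unfolding adn_Suc by blast
  qed
  have RBU: "R = B [+] U"
  proof -
    let ?X = "B [+] U"
    have X: "sub ?X" "B \<subseteq> ?X" "U \<subseteq> ?X" using sub_ssum[OF sB U(1)] ssum_upper1[OF sB U(1)] ssum_upper2[OF sB U(1)] by auto
    have "\<lbrace>m, v\<rbrace> \<in> ?X" if m: "m \<in> M" and v: "v \<in> ?X" for m v
    proof -
      obtain b u where bu: "b \<in> B" "u \<in> U" "v = b \<^bold>+ u" using v by (blast elim: ssumE)
      show ?thesis
        unfolding bu(3) bracket_add_right[OF Mc[OF m] sub_mem[OF sB bu(1)] sub_mem[OF U(1) bu(2)]]
        using ssumI[OF ide_br[OF iB Mc[OF m] bu(1)] MU[OF m bu(2)]] .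
    qed
    then have "?X = B \<or> ?X = R" using irr[OF X(1,2) ssum_least[OF sR BR(1) UR]] by blast
    moreover have "?X \<noteq> B"
    proof
      assume "?X = B"
      then have "(ad s ^^ stab) x \<in> B" if "x \<in> R" for x using that U(3) X(3) by blast
      then have "R \<subseteq> B" using inj by blast
      then show False using BR by blast
    qed
    ultimately show ?thesis by simp
  qed
  have MU_sum: "M [+] U = carrier L"
  proof -
    have "R \<subseteq> M [+] U" unfolding RBU by (rule ssum_mono[OF BR(2) order_refl])
    then have "M [+] R \<subseteq> M [+] U"
      by (rule ssum_least[OF sub_ssum[OF sM U(1)] ssum_upper1[OF sM U(1)]])
    then have "carrier L \<subseteq> M [+] U" unfolding MR .
    then show ?thesis using sub_carrier[OF sub_ssum[OF sM U(1)]] by blast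
  qed
  have UB: "U \<inter> B \<subseteq> J"
  proof
    fix x assume x: "x \<in> U \<inter> B"
    then obtain r j where r: "r \<in> R" "j \<in> J" "x = (ad s ^^ stab) r \<^bold>+ j" unfolding U_def by (force simp: ssum_iff)
    have rc: "(ad s ^^ n) r \<in> carrier L" for n using adn_closed[OF sc sub_mem[OF sR r(1)]] .
    have "x \<in> M" using x BR by blast
    \<comment> \<open>On \<open>M\<close> a power of \<open>ad s\<close> leads into
      \<open>J\<close>, so a higher power takes \<open>r\<close> into \<open>J\<close>. By
      stationarity of the kernels \<open>stab\<close> steps already do.\<close>
    then have xJ: "(ad s ^^ Suc stab) x \<in> J" using nil[of x "Suc stab"] TJ by blast
    have "(ad s ^^ Suc stab) x = (ad s ^^ (Suc stab + stab)) r \<^bold>+ (ad s ^^ Suc stab) j"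
      unfolding r(3) adn_add[OF sc rc sub_mem[OF sJ r(2)]] by (simp only: funpow_add o_apply)
    then have "(ad s ^^ (Suc stab + stab)) r \<^bold>+ (ad s ^^ Suc stab) j \<in> J" using xJ by simp
    moreover have "(ad s ^^ Suc stab) j \<in> J" using adn_in[of J s] Js r(2) by blast
    ultimately have "(ad s ^^ (Suc stab + stab)) r \<in> J" using sub_add_cancel[OF sJ rc] by blast
    then have "(ad s ^^ stab) r \<in> J" using adn_kernel_stab[OF sc sR Rs sJ Js r(1) _ order_refl] by blast
    then show "x \<in> J" unfolding r(3) using sub_add[OF sJ] r(2) by blast
  qed
  have nilJ: "(ad s ^^ n) m \<in> J" if "m \<in> M" "stab < n" for m n
    using nil[OF that] TJ by blast
  interpret Sp: lie_split F L M B J U R s h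
    by (rule lie_split.intro[OF solv_lie_axioms], rule lie_split_axioms.intro)
      (fact aM(1), fact iR, fact iB, fact iJ, fact U(1), fact JB, fact U(2), fact B_def, fact UR,
        fact MU, fact MU_sum, fact RBU, fact UB, fact RR, fact sM', fact surj, fact nilJ, fact h(1), fact h(2))

  \<comment> \<open>The largest ideal of \<open>B\<close> with vanishing \<open>r\<close>-th
    residual\<close>
  define r where "r = k - l"
  have kr: "k = r + l" unfolding r_def using l(2) by simp
  \<comment> \<open>A predicate for the ideals of \<open>B\<close> whose \<open>r\<close>-th
    residual vanishes. The largest of them, \<open>N\<close> below, is the ideal named D in the
    outline.\<close>
  define D where "D X \<longleftrightarrow> alg X \<and> X \<subseteq> B \<and> (\<forall>b\<in>B. \<forall>x\<in>X. \<lbrace>b, x\<rbrace> \<in> X) \<and> nres r X = {\<^bold>0}" for X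
  \<comment> \<open>\<open>nres l V\<close> lies in \<open>R\<close> and in \<open>V\<close>, hence
    in \<open>B\<close>; it is normalized by \<open>B\<close>, which lies in \<open>V\<close>; and
    its \<open>r\<close>-th residual is \<open>nres k V\<close>, which is 0 by minimality. This
    applies to \<open>M\<close> and to its conjugates.\<close>
  have D_res: "D (nres l V)" if V: "alg V" "V \<noteq> carrier L" "B \<subseteq> V" "R \<inter> V \<subseteq> B" for V
  proof -
    note Vc = sub_mem[OF alg_sub[OF V(1)]]
    have "nres l V \<subseteq> B"
      using nres_mono[OF V(1) alg_carrier sub_carrier[OF alg_sub[OF V(1)]], of l] nres_subset[OF V(1), of l] Rl V(4) by blast
    moreover have "\<lbrace>b, x\<rbrace> \<in> nres l V" if "b \<in> B" "x \<in> nres l V" for b x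
    proof -
      have b: "b \<in> V" using that(1) V(3) by blast
      show ?thesis using nres_norm[OF V(1) Vc[OF b] alg_br[OF V(1) b] that(2)] .
    qed
    moreover have "nres r (nres l V) = {\<^bold>0}" using proper[OF V(1,2)] nres_add[of r l V] kr by simp
    ultimately show ?thesis unfolding D_def using alg_nres[OF V(1)] by blast
  qed
  have D_conj: "D (nres l (Sp.conj_alg u))" if u: "u \<in> U" for u
  proof (rule D_res[OF Sp.alg_conj_alg[OF u] _ Sp.B_subset_conj_alg[OF sub_mem[OF U(1) u]] Sp.R_Int_conj_alg[OF u]])
    show "Sp.conj_alg u \<noteq> carrier L"
      using Sp.R_Int_conj_alg[OF u] sub_carrier[OF sR] BR by blast
  qed
  have DT: "D T" using D_res[OF aM(1,2) BR(2)] unfolding Tl B_def by blast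
  have D0: "D {\<^bold>0}"
    unfolding D_def using ide_alg[OF ide_zero] sub_zero[OF sB] nres_trivial bracket_zero_right sub_mem[OF sB] by auto
  obtain N where N: "D N" and Nmax: "\<And>X. D X \<Longrightarrow> N \<subseteq> X \<Longrightarrow> X = N"
    by (rule ex_maximal_sub[of D, OF D0]) (auto simp: D_def alg_sub)
  have aN: "alg N" using N unfolding D_def by blast
  note sN = alg_sub[OF aN]
  have D_N: "X \<subseteq> N" if X: "D X" for X
  proof -
    have aX: "alg X" using X unfolding D_def by blast
    have up: "N \<subseteq> N [+] X" "X \<subseteq> N [+] X" using ssum_upper1 ssum_upper2 sN alg_sub[OF aX] by auto
    have prem: "\<And>x y. x \<in> B \<Longrightarrow> y \<in> N \<Longrightarrow> \<lbrace>x, y\<rbrace> \<in> N" "\<And>x y. x \<in> B \<Longrightarrow> y \<in> X \<Longrightarrow> \<lbrace>x, y\<rbrace> \<in> X" "N \<subseteq> B" "X \<subseteq> B"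
      "nres r N = {\<^bold>0}" "nres r X = {\<^bold>0}"
      using N X unfolding D_def by auto
    have "alg (N [+] X)" by (rule resid_ssum(1)[OF ide_alg[OF iB] aN prem(3,1) aX prem(4,2)])
    moreover have "nres r (N [+] X) = {\<^bold>0}"
      by (rule nres_ssum_zero[OF ide_alg[OF iB] aN prem(3,1) aX prem(4,2,5,6)])
    moreover have "\<lbrace>b, z\<rbrace> \<in> N [+] X" if b: "b \<in> B" and z: "z \<in> N [+] X" for b z
    proof -
      obtain x y where xy: "x \<in> N" "y \<in> X" "z = x \<^bold>+ y" using z by (blast elim: ssumE)
      show ?thesis
        unfolding xy(3) bracket_add_right[OF sub_mem[OF sB b] sub_mem[OF sN xy(1)] sub_mem[OF alg_sub[OF aX] xy(2)]]
        using ssumI[OF prem(1)[OF b xy(1)] prem(2)[OF b xy(2)]] .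
    qed
    ultimately have "D (N [+] X)" unfolding D_def using ssum_least[OF sB prem(3,4)] by blast
    then show ?thesis using Nmax up by blast
  qed

  \<comment> \<open>Powers of \<open>s\<close> and of its conjugates on \<open>J\<close>\<close>
  let ?JJ = "brs J J"
  let ?W = "(N \<inter> J) [+] ?JJ"
  have sNJ: "sub (N \<inter> J)" using sub_Int sN sJ by blast
  note iJJ = Sp.JJ(1)
  note sJJ = ide_sub[OF iJJ]
  have W: "sub ?W" "N \<inter> J \<subseteq> ?W" "?JJ \<subseteq> ?W"
    using sub_ssum[OF sNJ sJJ] ssum_upper1[OF sNJ sJJ] ssum_upper2[OF sNJ sJJ] by auto
  \<comment> \<open>As \<open>z\<close> lies in \<open>V\<close>, the bracket [y, z] lies in
    \<open>nres l' V\<close>, and further brackets with \<open>y\<close> lead into its residual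
    \<open>nres l V\<close>, which is contained in \<open>N\<close>.\<close>
  have adJ: "(ad y ^^ n) z \<in> N \<inter> J"
    if V: "alg V" "B \<subseteq> V" "D (nres l V)" "y \<in> nres l' V" and z: "z \<in> J" and n: "stab < n" for V y z n
  proof -
    let ?Y = "nres l' V"
    note Vc = sub_mem[OF alg_sub[OF V(1)]]
    have yV: "y \<in> V" using V(4) nres_subset[OF V(1)] by blast
    have zV: "z \<in> V" using z JB V(2) by blast
    have "\<lbrace>z, y\<rbrace> \<in> ?Y" using nres_norm[OF V(1) Vc[OF zV] alg_br[OF V(1) zV] V(4)] .
    then have "\<lbrace>y, z\<rbrace> \<in> ?Y" using br_swap[OF sub_nres[OF V(1)] Vc[OF zV] Vc[OF yV]] by blast
    then have "(ad y ^^ n) z \<in> nres l V"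
      using adT[OF alg_nres[OF V(1)] V(4) _ n] unfolding l(1) by simp
    then have "(ad y ^^ n) z \<in> N" using D_N[OF V(3)] by blast
    then show ?thesis using Sp.J_adn[OF Vc[OF yV] z] by blast
  qed
  have sW: "(ad s ^^ n) z \<in> ?W" if "z \<in> J" "stab < n" for z n
  proof -
    have "D (nres l M)" using DT Tl by simp
    then show ?thesis using adJ[OF aM(1) BR(2) _ _ that, of s] s W(2) unfolding Y_def by blast
  qed
  have phiW: "(ad (Sp.phi u s) ^^ n) z \<in> ?W" if u: "u \<in> U" and z: "z \<in> J" and n: "stab < n" for u z n
  proof -
    let ?V = "Sp.conj_alg u"
    have "s \<in> nres l' M" using s unfolding Y_def .
    then have "Sp.phi u s \<in> nres l' ?V [+] J" using Sp.phi_nres[OF u] by blast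
    then obtain y j where y: "y \<in> nres l' ?V" "j \<in> J" "Sp.phi u s = y \<^bold>+ j" by (blast elim: ssumE)
    have yc: "y \<in> carrier L" using sub_mem[OF sub_nres[OF Sp.alg_conj_alg[OF u]] y(1)] .
    note jc = sub_mem[OF sJ y(2)]
    \<comment> \<open>\<open>phi u s\<close> agrees with \<open>y\<close> in the conjugate only up
      to \<open>j\<close> in \<open>J\<close>, which changes the iterated brackets on
      \<open>J\<close> by elements of [J, J].\<close>
    have "\<exists>b\<in>?JJ. (ad (y \<^bold>+ j) ^^ i) z = (ad y ^^ i) z \<^bold>+ b" for i
    proof (induction i)
      case 0
      show ?case using sub_zero[OF sJJ] sub_mem[OF sJ z] by (intro bexI[of _ "\<^bold>0"]) auto
    next
      case (Suc i)
      then obtain b where b: "b \<in> ?JJ" "(ad (y \<^bold>+ j) ^^ i) z = (ad y ^^ i) z \<^bold>+ b" by blast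
      let ?A = "(ad y ^^ i) z"
      have A: "?A \<in> J" using Sp.J_adn[OF yc z] .
      note c = yc jc sub_mem[OF sJ A] sub_mem[OF sJJ b(1)]
      have "\<lbrace>y \<^bold>+ j, ?A \<^bold>+ b\<rbrace> = \<lbrace>y, ?A\<rbrace> \<^bold>+ (\<lbrace>j, ?A\<rbrace> \<^bold>+ \<lbrace>y \<^bold>+ j, b\<rbrace>)"
        using c by (simp add: br_simps M.a_assoc)
      moreover have "\<lbrace>j, ?A\<rbrace> \<^bold>+ \<lbrace>y \<^bold>+ j, b\<rbrace> \<in> ?JJ"
        using sub_add[OF sJJ brsI[OF y(2) A] ide_br[OF iJJ _ b(1)]] c by simp
      ultimately show ?case unfolding adn_Suc b(2) by blast
    qed
    then obtain b where b: "b \<in> ?JJ" "(ad (Sp.phi u s) ^^ n) z = (ad y ^^ n) z \<^bold>+ b" unfolding y(3) by blast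
    have "(ad y ^^ n) z \<in> N \<inter> J"
      using adJ[OF Sp.alg_conj_alg[OF u] Sp.B_subset_conj_alg[OF sub_mem[OF U(1) u]] D_conj[OF u] y(1) z n] .
    then show ?thesis unfolding b(2) using b(1) by (rule ssumI)
  qed

  \<comment> \<open>The brackets of \<open>U\<close> with \<open>J\<close> and the inclusion of
    \<open>J\<close> in \<open>N\<close>\<close>
  have UJ: "\<lbrace>u, z\<rbrace> \<in> ?W" if u: "u \<in> U" and z: "z \<in> J" for u z
  proof (cases "finite (carrier F)")
    case True
    then obtain p where p: "prime p" "nscal p = \<zero>\<^bsub>F\<^esub>" by (rule finite_field_prime)
    have "p > 1" using prime_gt_1_nat[OF p(1)] .
    \<comment> \<open>The derivation argument asks for a power of \<open>p\<close> beyond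
      \<open>stab\<close>. Over an infinite field any larger exponent, such as
      \<open>Suc stab\<close>, does.\<close>
    then have n: "stab < p ^ stab" by (simp add: power_gt_expt)
    show ?thesis
      by (rule Sp.br_U_J_prime[OF W(1,3) p refl n _ _ u z]) (use phiW sW n in auto)
  next
    case False
    show ?thesis
      by (rule Sp.br_U_J_infinite[OF W(1,3) _ False phiW u z, of "Suc stab"]) auto
  qed
  let ?UJ = "brs U J"
  \<comment> \<open>An ideal: \<open>M\<close> normalizes each summand, and \<open>U\<close> maps
    \<open>?X\<close>, being part of \<open>J\<close>, into [U, J]. As it contains \<open>T\<close>,
    it contains \<open>J\<close>.\<close>
  let ?X = "(T [+] ?UJ) [+] ?JJ"
  have sUJ: "sub ?UJ" using sub_brs'[OF U(1) sJ] .
  have sTU: "sub (T [+] ?UJ)" using sub_ssum[OF sT sUJ] .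
  have X: "sub ?X" "T \<subseteq> ?X" "?UJ \<subseteq> ?X" "?JJ \<subseteq> ?X"
    using sub_ssum[OF sTU sJJ] ssum_upper1[OF sTU sJJ] ssum_upper2[OF sTU sJJ]
      ssum_upper1[OF sT sUJ] ssum_upper2[OF sT sUJ] by auto
  have UJJ: "?UJ \<subseteq> J" using ide_br[OF iJ sub_mem[OF U(1)]] by (intro brs_least[OF sJ])
  have XJ: "?X \<subseteq> J" using TJ UJJ Sp.JJ(2) by (intro ssum_least[OF sJ])
  have "ide ?X"
  proof (rule ide_of_ssum[OF X(1) sM U(1) MU_sum])
    fix m x assume m: "m \<in> M" and x: "x \<in> ?X"
    obtain a c where ac: "a \<in> T [+] ?UJ" "c \<in> ?JJ" "x = a \<^bold>+ c" using x by (blast elim: ssumE)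
    obtain t b where tb: "t \<in> T" "b \<in> ?UJ" "a = t \<^bold>+ b" using ac(1) by (blast elim: ssumE)
    note cc = sub_mem[OF sT tb(1)] sub_mem[OF sUJ tb(2)] sub_mem[OF sJJ ac(2)]
    have 1: "\<lbrace>m, t\<rbrace> \<in> ?X" using MT[OF m tb(1)] X(2) by blast
    have "\<lbrace>m, b\<rbrace> \<in> ?UJ"
      by (rule brs_norm[OF sub_carrier[OF U(1)] sub_carrier[OF sJ] Mc[OF m] MU[OF m] ide_br[OF iJ Mc[OF m]] tb(2)])
    then have 2: "\<lbrace>m, b\<rbrace> \<in> ?X" using X(3) by blast
    have 3: "\<lbrace>m, c\<rbrace> \<in> ?X" using ide_br[OF iJJ Mc[OF m] ac(2)] X(4) by blast
    have "\<lbrace>m, x\<rbrace> = (\<lbrace>m, t\<rbrace> \<^bold>+ \<lbrace>m, b\<rbrace>) \<^bold>+ \<lbrace>m, c\<rbrace>"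
      unfolding ac(3) tb(3) using cc Mc[OF m] by (simp add: br_simps)
    then show "\<lbrace>m, x\<rbrace> \<in> ?X" using sub_add[OF X(1) sub_add[OF X(1) 1 2] 3] by simp
  next
    fix u x assume "u \<in> U" "x \<in> ?X"
    then show "\<lbrace>u, x\<rbrace> \<in> ?X" using brsI[of u U x J] XJ X(3) by blast
  qed
  then have JX: "J \<subseteq> ?X" using Jleast X(2) by blast
  have "T \<subseteq> ?W" using D_N[OF DT] TJ W(2) by blast
  moreover have "?UJ \<subseteq> ?W" by (rule brs_least[OF W(1) UJ])
  ultimately have "?X \<subseteq> ?W" by (rule ssum_least[OF W(1) ssum_least[OF W(1)] W(3)])
  then have JW: "J \<subseteq> ?W" using JX by blast
  \<comment> \<open>\<open>J\<close> is spanned by its ideal \<open>N \<inter> J\<close> and its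
    derived algebra, so solvability leaves only the former.\<close>
  have "J = N \<inter> J"
  proof (rule solvable_sum[OF sJ sNJ _ _ JW])
    fix x y assume xy: "x \<in> J" "y \<in> N \<inter> J"
    then have "\<lbrace>x, y\<rbrace> \<in> N" using N JB unfolding D_def by blast
    moreover have "\<lbrace>x, y\<rbrace> \<in> J" using ide_br[OF iJ sub_mem[OF sJ xy(1)]] xy(2) by blast
    ultimately show "\<lbrace>x, y\<rbrace> \<in> N \<inter> J" by blast
  qed simp
  then have "nres r J \<subseteq> nres r N" using nres_mono[OF ide_alg[OF iJ] aN] by blast
  then have "nres r J = {\<^bold>0}" using N sub_zero[OF sub_nres[OF ide_alg[OF iJ], of r]] unfolding D_def by auto
  then show ?thesis using that[OF iJ] TJ Tl unfolding r_def by simp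
qed

lemma ex_ideal:
  assumes M: "maximal_lie_subalgebra F L M" and l: "l \<le> k" "\<not> nres l (carrier L) \<subseteq> M" "nres (Suc l) (carrier L) \<subseteq> M"
    and h: "h \<in> carrier F" "h \<oplus>\<^bsub>F\<^esub> h = \<one>\<^bsub>F\<^esub>"
  obtains J where "ide J" "nres l M \<subseteq> J" "nres (k - l) J = {\<^bold>0}"
proof (cases l)
  case 0
  have aM: "alg M" "M \<noteq> carrier L" using M unfolding maximal_lie_subalgebra_def by auto
  \<comment> \<open>At level 0 the residual of \<open>L\<close> lies in \<open>M\<close>, so
    \<open>M\<close> is itself an ideal and serves as \<open>J\<close>.\<close>
  have "ide (carrier L \<inter> M)" using maximal_Int_ide[OF M ide_carrier] l 0 by simp
  moreover have "carrier L \<inter> M = M" using sub_carrier[OF alg_sub[OF aM(1)]] by blast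
  ultimately show ?thesis using that[of M] proper[OF aM] 0 by simp
next
  case (Suc l')
  show ?thesis by (rule ex_ideal_Suc[OF M Suc l h]) (rule that)
qed

text \<open>Otherwise the level of \<open>M\<close> is at most \<open>k - e\<close>, and
  \<open>ex_ideal\<close> yields an ideal J' containing \<open>nres (k - e) M\<close> with
  \<open>nres e J'\<close> zero. Then I + J' contains the term \<open>k - e\<close> of
  \<open>L\<close> and has zero \<open>e\<close>-th residual, so the \<open>k\<close>-th term of
  \<open>L\<close> would vanish.\<close>

lemma not_nres_subset_maximal:
  assumes M: "maximal_lie_subalgebra F L M" and I: "ide I" "\<not> I \<subseteq> M" "nres e I = {\<^bold>0}" and e: "e \<le> k"
    and h: "h \<in> carrier F" "h \<oplus>\<^bsub>F\<^esub> h = \<one>\<^bsub>F\<^esub>"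
  shows "\<not> nres (Suc k - e) (carrier L) \<subseteq> M"
proof
  assume sub: "nres (Suc k - e) (carrier L) \<subseteq> M"
  have aM: "alg M" using M unfolding maximal_lie_subalgebra_def by auto
  obtain l where l: "l \<le> k" "\<not> nres l (carrier L) \<subseteq> M" "nres (Suc l) (carrier L) \<subseteq> M"
    using ex_level[OF M] by blast
  obtain J where J: "ide J" "nres l M \<subseteq> J" "nres (k - l) J = {\<^bold>0}"
    using ex_ideal[OF M l h] by blast
  have le: "l \<le> k - e" using level_unique[OF M l(2,3) sub] e by simp
  define J' where "J' = nres (k - e - l) J"
  have J': "ide J'" unfolding J'_def using ide_nres[OF J(1)] .
  have "nres e J' = nres (e + (k - e - l)) J" unfolding J'_def by (simp add: nres_add)
  also have "e + (k - e - l) = k - l" using le e by simp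
  finally have J'0: "nres e J' = {\<^bold>0}" using J(3) by simp
  have "nres (k - e) M = nres (k - e - l) (nres l M)" using nres_add[of "k - e - l" l M] unfolding le_add_diff_inverse2[OF le] .
  also have "\<dots> \<subseteq> J'" unfolding J'_def using nres_mono[OF alg_nres[OF aM] ide_alg[OF J(1)] J(2)] .
  finally have MJ: "nres (k - e) M \<subseteq> J'" .
  have IJ: "ide (I [+] J')" using ide_ssum I(1) J' by blast
  have "nres (k - e) (carrier L) \<subseteq> nres (k - e) M [+] I"
    using nres_ssum_ide[OF aM I(1), of "k - e"] maximal_ssum[OF M I(1,2)] by simp
  also have "\<dots> \<subseteq> I [+] J'"
    using MJ ssum_upper1 ssum_upper2 ide_sub I(1) J' by (intro ssum_least[OF ide_sub[OF IJ]]) blast+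
  finally have sub: "nres (k - e) (carrier L) \<subseteq> I [+] J'" .
  have "nres e (I [+] J') = {\<^bold>0}"
    using I J' J'0 by (intro nres_ssum_zero[OF alg_carrier]) (auto intro: ide_alg ide_br sub_mem[OF ide_sub])
  moreover have "nres k (carrier L) = nres e (nres (k - e) (carrier L))"
    using nres_add[of e "k - e" "carrier L"] e by simp
  ultimately have "nres k (carrier L) \<subseteq> {\<^bold>0}"
    using nres_mono[OF alg_nres[OF alg_carrier] ide_alg[OF IJ] sub, of e] by simp
  then show False using nonzero sub_zero[OF sub_nres[OF alg_carrier]] by blast
qed

text \<open>The level of \<open>M\<close> serves as \<open>l\<close>. Its term lies outside
  \<open>M\<close>, hence outside \<open>B\<close>; subalgebras above \<open>B\<close> are treated
  through the maximal ones containing them.\<close>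

lemma quotient_minimal:
  assumes A: "ide A" and B: "ide B" "B \<subseteq> A" "A \<noteq> B"
    and irr: "\<And>I. ide I \<Longrightarrow> B \<subseteq> I \<Longrightarrow> I \<subseteq> A \<Longrightarrow> I = B \<or> I = A"
    and M: "maximal_lie_subalgebra F L M" "carrier L = A [+] M" "A \<inter> M = B"
    and k: "nres k (carrier L) \<subseteq> B"
    and h: "h \<in> carrier F" "h \<oplus>\<^bsub>F\<^esub> h = \<one>\<^bsub>F\<^esub>"
  obtains l where "\<not> nres l (carrier L) \<subseteq> B" "\<And>S. alg S \<Longrightarrow> B \<subseteq> S \<Longrightarrow> S \<noteq> carrier L \<Longrightarrow> nres l S \<subseteq> B"
proof -
  have aM: "alg M" using M(1) unfolding maximal_lie_subalgebra_def by auto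
  obtain l where l: "l \<le> k" "\<not> nres l (carrier L) \<subseteq> M" "nres (Suc l) (carrier L) \<subseteq> M"
    using ex_level[OF M(1)] by blast
  obtain J where J: "ide J" "nres l M \<subseteq> J" "nres (k - l) J = {\<^bold>0}"
    using ex_ideal[OF M(1) l h] by blast
  have MA: "carrier L = M [+] A" using M(2) ssum_comm[OF ide_sub[OF A] alg_sub[OF aM]] by simp
  have RA: "nres l (carrier L) \<subseteq> A"
  proof (rule ccontr)
    assume no: "\<not> nres l (carrier L) \<subseteq> A"
    \<comment> \<open>The first term inside \<open>A\<close>; here \<open>m\<close> exceeds
      \<open>l\<close>. A maximal \<open>M3\<close> above \<open>A\<close> misses the term
      \<open>m - 1\<close>, hence also \<open>J'\<close>, since L = M + A. Then
      \<open>not_nres_subset_maximal\<close> with \<open>e = Suc k - m\<close> keeps the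
      \<open>m\<close>-th term out of \<open>M3\<close>, although it lies in
      \<open>A\<close>.\<close>
    define m where "m = (LEAST m. nres m (carrier L) \<subseteq> A)"
    have ex: "nres k (carrier L) \<subseteq> A" using k B(2) by blast
    have m: "nres m (carrier L) \<subseteq> A" "m \<le> k"
      unfolding m_def using LeastI[of "\<lambda>m. nres m (carrier L) \<subseteq> A", OF ex] Least_le[of "\<lambda>m. nres m (carrier L) \<subseteq> A", OF ex] by auto
    have lm: "l < m"
    proof (rule ccontr)
      assume "\<not> l < m"
      then show False using no m(1) nres_antimono[OF alg_carrier, of m l] by auto
    qed
    have nm: "\<not> nres (m - 1) (carrier L) \<subseteq> A"
      using not_less_Least[of "m - 1" "\<lambda>m. nres m (carrier L) \<subseteq> A"] lm unfolding m_def[symmetric] by simp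
    obtain M3 where M3: "maximal_lie_subalgebra F L M3" "A \<subseteq> M3" "\<not> nres (m - 1) (carrier L) \<subseteq> M3"
      using ex_maximal_not_nres[OF A nm] by blast
    define J' where "J' = nres (m - 1 - l) J"
    have J': "ide J'" unfolding J'_def using ide_nres[OF J(1)] .
    have aM3: "alg M3" using M3(1) unfolding maximal_lie_subalgebra_def by auto
    have "nres (m - 1) M = nres (m - 1 - l) (nres l M)" using nres_add[of "m - 1 - l" l M] lm by simp
    also have "\<dots> \<subseteq> J'" unfolding J'_def using nres_mono[OF alg_nres[OF aM] ide_alg[OF J(1)] J(2)] .
    finally have MJ: "nres (m - 1) M \<subseteq> J'" .
    have "nres (m - 1) (carrier L) \<subseteq> nres (m - 1) M [+] A"
      using nres_ssum_ide[OF aM A, of "m - 1"] MA by simp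
    then have J'M3: "\<not> J' \<subseteq> M3"
      using ssum_least[OF alg_sub[OF aM3], of "nres (m - 1) M" A] MJ M3(2,3) by blast
    have "nres (Suc k - m) J' = nres (Suc k - m + (m - 1 - l)) J" unfolding J'_def by (simp add: nres_add)
    also have "Suc k - m + (m - 1 - l) = k - l" using lm m(2) by simp
    finally have "nres (Suc k - m) J' = {\<^bold>0}" using J(3) by simp
    then have "\<not> nres (Suc k - (Suc k - m)) (carrier L) \<subseteq> M3"
      using lm by (intro not_nres_subset_maximal[OF M3(1) J' J'M3 _ _ h]) auto
    moreover have "Suc k - (Suc k - m) = m" using m(2) by simp
    ultimately show False using m(1) M3(2) by auto
  qed
  have ab: "\<lbrace>x, y\<rbrace> \<in> B" if "x \<in> A" "y \<in> A" for x y
  proof -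
    have ib: "ide (brs A A)" using ide_brs A by blast
    let ?B = "B [+] brs A A"
    have up: "B \<subseteq> ?B" "brs A A \<subseteq> ?B"
      using ssum_upper1 ssum_upper2 ide_sub[OF B(1)] ide_sub[OF ib] by auto
    have "brs A A \<subseteq> A" using brs_least[OF ide_sub[OF A]] alg_br[OF ide_alg[OF A]] by blast
    then have "?B = B \<or> ?B = A"
      using irr[OF ide_ssum[OF B(1) ib] up(1)] ssum_least[OF ide_sub[OF A] B(2)] by blast
    moreover have "?B \<noteq> A"
    proof
      assume "?B = A"
      then have "A = B"
        by (intro solvable_sum[OF ide_sub[OF A] ide_sub[OF B(1)] B(2)])
          (auto intro: ide_br[OF B(1)] sub_mem[OF ide_sub[OF A]])
      then show False using B(3) by simp
    qed
    ultimately show ?thesis using up(2) brsI[OF that] by blast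
  qed
  \<comment> \<open>If \<open>A\<close> is not in \<open>M2\<close>, then
    \<open>A \<inter> M2\<close> is an ideal and equals \<open>B\<close>. Otherwise
    \<open>M2\<close> has a smaller level, and its ideal \<open>J'\<close> must lie in
    \<open>M\<close>, since \<open>not_nres_subset_maximal\<close> with \<open>e = k - l\<close>
    would contradict the level of \<open>M\<close>; then \<open>A \<inter> M = B\<close>
    finishes.\<close>
  have main: "nres l M2 \<subseteq> B" if M2: "maximal_lie_subalgebra F L M2" "B \<subseteq> M2" for M2
  proof -
    have aM2: "alg M2" using M2(1) unfolding maximal_lie_subalgebra_def by auto
    note M2c = sub_mem[OF alg_sub[OF aM2]]
    have lA: "nres l M2 \<subseteq> A"
      using RA nres_mono[OF aM2 alg_carrier sub_carrier[OF alg_sub[OF aM2]], of l] by blast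
    show ?thesis
    proof (cases "A \<subseteq> M2")
      case False
      have "ide (A \<inter> M2)"
      proof (rule ide_of_ssum[OF sub_Int[OF ide_sub[OF A] alg_sub[OF aM2]] alg_sub[OF aM2] ide_sub[OF A] maximal_ssum[OF M2(1) A False]])
        show "\<lbrace>p, x\<rbrace> \<in> A \<inter> M2" if "p \<in> M2" "x \<in> A \<inter> M2" for p x
          using ide_br[OF A M2c[OF that(1)]] alg_br[OF aM2 that(1)] that(2) by blast
        show "\<lbrace>p, x\<rbrace> \<in> A \<inter> M2" if "p \<in> A" "x \<in> A \<inter> M2" for p x
          using ab[of p x] that B(2) M2(2) by blast
      qed
      then have "A \<inter> M2 = B" using irr[of "A \<inter> M2"] B(2) M2(2) False by blast
      then show ?thesis using lA nres_subset[OF aM2, of l] by blast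
    next
      case True
      obtain l2 where l2: "l2 \<le> k" "\<not> nres l2 (carrier L) \<subseteq> M2" "nres (Suc l2) (carrier L) \<subseteq> M2"
        using ex_level[OF M2(1)] by blast
      obtain J2 where J2: "ide J2" "nres l2 M2 \<subseteq> J2" "nres (k - l2) J2 = {\<^bold>0}"
        using ex_ideal[OF M2(1) l2 h] by blast
      have "nres l (carrier L) \<subseteq> M2" using RA True by blast
      then have l2l: "l2 < l" using level_unique[OF M2(1) l2(2,3)] by blast
      define J' where "J' = nres (l - l2) J2"
      have J': "ide J'" unfolding J'_def using ide_nres[OF J2(1)] .
      have "nres l M2 = nres (l - l2) (nres l2 M2)" using nres_add[of "l - l2" l2 M2] l2l by simp
      also have "\<dots> \<subseteq> J'" unfolding J'_def using nres_mono[OF alg_nres[OF aM2] ide_alg[OF J2(1)] J2(2)] .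
      finally have M2J: "nres l M2 \<subseteq> J'" .
      have "nres (k - l) J' = nres (k - l + (l - l2)) J2" unfolding J'_def by (simp add: nres_add)
      also have "k - l + (l - l2) = k - l2" using l2l l(1) by simp
      finally have J'0: "nres (k - l) J' = {\<^bold>0}" using J2(3) by simp
      have "J' \<subseteq> M"
      proof (rule ccontr)
        assume "\<not> J' \<subseteq> M"
        then have "\<not> nres (Suc k - (k - l)) (carrier L) \<subseteq> M"
          using not_nres_subset_maximal[OF M(1) J' _ J'0 _ h] by simp
        moreover have "Suc k - (k - l) = Suc l" using l(1) by simp
        ultimately show False using l(3) by simp
      qed
      then show ?thesis using lA M2J M(3) by blast
    qed
  qed
  show ?thesis
  proof (rule that)
    show "\<not> nres l (carrier L) \<subseteq> B" using l(2) M(3) by blast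
    fix S assume S: "alg S" "B \<subseteq> S" "S \<noteq> carrier L"
    then obtain M2 where M2: "maximal_lie_subalgebra F L M2" "S \<subseteq> M2" using ex_maximal_alg by blast
    have "alg M2" using M2(1) unfolding maximal_lie_subalgebra_def by auto
    then have "nres l S \<subseteq> nres l M2" using nres_mono[OF S(1) _ M2(2)] by blast
    also have "\<dots> \<subseteq> B" using main[OF M2(1)] S(2) M2(2) by blast
    finally show "nres l S \<subseteq> B" .
  qed
qed

end

section \<open>Homomorphic images and restriction of the carrier\<close>

locale lie_epi = A: lie_algebra F L + Q: lie_algebra F K
    for F :: "('f, 'm) ring_scheme" (structure) and L :: "('f, 'a, 'n) lie_scheme" (structure)
      and K :: "('f, 'b, 'k) lie_scheme" (structure) +
  fixes f
  assumes surj: "f ` carrier L = carrier K"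
    and add: "\<And>x y. x \<in> carrier L \<Longrightarrow> y \<in> carrier L \<Longrightarrow> f (x \<oplus>\<^bsub>L\<^esub> y) = f x \<oplus>\<^bsub>K\<^esub> f y"
    and smult: "\<And>a x. a \<in> carrier F \<Longrightarrow> x \<in> carrier L \<Longrightarrow> f (a \<odot>\<^bsub>L\<^esub> x) = a \<odot>\<^bsub>K\<^esub> f x"
    and bracket: "\<And>x y. x \<in> carrier L \<Longrightarrow> y \<in> carrier L \<Longrightarrow> f (\<langle>x, y\<rangle>\<^bsub>L\<^esub>) = \<langle>f x, f y\<rangle>\<^bsub>K\<^esub>"
begin

lemma closed: "x \<in> carrier L \<Longrightarrow> f x \<in> carrier K" using surj by blast

lemma zero: "f \<zero>\<^bsub>L\<^esub> = \<zero>\<^bsub>K\<^esub>"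
  using smult[of "\<zero>\<^bsub>F\<^esub>" "\<zero>\<^bsub>L\<^esub>"] closed[of "\<zero>\<^bsub>L\<^esub>"] by simp

lemma minus: "x \<in> carrier L \<Longrightarrow> f (\<ominus>\<^bsub>L\<^esub> x) = \<ominus>\<^bsub>K\<^esub> f x"
  using smult[of "\<ominus>\<^bsub>F\<^esub> \<one>\<^bsub>F\<^esub>" x] closed[of x] by (simp add: A.smult_l_minus Q.smult_l_minus)

lemma sub_image: assumes V: "submodule V F L" shows "submodule (f ` V) F K"
proof (rule Q.submoduleI)
  note c = A.sub_mem[OF V]
  show "f ` V \<subseteq> carrier K" using c closed by blast
  show "\<zero>\<^bsub>K\<^esub> \<in> f ` V" using zero A.sub_zero[OF V] by (metis imageI)
  fix x assume "x \<in> f ` V"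
  then obtain v where v: "v \<in> V" "x = f v" by blast
  show "\<ominus>\<^bsub>K\<^esub> x \<in> f ` V" unfolding v(2) minus[OF c[OF v(1)], symmetric] using A.sub_neg[OF V v(1)] by (rule imageI)
  { fix y assume "y \<in> f ` V"
    then obtain w where w: "w \<in> V" "y = f w" by blast
    show "x \<oplus>\<^bsub>K\<^esub> y \<in> f ` V"
      unfolding v(2) w(2) add[OF c[OF v(1)] c[OF w(1)], symmetric] using A.sub_add[OF V v(1) w(1)] by (rule imageI) }
  fix a assume a: "a \<in> carrier F"
  show "a \<odot>\<^bsub>K\<^esub> x \<in> f ` V"
    unfolding v(2) smult[OF a c[OF v(1)], symmetric] using A.sub_smult[OF V a v(1)] by (rule imageI)
qed

lemma sub_vimage: assumes W: "submodule W F K" shows "submodule {x \<in> carrier L. f x \<in> W} F L"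
  by (rule A.submoduleI)
    (auto simp: zero minus add smult Q.sub_zero[OF W] Q.sub_neg[OF W] Q.sub_add[OF W] Q.sub_smult[OF W])

lemma lin_span_image:
  assumes S: "S \<subseteq> carrier L" shows "f ` lin_span F L S = lin_span F K (f ` S)"
proof
  have fS: "f ` S \<subseteq> carrier K" using S closed by blast
  have "lin_span F L S \<subseteq> {x \<in> carrier L. f x \<in> lin_span F K (f ` S)}"
    using S Q.lin_span_upper[of "f ` S"] by (intro A.lin_span_least sub_vimage Q.sub_lin_span fS) auto
  then show "f ` lin_span F L S \<subseteq> lin_span F K (f ` S)" by blast
  show "lin_span F K (f ` S) \<subseteq> f ` lin_span F L S"
    by (intro Q.lin_span_least sub_image A.sub_lin_span S image_mono A.lin_span_upper)
qed

lemma bracket_space_image: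
  assumes "X \<subseteq> carrier L" "Y \<subseteq> carrier L"
  shows "f ` bracket_space F L X Y = bracket_space F K (f ` X) (f ` Y)"
proof -
  have "f ` {\<langle>x, y\<rangle>\<^bsub>L\<^esub> | x y. x \<in> X \<and> y \<in> Y} = {\<langle>x, y\<rangle>\<^bsub>K\<^esub> | x y. x \<in> f ` X \<and> y \<in> f ` Y}" (is "f ` ?S = ?T")
  proof
    show "f ` ?S \<subseteq> ?T"
    proof
      fix z assume "z \<in> f ` ?S"
      then obtain x y where "x \<in> X" "y \<in> Y" "z = f (\<langle>x, y\<rangle>\<^bsub>L\<^esub>)" by blast
      moreover from this have "z = \<langle>f x, f y\<rangle>\<^bsub>K\<^esub>" using bracket assms by (auto simp: subset_iff)
      ultimately show "z \<in> ?T" by blast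
    qed
    show "?T \<subseteq> f ` ?S"
    proof
      fix z assume "z \<in> ?T"
      then obtain x y where xy: "x \<in> X" "y \<in> Y" "z = \<langle>f x, f y\<rangle>\<^bsub>K\<^esub>" by blast
      then have "z = f (\<langle>x, y\<rangle>\<^bsub>L\<^esub>)" using bracket assms by (auto simp: subset_iff)
      then show "z \<in> f ` ?S" using xy by blast
    qed
  qed
  moreover have "?S \<subseteq> carrier L" using assms A.bracket_closed by blast
  ultimately show ?thesis unfolding bracket_space_def by (simp add: lin_span_image)
qed

lemma lc_image: "lie_subalgebra F L S \<Longrightarrow> f ` lie_lc F L S i = lie_lc F K (f ` S) i"
proof (induction i)
  case (Suc i)
  then show ?case
    using bracket_space_image[OF A.sub_carrier[OF A.sub_lc[of S i]] A.sub_carrier[OF A.alg_sub[of S]]] by simp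
qed simp

lemma derived_image: "f ` derived_series F L i = derived_series F K i \<and> derived_series F L i \<subseteq> carrier L"
proof (induction i)
  case (Suc i)
  then show ?case
    using bracket_space_image[of "derived_series F L i" "derived_series F L i"]
      A.sub_carrier[OF A.sub_brs[of "derived_series F L i" "derived_series F L i"]] by simp
qed (simp add: surj)

lemma alg_image: "lie_subalgebra F L S \<Longrightarrow> lie_subalgebra F K (f ` S)"
proof (rule Q.algI[OF sub_image[OF A.alg_sub]])
  fix x y assume S: "lie_subalgebra F L S" and "x \<in> f ` S" "y \<in> f ` S"
  then obtain u v where uv: "u \<in> S" "v \<in> S" "x = f u" "y = f v" by blast
  note c = A.sub_mem[OF A.alg_sub[OF S]]
  show "\<langle>x, y\<rangle>\<^bsub>K\<^esub> \<in> f ` S"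
    unfolding uv(3,4) bracket[OF c[OF uv(1)] c[OF uv(2)], symmetric] using A.alg_br[OF S uv(1,2)] by (rule imageI)
qed

lemma ide_image: "lie_ideal F L S \<Longrightarrow> lie_ideal F K (f ` S)"
proof (rule Q.ideI[OF sub_image[OF A.ide_sub]])
  fix x y assume S: "lie_ideal F L S" and "x \<in> carrier K" "y \<in> f ` S"
  then obtain u v where uv: "u \<in> carrier L" "v \<in> S" "x = f u" "y = f v" using surj by blast
  note c = A.sub_mem[OF A.ide_sub[OF S]]
  show "\<langle>x, y\<rangle>\<^bsub>K\<^esub> \<in> f ` S"
    unfolding uv(3,4) bracket[OF uv(1) c[OF uv(2)], symmetric] using A.ide_br[OF S uv(1,2)] by (rule imageI)
qed

lemma alg_vimage: "lie_subalgebra F K W \<Longrightarrow> lie_subalgebra F L {x \<in> carrier L. f x \<in> W}"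
  by (rule A.algI[OF sub_vimage[OF Q.alg_sub]]) (auto simp: A.bracket_closed bracket Q.alg_br)

lemma ide_vimage: "lie_ideal F K W \<Longrightarrow> lie_ideal F L {x \<in> carrier L. f x \<in> W}"
  by (rule A.ideI[OF sub_vimage[OF Q.ide_sub]]) (auto simp: A.bracket_closed bracket Q.ide_br closed)

lemma image_vimage: "W \<subseteq> carrier K \<Longrightarrow> f ` {x \<in> carrier L. f x \<in> W} = W"
  using surj by (auto simp: subset_iff image_iff)

lemma fd_image: "finite_dimensional F L \<Longrightarrow> finite_dimensional F K"
  unfolding finite_dimensional_def
proof -
  assume "\<exists>S. finite S \<and> S \<subseteq> carrier L \<and> lin_span F L S = carrier L"
  then obtain S where S: "finite S" "S \<subseteq> carrier L" "lin_span F L S = carrier L" by blast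
  have "lin_span F K (f ` S) = carrier K" using lin_span_image[OF S(2)] S(3) surj by simp
  then show "\<exists>S. finite S \<and> S \<subseteq> carrier K \<and> lin_span F K S = carrier K"
    using S closed by (intro exI[of _ "f ` S"]) auto
qed

lemma solvable_image: "lie_solvable F L \<Longrightarrow> lie_solvable F K"
  unfolding lie_solvable_def using derived_image zero by (metis image_insert image_empty)

lemma nres_image:
  assumes "finite_dimensional F L" "lie_subalgebra F L S"
  shows "f ` lie_nres F L k S = lie_nres F K k (f ` S)"
proof -
  interpret A': fd_lie F L using assms(1) by unfold_locales
  interpret Q': fd_lie F K using fd_image[OF assms(1)] by unfold_locales
  have r: "f ` lie_resid F L V = lie_resid F K (f ` V)" if V: "lie_subalgebra F L V" for V
  proof -
    \<comment> \<open>The two algebras may have different values of \<open>stab\<close>; beyond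
      both, residuals are lower central terms, which commute with images.\<close>
    let ?n = "max A'.stab Q'.stab"
    have "f ` lie_resid F L V = f ` lie_lc F L V ?n" using A'.resid_eq_lc[OF V, of ?n] by simp
    also have "\<dots> = lie_lc F K (f ` V) ?n" by (rule lc_image[OF V])
    also have "\<dots> = lie_resid F K (f ` V)" using Q'.resid_eq_lc[OF alg_image[OF V], of ?n] by simp
    finally show ?thesis .
  qed
  show ?thesis by (induction k) (simp_all add: r A.alg_nres[OF assms(2)])
qed

end

section \<open>Restriction to a subalgebra\<close>

context lie_algebra
begin

lemma lie_algebra_restrict: assumes U: "alg U" shows "lie_algebra F (L\<lparr>carrier := U\<rparr>)"
proof -
  have m: "module F (L\<lparr>carrier := U\<rparr>)"
    using submodule.submodule_is_module[OF alg_sub[OF U] module_axioms] .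
  show ?thesis
    unfolding lie_algebra_def lie_algebra_axioms_def
    using field_axioms m sub_mem[OF alg_sub[OF U]] alg_br[OF U] jacobi
    by (auto simp: br_simps bracket_self)
qed

lemma submodule_restrict:
  assumes U: "alg U"
  shows "submodule H F (L\<lparr>carrier := U\<rparr>) \<longleftrightarrow> sub H \<and> H \<subseteq> U"
proof -
  interpret R: lie_algebra F "L\<lparr>carrier := U\<rparr>" by (rule lie_algebra_restrict[OF U])
  have neg: "\<ominus>\<^bsub>L\<lparr>carrier := U\<rparr>\<^esub> x = \<^bold>- x" if "x \<in> U" for x
    using R.M.minus_equality[of "\<^bold>- x" x] that sub_neg[OF alg_sub[OF U] that] sub_mem[OF alg_sub[OF U] that]
    by (simp add: M.l_neg)
  show ?thesis
  proof
    assume H: "submodule H F (L\<lparr>carrier := U\<rparr>)"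
    then have HU: "H \<subseteq> U" using R.sub_carrier[OF H] by simp
    have "sub H"
    proof (rule submoduleI)
      show "H \<subseteq> carrier L" using HU sub_carrier[OF alg_sub[OF U]] by blast
      show "\<^bold>0 \<in> H" using R.sub_zero[OF H] by simp
      show "\<^bold>- a \<in> H" if "a \<in> H" for a using R.sub_neg[OF H that] neg[of a] that HU by auto
      show "a \<^bold>+ b \<in> H" if "a \<in> H" "b \<in> H" for a b using R.sub_add[OF H that] by simp
      show "a \<^bold>* x \<in> H" if "a \<in> carrier F" "x \<in> H" for a x using R.sub_smult[OF H that] by simp
    qed
    then show "sub H \<and> H \<subseteq> U" using HU by blast
  next
    assume H: "sub H \<and> H \<subseteq> U"
    show "submodule H F (L\<lparr>carrier := U\<rparr>)"
      using H neg sub_zero[of H] sub_neg[of H] sub_add[of H] sub_smult[of H]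
      by (intro R.submoduleI) (auto simp: subset_iff)
  qed
qed

lemma lin_span_restrict:
  assumes U: "alg U" and S: "S \<subseteq> U"
  shows "lin_span F (L\<lparr>carrier := U\<rparr>) S = lin_span F L S"
proof
  have c: "S \<subseteq> carrier L" using S sub_carrier[OF alg_sub[OF U]] by blast
  have "submodule (lin_span F L S) F (L\<lparr>carrier := U\<rparr>)"
    unfolding submodule_restrict[OF U] using sub_lin_span[OF c] lin_span_least[OF alg_sub[OF U] S] by blast
  then show "lin_span F (L\<lparr>carrier := U\<rparr>) S \<subseteq> lin_span F L S"
    unfolding lin_span_def[of F "L\<lparr>carrier := U\<rparr>"] using lin_span_upper[of S] by blast
  show "lin_span F L S \<subseteq> lin_span F (L\<lparr>carrier := U\<rparr>) S"
    unfolding lin_span_def submodule_restrict[OF U] by blast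
qed

lemma bracket_space_restrict:
  assumes U: "alg U" and "X \<subseteq> U" "Y \<subseteq> U"
  shows "bracket_space F (L\<lparr>carrier := U\<rparr>) X Y = brs X Y"
proof -
  have "{\<lbrace>x, y\<rbrace> | x y. x \<in> X \<and> y \<in> Y} \<subseteq> U" using assms alg_br[OF U] by blast
  then show ?thesis unfolding bracket_space_def by (simp add: lin_span_restrict[OF U])
qed

lemma lc_restrict:
  assumes "alg U" "alg S" "S \<subseteq> U" shows "lie_lc F (L\<lparr>carrier := U\<rparr>) S i = lc S i"
proof (induction i)
  case (Suc i)
  have "lc S i \<subseteq> U" using lc_subset[OF assms(2)] assms(3) by blast
  then show ?case using Suc bracket_space_restrict[OF assms(1) _ assms(3)] by simp
qed simp

lemma nres_restrict:
  assumes "alg U" "alg S" "S \<subseteq> U" shows "lie_nres F (L\<lparr>carrier := U\<rparr>) k S = nres k S"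
proof (induction k)
  case (Suc k)
  have "nres k S \<subseteq> U" using nres_subset[OF assms(2)] assms(3) by blast
  then show ?case using Suc lc_restrict[OF assms(1) alg_nres[OF assms(2)]] by (simp add: lie_resid_def)
qed simp

lemma lower_central_restrict:
  assumes "alg S" shows "lower_central F (L\<lparr>carrier := S\<rparr>) i = lc S i"
proof (induction i)
  case (Suc i)
  then show ?case using bracket_space_restrict[OF assms lc_subset[OF assms] order_refl] by simp
qed simp

lemma a_r_coset_iff: "y \<in> I +>\<^bsub>L\<^esub> x \<longleftrightarrow> (\<exists>i\<in>I. y = i \<^bold>+ x)"
  by (auto simp: a_r_coset_def')

end

section \<open>Quotient algebras\<close>

locale lie_quot = lie_algebra +
  fixes I
  assumes I: "lie_ideal F L I"
begin

lemma coset_eq_iff: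
  assumes x: "x \<in> carrier L" and y: "y \<in> carrier L"
  shows "I +>\<^bsub>L\<^esub> x = I +>\<^bsub>L\<^esub> y \<longleftrightarrow> x \<^bold>+ \<^bold>- y \<in> I"
proof -
  note sI = ide_sub[OF I] and c = sub_mem[OF ide_sub[OF I]]
  show ?thesis
  proof
    assume "I +>\<^bsub>L\<^esub> x = I +>\<^bsub>L\<^esub> y"
    moreover have "x \<in> I +>\<^bsub>L\<^esub> x" unfolding a_r_coset_iff using sub_zero[OF sI] x by (intro bexI[of _ "\<^bold>0"]) auto
    ultimately have "x \<in> I +>\<^bsub>L\<^esub> y" by simp
    then obtain i where i: "i \<in> I" "x = i \<^bold>+ y" unfolding a_r_coset_iff by blast
    have "x \<^bold>+ \<^bold>- y = i" unfolding i(2) using c[OF i(1)] y by algebra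
    then show "x \<^bold>+ \<^bold>- y \<in> I" using i by simp
  next
    assume d: "x \<^bold>+ \<^bold>- y \<in> I"
    have 1: "i \<^bold>+ x = (i \<^bold>+ (x \<^bold>+ \<^bold>- y)) \<^bold>+ y" if "i \<in> I" for i using c[OF that] x y by algebra
    have 2: "i \<^bold>+ y = (i \<^bold>+ \<^bold>- (x \<^bold>+ \<^bold>- y)) \<^bold>+ x" if "i \<in> I" for i using c[OF that] x y by algebra
    show "I +>\<^bsub>L\<^esub> x = I +>\<^bsub>L\<^esub> y"
      unfolding set_eq_iff a_r_coset_iff using 1 2 sub_add[OF sI _ d] sub_add[OF sI _ sub_neg[OF sI d]] by blast
  qed
qed

lemma coset_zero_iff: "x \<in> carrier L \<Longrightarrow> I +>\<^bsub>L\<^esub> x = I \<longleftrightarrow> x \<in> I"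
proof -
  assume x: "x \<in> carrier L"
  have "I +>\<^bsub>L\<^esub> \<^bold>0 = I" using sub_mem[OF ide_sub[OF I]] unfolding set_eq_iff a_r_coset_iff by auto
  then show ?thesis using coset_eq_iff[OF x, of "\<^bold>0"] x by (simp add: minus_vzero)
qed

abbreviation pr where "pr x \<equiv> I +>\<^bsub>L\<^esub> x"

text \<open>The operations of \<open>lie_quotient\<close> are unions over representatives; if the
  value does not depend on the representative, all sets in the union are equal.\<close>

lemma pr_UN:
  assumes x: "x \<in> carrier L" and g: "\<And>y. y \<in> carrier L \<Longrightarrow> y \<^bold>+ \<^bold>- x \<in> I \<Longrightarrow> g y = g x"
  shows "(\<Union>y\<in>pr x. g y) = g x"
proof -
  have "g y = g x" if "y \<in> pr x" for y
  proof -
    obtain i where i: "i \<in> I" "y = i \<^bold>+ x" using \<open>y \<in> pr x\<close> unfolding a_r_coset_iff by blast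
    note c = sub_mem[OF ide_sub[OF I] i(1)]
    have "y \<^bold>+ \<^bold>- x = i" unfolding i(2) using c x by algebra
    then show ?thesis using g[of y] i c x by simp
  qed
  moreover have "x \<in> pr x" unfolding a_r_coset_iff using sub_zero[OF ide_sub[OF I]] x by (intro bexI[of _ "\<^bold>0"]) auto
  ultimately show ?thesis by blast
qed

lemma quot_carrier: "carrier (lie_quotient L I) = pr ` carrier L"
  unfolding lie_quotient_def by (auto simp: A_RCOSETS_def')

lemma quot_zero: "\<zero>\<^bsub>lie_quotient L I\<^esub> = I"
  unfolding lie_quotient_def by simp

lemma quot_add:
  assumes x: "x \<in> carrier L" and y: "y \<in> carrier L"
  shows "pr x \<oplus>\<^bsub>lie_quotient L I\<^esub> pr y = pr (x \<^bold>+ y)"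
proof -
  note sI = ide_sub[OF I] and c = sub_mem[OF ide_sub[OF I]]
  have "z \<in> set_add L (pr x) (pr y) \<longleftrightarrow> z \<in> pr (x \<^bold>+ y)" for z
  proof
    assume "z \<in> set_add L (pr x) (pr y)"
    then obtain u v where uv: "u \<in> pr x" "v \<in> pr y" "z = u \<^bold>+ v" by (rule ssumE)
    obtain i j where ij: "i \<in> I" "j \<in> I" "z = (i \<^bold>+ x) \<^bold>+ (j \<^bold>+ y)"
      using uv unfolding a_r_coset_iff by blast
    have "z = (i \<^bold>+ j) \<^bold>+ (x \<^bold>+ y)" unfolding ij(3) using c[OF ij(1)] c[OF ij(2)] x y by algebra
    then show "z \<in> pr (x \<^bold>+ y)" unfolding a_r_coset_iff using sub_add[OF sI ij(1,2)] by blast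
  next
    assume "z \<in> pr (x \<^bold>+ y)"
    then obtain i where i: "i \<in> I" "z = i \<^bold>+ (x \<^bold>+ y)" unfolding a_r_coset_iff by blast
    have "z = (i \<^bold>+ x) \<^bold>+ (\<^bold>0 \<^bold>+ y)" unfolding i(2) using c[OF i(1)] x y by algebra
    moreover have "i \<^bold>+ x \<in> pr x" "\<^bold>0 \<^bold>+ y \<in> pr y" unfolding a_r_coset_iff using i(1) sub_zero[OF sI] by blast+
    ultimately show "z \<in> set_add L (pr x) (pr y)" using ssumI by simp
  qed
  then show ?thesis unfolding lie_quotient_def by auto
qed

lemma quot_smult:
  assumes a: "a \<in> carrier F" and x: "x \<in> carrier L"
  shows "a \<odot>\<^bsub>lie_quotient L I\<^esub> pr x = pr (a \<^bold>* x)"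
proof -
  have "(\<Union>y\<in>pr x. pr (a \<^bold>* y)) = pr (a \<^bold>* x)"
  proof (rule pr_UN[OF x])
    fix y assume y: "y \<in> carrier L" "y \<^bold>+ \<^bold>- x \<in> I"
    have "a \<^bold>* (y \<^bold>+ \<^bold>- x) \<in> I" using sub_smult[OF ide_sub[OF I] a y(2)] .
    then show "pr (a \<^bold>* y) = pr (a \<^bold>* x)" using a x y by (simp add: coset_eq_iff smult_r_distr smult_r_minus)
  qed
  then show ?thesis unfolding lie_quotient_def by simp
qed

lemma quot_bracket:
  assumes x: "x \<in> carrier L" and y: "y \<in> carrier L"
  shows "\<langle>pr x, pr y\<rangle>\<^bsub>lie_quotient L I\<^esub> = pr \<lbrace>x, y\<rbrace>"
proof -
  have 1: "(\<Union>v\<in>pr y. pr \<lbrace>u, v\<rbrace>) = pr \<lbrace>u, y\<rbrace>" if u: "u \<in> carrier L" for u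
  proof (rule pr_UN[OF y])
    fix v assume v: "v \<in> carrier L" "v \<^bold>+ \<^bold>- y \<in> I"
    have "\<lbrace>u, v \<^bold>+ \<^bold>- y\<rbrace> \<in> I" using ide_br[OF I u v(2)] .
    then show "pr \<lbrace>u, v\<rbrace> = pr \<lbrace>u, y\<rbrace>" using u v y by (simp add: coset_eq_iff br_simps)
  qed
  have pc: "u \<in> carrier L" if "u \<in> pr x" for u
    using that sub_mem[OF ide_sub[OF I]] x unfolding a_r_coset_iff by auto
  have "(\<Union>u\<in>pr x. \<Union>v\<in>pr y. pr \<lbrace>u, v\<rbrace>) = (\<Union>u\<in>pr x. pr \<lbrace>u, y\<rbrace>)"
    using 1 pc by (intro SUP_cong) auto
  also have "\<dots> = pr \<lbrace>x, y\<rbrace>"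
  proof (rule pr_UN[OF x])
    fix u assume u: "u \<in> carrier L" "u \<^bold>+ \<^bold>- x \<in> I"
    have "\<lbrace>u \<^bold>+ \<^bold>- x, y\<rbrace> \<in> I" using ide_br'[OF I u(2) y] .
    then show "pr \<lbrace>u, y\<rbrace> = pr \<lbrace>x, y\<rbrace>" using u x y by (simp add: coset_eq_iff br_simps)
  qed
  finally show ?thesis unfolding lie_quotient_def by simp
qed

lemma lie_algebra_quot: "lie_algebra F (lie_quotient L I)"
proof -
  let ?Q = "lie_quotient L I"
  have ab: "abelian_group ?Q"
  proof (rule abelian_groupI)
    show "\<zero>\<^bsub>?Q\<^esub> \<in> carrier ?Q"
      unfolding quot_carrier quot_zero using coset_zero_iff[of "\<^bold>0"] sub_zero[OF ide_sub[OF I]] by (intro image_eqI[of _ _ "\<^bold>0"]) auto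
    show "\<exists>y\<in>carrier ?Q. y \<oplus>\<^bsub>?Q\<^esub> x = \<zero>\<^bsub>?Q\<^esub>" if x: "x \<in> carrier ?Q" for x
    proof -
      obtain u where u: "u \<in> carrier L" "x = pr u" using x unfolding quot_carrier by blast
      have "pr (\<^bold>- u) \<oplus>\<^bsub>?Q\<^esub> x = pr \<^bold>0" using u by (simp add: quot_add M.l_neg)
      then show ?thesis
        unfolding quot_carrier quot_zero using u coset_zero_iff[of "\<^bold>0"] sub_zero[OF ide_sub[OF I]] by auto
    qed
    show "\<zero>\<^bsub>?Q\<^esub> \<oplus>\<^bsub>?Q\<^esub> x = x" if x: "x \<in> carrier ?Q" for x
    proof -
      obtain u where u: "u \<in> carrier L" "x = pr u" using x unfolding quot_carrier by blast
      have "\<zero>\<^bsub>?Q\<^esub> = pr \<^bold>0" unfolding quot_zero using coset_zero_iff[of "\<^bold>0"] sub_zero[OF ide_sub[OF I]] by simp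
      then show ?thesis using u by (simp add: quot_add)
    qed
  qed (auto simp: quot_carrier quot_add M.a_ac)
  have "module F ?Q"
    by (rule moduleI[OF _ ab])
      (use is_cring in \<open>auto simp: quot_carrier quot_add quot_smult smult_l_distr smult_r_distr smult_assoc1\<close>)
  moreover have "pr \<^bold>0 = I" using coset_zero_iff[of "\<^bold>0"] sub_zero[OF ide_sub[OF I]] by simp
  ultimately show ?thesis
    unfolding lie_algebra_def lie_algebra_axioms_def using field_axioms jacobi
    by (auto simp: quot_carrier quot_add quot_smult quot_bracket quot_zero br_simps bracket_self)
qed

lemma lie_epi_quot: "lie_epi F L (lie_quotient L I) pr"
  by (intro lie_epi.intro lie_epi_axioms.intro lie_algebra_quot lie_algebra_axioms)
    (auto simp: quot_carrier quot_add quot_smult quot_bracket)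

end

section \<open>Nilradical and nilpotent length\<close>

context fd_lie
begin

lemma lie_nilpotent_iff: "alg S \<Longrightarrow> lie_nilpotent F (L\<lparr>carrier := S\<rparr>) \<longleftrightarrow> nres 1 S = {\<^bold>0}"
proof -
  assume S: "alg S"
  have "resid S \<subseteq> lc S r" for r unfolding lie_resid_def by blast
  then have "resid S = {\<^bold>0}" if "lc S r = {\<^bold>0}" for r
    using that sub_zero[OF sub_resid[OF S]] by blast
  moreover have "lc S stab = resid S" using resid_eq_lc[OF S, of stab] by simp
  ultimately show ?thesis unfolding lie_nilpotent_def lower_central_restrict[OF S] by auto
qed

text \<open>A description of the \<open>k\<close>-th upper nilpotent term without quotients, which
  links the upper series to the lower one. For \<open>k = 1\<close> it is the nilradical.\<close>

definition nres_radical where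
  "nres_radical k P \<longleftrightarrow> ide P \<and> nres k P = {\<^bold>0} \<and> (\<forall>I. ide I \<longrightarrow> nres k I = {\<^bold>0} \<longrightarrow> I \<subseteq> P)"

lemma nres_radical_ex: "\<exists>P. nres_radical k P"
proof -
  have z: "nres k {\<^bold>0} = {\<^bold>0}"
    using nres_subset[OF ide_alg[OF ide_zero], of k] sub_zero[OF sub_nres[OF ide_alg[OF ide_zero]], of k] by auto
  obtain P where P: "ide P \<and> nres k P = {\<^bold>0}"
    and max: "\<And>K. ide K \<and> nres k K = {\<^bold>0} \<Longrightarrow> P \<subseteq> K \<Longrightarrow> K = P"
    by (rule ex_maximal_sub[of "\<lambda>I. ide I \<and> nres k I = {\<^bold>0}" "{\<^bold>0}"]) (use z ide_zero ide_sub in auto)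
  have "I \<subseteq> P" if I: "ide I" "nres k I = {\<^bold>0}" for I
  proof -
    have "nres k (P [+] I) = {\<^bold>0}"
      by (rule nres_ssum_zero[OF alg_carrier])
        (use P I sub_carrier[OF ide_sub] ide_br ide_alg in auto)
    then have "P [+] I = P"
      using max[of "P [+] I"] ide_ssum[of P I] ssum_upper1[OF ide_sub ide_sub, of P I] P I by blast
    then show ?thesis using ssum_upper2[OF ide_sub ide_sub, of P I] P I by auto
  qed
  then show ?thesis unfolding nres_radical_def using P by blast
qed

lemma nilradical_eq:
  assumes "nres_radical 1 P" shows "nilradical F L = P"
  unfolding nilradical_def
proof (rule Greatest_equality)
  show "ide P \<and> lie_nilpotent F (L\<lparr>carrier := P\<rparr>)"
    using assms lie_nilpotent_iff[OF ide_alg, of P] unfolding nres_radical_def by blast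
  show "J \<subseteq> P" if "ide J \<and> lie_nilpotent F (L\<lparr>carrier := J\<rparr>)" for J
    using assms that lie_nilpotent_iff[OF ide_alg, of J] unfolding nres_radical_def by blast
qed

text \<open>An ideal \<open>V\<close> is nilpotent modulo \<open>P\<close> iff
  \<open>nres 1 V\<close> lies in \<open>P\<close>, which by the choice of \<open>P\<close> means
  that \<open>nres (Suc k) V\<close> is 0. So \<open>P'\<close> maps onto the nilradical of the
  quotient.\<close>

lemma upper_nilpotent_Suc:
  assumes P: "nres_radical k P" and P': "nres_radical (Suc k) P'"
  shows "{x \<in> carrier L. P +>\<^bsub>L\<^esub> x \<in> nilradical F (lie_quotient L P)} = P'"
proof -
  have iP: "ide P" "ide P'" using P P' unfolding nres_radical_def by auto
  interpret q: lie_quot F L P using iP(1) by unfold_locales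
  interpret e: lie_epi F L "lie_quotient L P" q.pr by (rule q.lie_epi_quot)
  interpret Q: fd_lie F "lie_quotient L P" using e.fd_image[OF fd] by unfold_locales
  have img: "q.pr ` V = {\<zero>\<^bsub>lie_quotient L P\<^esub>} \<longleftrightarrow> V \<subseteq> P" if "sub V" for V
    using sub_zero[OF that] sub_carrier[OF that] q.coset_zero_iff unfolding q.quot_zero
    by (auto simp: subset_iff)
  have im: "lie_nres F (lie_quotient L P) 1 (q.pr ` V) = {\<zero>\<^bsub>lie_quotient L P\<^esub>} \<longleftrightarrow> nres 1 V \<subseteq> P"
    if "alg V" for V
    using e.nres_image[OF fd that, of 1] img[OF sub_nres[OF that, of 1]] by simp
  have nk: "nres (Suc k) V = nres k (nres 1 V)" for V using nres_add[of k 1] by simp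
  have "Q.nres_radical 1 (q.pr ` P')"
    unfolding Q.nres_radical_def
  proof (intro conjI allI impI)
    show "lie_ideal F (lie_quotient L P) (q.pr ` P')" by (rule e.ide_image[OF iP(2)])
    have "nres 1 P' \<subseteq> P"
      using P P' nk[of P'] ide_nres[OF iP(2), of 1] unfolding nres_radical_def by auto
    then show "lie_nres F (lie_quotient L P) 1 (q.pr ` P') = {\<zero>\<^bsub>lie_quotient L P\<^esub>}"
      using im[OF ide_alg[OF iP(2)]] by blast
    fix X assume X: "lie_ideal F (lie_quotient L P) X"
      and nX: "lie_nres F (lie_quotient L P) 1 X = {\<zero>\<^bsub>lie_quotient L P\<^esub>}"
    define J where "J = {x \<in> carrier L. q.pr x \<in> X}"
    have J: "ide J" unfolding J_def by (rule e.ide_vimage[OF X])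
    have XJ: "X = q.pr ` J"
      unfolding J_def using e.image_vimage[OF e.Q.sub_carrier[OF e.Q.ide_sub[OF X]]] by simp
    have "nres 1 J \<subseteq> P" using nX im[OF ide_alg[OF J]] unfolding XJ by blast
    then have "nres (Suc k) J \<subseteq> nres k P"
      unfolding nk by (rule nres_mono[OF alg_nres[OF ide_alg[OF J]] ide_alg[OF iP(1)]])
    then have "nres (Suc k) J = {\<^bold>0}"
      using P sub_zero[OF sub_nres[OF ide_alg[OF J]], of "Suc k"] unfolding nres_radical_def by auto
    then have "J \<subseteq> P'" using P' J unfolding nres_radical_def by blast
    then show "X \<subseteq> q.pr ` P'" unfolding XJ by blast
  qed
  then have "nilradical F (lie_quotient L P) = q.pr ` P'" by (rule Q.nilradical_eq)
  moreover have "P \<subseteq> P'"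
    using P P' nres_zero[OF ide_alg[OF iP(1)], of k "Suc k"] unfolding nres_radical_def by auto
  then have "x \<in> P'" if x: "x \<in> carrier L" and y: "y \<in> P'" "q.pr x = q.pr y" for x y
  proof -
    note c = sub_mem[OF ide_sub[OF iP(2)] y(1)]
    have "x \<^bold>+ \<^bold>- y \<in> P'" using q.coset_eq_iff[OF x c] y(2) \<open>P \<subseteq> P'\<close> by blast
    then have "(x \<^bold>+ \<^bold>- y) \<^bold>+ y \<in> P'" using sub_add[OF ide_sub[OF iP(2)]] y(1) by blast
    moreover have "(x \<^bold>+ \<^bold>- y) \<^bold>+ y = x" using x c by algebra
    ultimately show ?thesis by simp
  qed
  ultimately show ?thesis using sub_mem[OF ide_sub[OF iP(2)]] by auto
qed

lemma upper_nilpotent_radical: "nres_radical k (upper_nilpotent F L k)"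
proof (induction k)
  case 0
  then show ?case unfolding nres_radical_def using ide_zero by auto
next
  case (Suc k)
  obtain P' where "nres_radical (Suc k) P'" using nres_radical_ex by blast
  then show ?case using upper_nilpotent_Suc[OF Suc] by simp
qed

lemma upper_nilpotent_eq_carrier: "upper_nilpotent F L k = carrier L \<longleftrightarrow> nres k (carrier L) = {\<^bold>0}"
proof
  assume "upper_nilpotent F L k = carrier L"
  then show "nres k (carrier L) = {\<^bold>0}"
    using upper_nilpotent_radical[of k] unfolding nres_radical_def by simp
next
  assume "nres k (carrier L) = {\<^bold>0}"
  then have "carrier L \<subseteq> upper_nilpotent F L k" "ide (upper_nilpotent F L k)"
    using upper_nilpotent_radical[of k] ide_carrier unfolding nres_radical_def by auto
  then show "upper_nilpotent F L k = carrier L" using sub_carrier[OF ide_sub] by blast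
qed

lemma lie_core_props:
  assumes M: "sub M"
  shows "ide (lie_core F L M)" "lie_core F L M \<subseteq> M" "\<And>I. ide I \<Longrightarrow> I \<subseteq> M \<Longrightarrow> I \<subseteq> lie_core F L M"
proof -
  obtain P where P: "ide P \<and> P \<subseteq> M" and max: "\<And>K. ide K \<and> K \<subseteq> M \<Longrightarrow> P \<subseteq> K \<Longrightarrow> K = P"
    by (rule ex_maximal_sub[of "\<lambda>I. ide I \<and> I \<subseteq> M" "{\<^bold>0}"])
      (use sub_zero[OF M] ide_zero ide_sub in auto)
  have *: "I \<subseteq> P" if I: "ide I" "I \<subseteq> M" for I
  proof -
    have "P [+] I \<subseteq> M" using P I by (intro ssum_least[OF M]) auto
    then have "P [+] I = P"
      using max[of "P [+] I"] ide_ssum[of P I] ssum_upper1[OF ide_sub ide_sub, of P I] P I by blast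
    then show ?thesis using ssum_upper2[OF ide_sub ide_sub, of P I] P I by auto
  qed
  have "lie_core F L M = P"
    unfolding lie_core_def using P * by (intro Greatest_equality) auto
  then show "ide (lie_core F L M)" "lie_core F L M \<subseteq> M" "\<And>I. ide I \<Longrightarrow> I \<subseteq> M \<Longrightarrow> I \<subseteq> lie_core F L M"
    using P * by auto
qed

end

context solv_lie
begin

lemma nilpotent_length_le_iff: "nilpotent_length_le F k L \<longleftrightarrow> nres k (carrier L) = {\<^bold>0}"
proof -
  have "nilpotent_length F L \<le> k \<longleftrightarrow> nres k (carrier L) = {\<^bold>0}"
    unfolding nilpotent_length_def upper_nilpotent_eq_carrier
    using LeastI_ex[OF nres_terminates] nres_zero[OF alg_carrier] Least_le[of "\<lambda>m. nres m (carrier L) = {\<^bold>0}" k]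
    by blast
  then show ?thesis unfolding nilpotent_length_le_def using lie_algebra_axioms fd solv by blast
qed

text \<open>Class 0 means that the nilradical is 0, whereas the last nonzero term of the lower
  nilpotent series of a nonzero solvable algebra would be a nilpotent ideal.\<close>

lemma trivial_if_class_zero:
  assumes "nilpotency_class F (L\<lparr>carrier := nilradical F L\<rparr>) = 0"
  shows "carrier L = {\<^bold>0}"
proof -
  obtain N where N: "nres_radical 1 N" using nres_radical_ex by blast
  then have N': "ide N" "nres 1 N = {\<^bold>0}" "\<And>I. ide I \<Longrightarrow> nres 1 I = {\<^bold>0} \<Longrightarrow> I \<subseteq> N"
    unfolding nres_radical_def by auto
  have "\<exists>r. lc N r = {\<^bold>0}"
    using N'(2) resid_eq_lc[OF ide_alg[OF N'(1)], of stab] by auto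
  then have "lc N (LEAST r. lc N r = {\<^bold>0}) = {\<^bold>0}" by (rule LeastI_ex)
  then have N0: "N = {\<^bold>0}"
    using assms unfolding nilradical_eq[OF N] nilpotency_class_def lower_central_restrict[OF ide_alg[OF N'(1)]]
    by simp
  define j where "j = (LEAST j. nres j (carrier L) = {\<^bold>0})"
  have j: "nres j (carrier L) = {\<^bold>0}" unfolding j_def by (rule LeastI_ex[OF nres_terminates])
  show ?thesis
  proof (cases j)
    case (Suc i)
    have "nres 1 (nres i (carrier L)) = {\<^bold>0}" using j Suc by simp
    then have "nres i (carrier L) \<subseteq> {\<^bold>0}" using N'(3)[OF ide_nres[OF ide_carrier]] N0 by blast
    then have "nres i (carrier L) = {\<^bold>0}" using sub_zero[OF sub_nres[OF alg_carrier]] by blast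
    then have "j \<le> i" unfolding j_def by (rule Least_le)
    then show ?thesis using Suc by simp
  qed (use j in simp)
qed

end

section \<open>Transfer to the quotient\<close>

lemma (in field) field_char_two:
  assumes "\<one> \<oplus> \<one> = \<zero>" shows "field_char R = 2"
proof -
  have "\<one> [^]\<^bsub>add_monoid R\<^esub> (2::nat) = \<one>\<^bsub>add_monoid R\<^esub>"
    using assms by (simp add: numeral_2_eq_2)
  then have "field_char R dvd 2" unfolding field_char_def using group.pow_eq_id[OF a_group, of \<one> 2] by simp
  moreover have "field_char R \<noteq> 1" unfolding field_char_def using group.ord_eq_1[OF a_group, of \<one>] by simp
  ultimately show ?thesis by (metis two_is_prime_nat prime_nat_iff)
qed

lemma (in lie_algebra) nres_eq_zero_if_length_le:
  assumes "alg U" "nilpotent_length_le F k (L\<lparr>carrier := U\<rparr>)"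
  shows "nres k U = {\<^bold>0}"
proof -
  interpret U: solv_lie F "L\<lparr>carrier := U\<rparr>"
    using assms(2) unfolding nilpotent_length_le_def
    by (intro solv_lie.intro fd_lie.intro fd_lie_axioms.intro solv_lie_axioms.intro) auto
  show ?thesis
    using assms(2) U.nilpotent_length_le_iff[of k] nres_restrict[OF assms(1,1), of k] by simp
qed

lemma (in lie_epi) lie_epi_restrict:
  assumes W: "lie_subalgebra F K W"
  shows "lie_epi F (L\<lparr>carrier := {x \<in> carrier L. f x \<in> W}\<rparr>) (K\<lparr>carrier := W\<rparr>) f"
  using image_vimage[OF Q.sub_carrier[OF Q.alg_sub[OF W]]]
  by (intro lie_epi.intro lie_epi_axioms.intro A.lie_algebra_restrict Q.lie_algebra_restrict alg_vimage W)
    (auto simp: add smult bracket)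

text \<open>Subalgebras of the image correspond to those above the kernel, and a residual vanishes
  in the image iff it lies in the kernel upstairs. Finite dimension and solvability pass from the
  preimage \<open>U\<close> to \<open>W\<close>.\<close>

lemma (in lie_epi) minimal_non_N_le_image:
  assumes L: "finite_dimensional F L" "lie_solvable F L"
    and sub: "\<And>U. lie_subalgebra F L U \<Longrightarrow> U \<noteq> carrier L \<Longrightarrow>
      finite_dimensional F (L\<lparr>carrier := U\<rparr>) \<and> lie_solvable F (L\<lparr>carrier := U\<rparr>)"
    and proper: "\<And>U. lie_subalgebra F L U \<Longrightarrow> {x \<in> carrier L. f x = \<zero>\<^bsub>K\<^esub>} \<subseteq> U \<Longrightarrow> U \<noteq> carrier L \<Longrightarrow>
      lie_nres F L l U \<subseteq> {x \<in> carrier L. f x = \<zero>\<^bsub>K\<^esub>}"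
    and nonzero: "\<not> lie_nres F L l (carrier L) \<subseteq> {x \<in> carrier L. f x = \<zero>\<^bsub>K\<^esub>}"
  shows "minimal_non_N_le F l K"
proof -
  interpret K: solv_lie F K
    using fd_image[OF L(1)] solvable_image[OF L(2)] by unfold_locales
  have "nilpotent_length_le F l (K\<lparr>carrier := W\<rparr>)" if W: "lie_subalgebra F K W" "W \<noteq> carrier K" for W
  proof -
    define U where "U = {x \<in> carrier L. f x \<in> W}"
    interpret R: lie_epi F "L\<lparr>carrier := U\<rparr>" "K\<lparr>carrier := W\<rparr>" f
      unfolding U_def by (rule lie_epi_restrict[OF W(1)])
    have im: "f ` U = W"
      unfolding U_def by (rule image_vimage[OF Q.sub_carrier[OF Q.alg_sub[OF W(1)]]])
    have U: "lie_subalgebra F L U" unfolding U_def by (rule alg_vimage[OF W(1)])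
    have UL: "U \<noteq> carrier L" using im surj W(2) by auto
    interpret W: solv_lie F "K\<lparr>carrier := W\<rparr>"
      using sub[OF U UL] R.fd_image R.solvable_image
      by (intro solv_lie.intro fd_lie.intro fd_lie_axioms.intro solv_lie_axioms.intro R.Q.lie_algebra_axioms) auto
    have "{x \<in> carrier L. f x = \<zero>\<^bsub>K\<^esub>} \<subseteq> U" unfolding U_def using Q.sub_zero[OF Q.alg_sub[OF W(1)]] by auto
    then have "f ` lie_nres F L l U \<subseteq> {\<zero>\<^bsub>K\<^esub>}" using proper[OF U _ UL] by blast
    then have "lie_nres F K l W \<subseteq> {\<zero>\<^bsub>K\<^esub>}" using nres_image[OF L(1) U, of l] im by simp
    then have "lie_nres F K l W = {\<zero>\<^bsub>K\<^esub>}" using Q.sub_zero[OF Q.sub_nres[OF W(1), of l]] by blast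
    then show ?thesis
      using W.nilpotent_length_le_iff[of l] Q.nres_restrict[OF W(1,1), of l] by simp
  qed
  moreover have "\<not> nilpotent_length_le F l K"
  proof
    assume "nilpotent_length_le F l K"
    then have "f ` lie_nres F L l (carrier L) = {\<zero>\<^bsub>K\<^esub>}"
      using K.nilpotent_length_le_iff[of l] nres_image[OF L(1) A.alg_carrier, of l] surj by simp
    then show False using nonzero A.sub_carrier[OF A.sub_nres[OF A.alg_carrier, of l]] by blast
  qed
  ultimately show ?thesis
    unfolding minimal_non_N_le_def using Q.lie_algebra_axioms K.fd K.solv by blast
qed

text \<open>Minimality compares the images of \<open>I\<close> and \<open>A\<close> in the quotient
  by \<open>B\<close>; both ideals contain \<open>B\<close> and are recovered from their
  images.\<close>

lemma (in lie_algebra) chief_factor_irreducible: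
  assumes "chief_factor F L A B" "ide I" "B \<subseteq> I" "I \<subseteq> A"
  shows "I = B \<or> I = A"
proof -
  have AB: "ide A" "ide B" "B \<subseteq> A"
    and min: "minimal_lie_ideal F (lie_quotient L B) (carrier (lie_quotient (L\<lparr>carrier := A\<rparr>) B))"
    using assms(1) unfolding chief_factor_def by auto
  interpret q: lie_quot F L B using AB(2) by unfold_locales
  interpret e: lie_epi F L "lie_quotient L B" q.pr by (rule q.lie_epi_quot)
  have im: "carrier (lie_quotient (L\<lparr>carrier := A\<rparr>) B) = q.pr ` A"
    unfolding lie_quotient_def by (auto simp: A_RCOSETS_def' a_r_coset_def')
  have c: "I \<subseteq> carrier L" "A \<subseteq> carrier L" using assms(2) AB sub_carrier[OF ide_sub] by auto
  have "lie_ideal F (lie_quotient L B) (q.pr ` I)" "q.pr ` I \<subseteq> q.pr ` A"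
    using e.ide_image[OF assms(2)] assms(4) by auto
  then consider "q.pr ` I = {B}" | "q.pr ` I = q.pr ` A"
    using min unfolding minimal_lie_ideal_def im q.quot_zero by blast
  then show ?thesis
  proof cases
    case 1
    have "x \<in> B" if x: "x \<in> I" for x
    proof -
      have "q.pr x = B" using x 1 by blast
      then show ?thesis using q.coset_zero_iff[of x] x c(1) by blast
    qed
    then show ?thesis using assms(3) by blast
  next
    case 2
    have "x \<in> I" if x: "x \<in> A" for x
    proof -
      have "q.pr x \<in> q.pr ` I" using x 2 by blast
      then obtain y where y: "y \<in> I" "q.pr x = q.pr y" by blast
      have xy: "x \<in> carrier L" "y \<in> carrier L" using x y c by auto
      have "x \<^bold>+ \<^bold>- y \<in> I" using q.coset_eq_iff[OF xy] y(2) assms(3) by blast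
      then have "(x \<^bold>+ \<^bold>- y) \<^bold>+ y \<in> I" using sub_add[OF ide_sub[OF assms(2)]] y(1) by blast
      moreover have "(x \<^bold>+ \<^bold>- y) \<^bold>+ y = x" using xy by algebra
      ultimately show ?thesis by simp
    qed
    then show ?thesis using assms(4) by blast
  qed
qed

lemma (in min_non_N) exists_minimal_quotient_length:
  assumes sub: "\<And>U. alg U \<Longrightarrow> U \<noteq> carrier L \<Longrightarrow> lie_solvable F (L\<lparr>carrier := U\<rparr>)"
    and fdim: "\<And>U. alg U \<Longrightarrow> U \<noteq> carrier L \<Longrightarrow> finite_dimensional F (L\<lparr>carrier := U\<rparr>)"
    and reg: "\<And>M. maximal_lie_subalgebra F L M \<Longrightarrow> nilregular F L (lie_core F L M)"
    and chief: "chief_factor F L A B" and compl: "complemented_factor F L A B"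
  obtains l where "\<not> nres l (carrier L) \<subseteq> B"
    and "\<And>S. alg S \<Longrightarrow> B \<subseteq> S \<Longrightarrow> S \<noteq> carrier L \<Longrightarrow> nres l S \<subseteq> B"
proof -
  have AB: "ide A" "ide B" "B \<subseteq> A" "A \<noteq> B" using chief unfolding chief_factor_def by auto
  obtain M where M: "maximal_lie_subalgebra F L M" "carrier L = A [+] M" "A \<inter> M = B"
    using compl unfolding complemented_factor_def by blast
  have aM: "alg M" "M \<noteq> carrier L" using M(1) unfolding maximal_lie_subalgebra_def by auto
  show ?thesis
  proof (cases "nres k (carrier L) \<subseteq> B")
    case False
    then show ?thesis using that[of k] proper sub_zero[OF ide_sub[OF AB(2)]] by simp
  next
    case True
    show ?thesis
    proof (cases "\<one> \<oplus> \<one> = \<zero>")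
      case False
      have "inv (\<one> \<oplus> \<one>) \<in> carrier F" "inv (\<one> \<oplus> \<one>) \<otimes> (\<one> \<oplus> \<one>) = \<one>"
        using False field_Units by auto
      then have "inv (\<one> \<oplus> \<one>) \<oplus> inv (\<one> \<oplus> \<one>) = \<one>" by (simp add: r_distr)
      then show ?thesis
        using quotient_minimal[OF AB(1-4) chief_factor_irreducible[OF chief] M(1-3) True \<open>inv (\<one> \<oplus> \<one>) \<in> carrier F\<close>] that
        by blast
    next
      case char2: True
      let ?C = "lie_core F L M"
      note core = lie_core_props[OF alg_sub[OF aM(1)]]
      have C: "alg ?C" "?C \<noteq> carrier L"
        using ide_alg[OF core(1)] core(2) aM sub_carrier[OF alg_sub[OF aM(1)]] by auto
      interpret C: solv_lie F "L\<lparr>carrier := ?C\<rparr>"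
        using sub[OF C] fdim[OF C]
        by (intro solv_lie.intro fd_lie.intro fd_lie_axioms.intro solv_lie_axioms.intro lie_algebra_restrict C)
      \<comment> \<open>In characteristic 2 nilregularity bounds the class by less than 1, so the
        nilradical of the core, and with it the core, is 0.\<close>
      have "nilpotency_class F ((L\<lparr>carrier := ?C\<rparr>)\<lparr>carrier := nilradical F (L\<lparr>carrier := ?C\<rparr>)\<rparr>) = 0"
        using reg[OF M(1)] field_char_two[OF char2] unfolding nilregular_def by simp
      then have "?C = {\<^bold>0}" using C.trivial_if_class_zero by simp
      moreover have "B \<subseteq> ?C" using core(3)[OF AB(2)] M(3) by blast
      ultimately have "nres k (carrier L) \<subseteq> {\<^bold>0}" using True by blast
      then show ?thesis using nonzero sub_zero[OF sub_nres[OF alg_carrier, of k]] by blast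
    qed
  qed
qed

theorem theorem4p10:
  fixes F :: "('f, 'm) ring_scheme" and L :: "('f, 'a, 'n) lie_scheme" and A B :: "'a set"
  assumes "lie_algebra F L" and "finite_dimensional F L" and "lie_solvable F L"
    and "minimal_non_N F L"
    and "\<And>M. maximal_lie_subalgebra F L M \<Longrightarrow> nilregular F L (lie_core F L M)"
    and "chief_factor F L A B" and "complemented_factor F L A B"
  shows "minimal_non_N F (lie_quotient L B)"
proof -
  interpret solv_lie F L
    using assms(1-3) by (intro solv_lie.intro fd_lie.intro fd_lie_axioms.intro solv_lie_axioms.intro)
  obtain k where len: "\<And>U. lie_subalgebra F L U \<Longrightarrow> U \<noteq> carrier L \<Longrightarrow> nilpotent_length_le F k (L\<lparr>carrier := U\<rparr>)"
    and nlen: "\<not> nilpotent_length_le F k L"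
    using assms(4) unfolding minimal_non_N_def minimal_non_N_le_def by blast
  have fds: "finite_dimensional F (L\<lparr>carrier := U\<rparr>) \<and> lie_solvable F (L\<lparr>carrier := U\<rparr>)"
    if "lie_subalgebra F L U" "U \<noteq> carrier L" for U
    using len[OF that] unfolding nilpotent_length_le_def by blast
  interpret min_non_N F L k
    using nres_eq_zero_if_length_le len nlen nilpotent_length_le_iff by unfold_locales auto
  have B: "lie_ideal F L B" using assms(6) unfolding chief_factor_def by blast
  interpret q: lie_quot F L B using B by unfold_locales
  interpret e: lie_epi F L "lie_quotient L B" q.pr by (rule q.lie_epi_quot)
  have ker: "{x \<in> carrier L. q.pr x = \<zero>\<^bsub>lie_quotient L B\<^esub>} = B"
    unfolding q.quot_zero using q.coset_zero_iff sub_carrier[OF ide_sub[OF B]] by blast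
  obtain l where "\<not> lie_nres F L l (carrier L) \<subseteq> B"
    "\<And>S. lie_subalgebra F L S \<Longrightarrow> B \<subseteq> S \<Longrightarrow> S \<noteq> carrier L \<Longrightarrow> lie_nres F L l S \<subseteq> B"
    using exists_minimal_quotient_length[OF _ _ assms(5-7)] fds by blast
  then have "minimal_non_N_le F l (lie_quotient L B)"
    using e.minimal_non_N_le_image[OF assms(2,3) fds] unfolding ker by blast
  then show ?thesis unfolding minimal_non_N_def by blast
qed

end
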